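(* Let $\mathbb{FP}^{d-1}$ be one of the projective spaces $\mathbb{RP}^{d-1}$, $\mathbb{CP}^{d-1}$, $\mathbb{HP}^{d-1}$ ($d\ge 2$) or $\mathbb{OP}^2$ (where $d=3$), with normalised geodesic metric $\vartheta$ and associated parameters $\alpha,\beta$. Let $(X_N)_{N\in\mathbb{N}}$ be a sequence of finite point sets in $\mathbb{FP}^{d-1}$ with $\lim_{N\to\infty}\#X_N=\infty$ that is hyperuniform for large balls. Then $(X_N)_{N\in\mathbb{N}}$ is uniformly distributed. More precisely, for all integers $n\ge 1$, $$\lim_{N\to\infty}\frac{1}{\#X_N}\sum_{x,y\in X_N}P_n^{(\alpha,\beta)}(\cos(2\vartheta(x,y)))=0,$$ where the sum runs over all ordered pairs $(x,y)\in X_N\times X_N$ (including $x=y$).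
   Context: Spaces. $\mathbb{F}\in\{\mathbb{R},\mathbb{C},\mathbb{H},\mathbb{O}\}$ with $\dim_{\mathbb{R}}(\mathbb{F})=1,2,4,8$ respectively; as homogeneous spaces $\mathbb{RP}^{d-1}\cong \mathrm{O}(d)/(\mathrm{O}(d-1)\times\mathrm{O}(1))$, $\mathbb{CP}^{d-1}\cong \mathrm{U}(d)/(\mathrm{U}(d-1)\times\mathrm{U}(1))$, $\mathbb{HP}^{d-1}\cong \mathrm{Sp}(d)/(\mathrm{Sp}(d-1)\times\mathrm{Sp}(1))$, $\mathbb{OP}^2\cong \mathrm{F}_4/\mathrm{Spin}(9)$. The real dimension is $D=(d-1)\dim_{\mathbb{R}}(\mathbb{F})$ and the parameters are $\alpha=\frac{d-1}{2}\dim_{\mathbb{R}}(\mathbb{F})-1$, $\beta=\frac12\dim_{\mathbb{R}}(\mathbb{F})-1$. Metric and measure. $\vartheta$ is the invariant geodesic metric, normalised to take values in $[0,\frac{\pi}{2}]$. (Concretely, for $\mathbb{F}=\mathbb{R},\mathbb{C},\mathbb{H}$, points are $\mathbb{F}$-lines in $\mathbb{F}^d$ and $\cos\vartheta=|\langle u,v\rangle|$ for unit vectors $u,v$ spanning the lines; for $\mathbb{OP}^2$, points are the idempotents $P$ of trace $1$ in the Albert algebra of Hermitian $3\times 3$ octonionic matrices and $\cos^2\vartheta(P,Q)=\mathrm{Tr}(P\circ Q)$.) $\sigma$ is the normalised (probability) surface measure, invariant under the isometry group. $B(x,r)=\{y\in\mathbb{FP}^{d-1}\mid\vartheta(x,y)<r\}$;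 its measure $\sigma(B(x,r))$ does not depend on $x$. $P_n^{(\alpha,\beta)}$ denotes the Jacobi polynomial of degree $n$ with parameters $\alpha,\beta$ (standard normalisation). Number variance. For a finite set $X_N$, $$\mathbb{V}(X_N,r)=\int_{\mathbb{FP}^{d-1}}\Big(\sum_{y\in X_N}\mathbb{1}_{B(x,r)}(y)-\#X_N\,\sigma(B(x,r))\Big)^2d\sigma(x).$$ Hyperuniform for large balls: for every $r\in(0,\frac{\pi}{2})$, $\mathbb{V}(X_N,r)=o(\#X_N)$ as $N\to\infty$. Uniformly distributed: for all $x\in\mathbb{FP}^{d-1}$ and $r\in[0,\frac{\pi}{2}]$, $\lim_{N\to\infty}\frac{1}{\#X_N}\sum_{y\in X_N}\mathbb{1}_{B(x,r)}(y)=\sigma(B(x,r))$. *)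

theory Defs
  imports "HOL-Probability.Probability"
begin

text \<open>
  The quaternions and the octonions are obtained by Cayley-Dickson doubling,
  \<open>(a, b) (c, d) = (a c - d\<^sup>* b, d a + b c\<^sup>*)\<close> and \<open>(a, b)\<^sup>* = (a\<^sup>*, - b)\<close>,
  from the complex numbers and from the quaternions respectively.
\<close>

datatype quat = Quat (qfst: complex) (qsnd: complex)

instantiation quat :: "{real_vector, one, times, inverse}"
begin

definition "0 = Quat 0 0"
definition "1 = Quat 1 0"
definition "p + q = Quat (qfst p + qfst q) (qsnd p + qsnd q)"
definition "p - q = Quat (qfst p - qfst q) (qsnd p - qsnd q)"
definition "- q = Quat (- qfst q) (- qsnd q)"
definition "r *\<^sub>R q = Quat (r *\<^sub>R qfst q) (r *\<^sub>R qsnd q)"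
definition "p * q = Quat (qfst p * qfst q - cnj (qsnd q) * qsnd p)
                         (qsnd q * qfst p + qsnd p * cnj (qfst q))"
definition "inverse q = (1 / ((cmod (qfst q))\<^sup>2 + (cmod (qsnd q))\<^sup>2)) *\<^sub>R Quat (cnj (qfst q)) (- qsnd q)"
definition "p div q = p * inverse (q :: quat)"

instance
  by standard
    (simp_all add: zero_quat_def plus_quat_def minus_quat_def uminus_quat_def scaleR_quat_def
      algebra_simps)

end

lemmas quat_defs = zero_quat_def one_quat_def plus_quat_def minus_quat_def uminus_quat_def
  scaleR_quat_def times_quat_def inverse_quat_def divide_quat_def

instantiation quat :: real_normed_div_algebra
begin

definition "norm q = norm (qfst q, qsnd q)"
definition "sgn q = inverse (norm q) *\<^sub>R (q :: quat)"
definition "dist p q = norm (p - q :: quat)"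
definition "(uniformity :: (quat \<times> quat) filter) = (INF e\<in>{0 <..}. principal {(x, y). dist x y < e})"
definition "open (U :: quat set) \<longleftrightarrow>
  (\<forall>x\<in>U. eventually (\<lambda>(x', y). x' = x \<longrightarrow> y \<in> U) uniformity)"

instance
proof
  fix a b c :: quat and r s :: real and U :: "quat set"
  show "dist a b = norm (a - b)" by (rule dist_quat_def)
  show "sgn a = inverse (norm a) *\<^sub>R a" by (rule sgn_quat_def)
  show "uniformity = (INF e\<in>{0<..}. principal {(x, y). dist (x :: quat) y < e})"
    by (rule uniformity_quat_def)
  show "open U = (\<forall>x\<in>U. \<forall>\<^sub>F (x', y) in uniformity. x' = x \<longrightarrow> y \<in> U)"
    by (rule open_quat_def)
  show "(norm a = 0) = (a = 0)"
    by (cases a) (simp add: norm_quat_def quat_defs norm_Pair)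
  show "norm (a + b) \<le> norm a + norm b"
    using norm_triangle_ineq[of "(qfst a, qsnd a)" "(qfst b, qsnd b)"]
    by (simp add: norm_quat_def quat_defs)
  show "norm (r *\<^sub>R a) = \<bar>r\<bar> * norm a"
    using norm_scaleR[of r "(qfst a, qsnd a)"] by (simp add: norm_quat_def quat_defs)
  show "a * b * c = a * (b * c)" "(a + b) * c = a * c + b * c" "a * (b + c) = a * b + a * c"
    "r *\<^sub>R a * b = r *\<^sub>R (a * b)" "a * r *\<^sub>R b = r *\<^sub>R (a * b)" "1 * a = a" "a * 1 = a"
    "(0 :: quat) \<noteq> 1" "a div b = a * inverse b" "inverse 0 = (0 :: quat)"
    by (simp_all add: quat_defs algebra_simps)
  show "norm (a * b) = norm a * norm b"
    unfolding norm_quat_def norm_Pair real_sqrt_mult[symmetric] real_sqrt_eq_iff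
    by (simp add: quat_defs cmod_power2) algebra
  assume "a \<noteq> 0"
  define S where "S = (cmod (qfst a))\<^sup>2 + (cmod (qsnd a))\<^sup>2"
  have "S \<noteq> 0"
    using \<open>a \<noteq> 0\<close> by (cases a) (simp add: S_def quat_defs sum_power2_eq_zero_iff)
  moreover have "qfst a * cnj (qfst a) + qsnd a * cnj (qsnd a) = of_real S"
    by (simp only: S_def of_real_add complex_norm_square)
  moreover have "inverse a = (1 / S) *\<^sub>R Quat (cnj (qfst a)) (- qsnd a)"
    by (simp add: S_def inverse_quat_def)
  ultimately show "inverse a * a = 1" "a * inverse a = 1"
    by (simp_all add: one_quat_def times_quat_def scaleR_quat_def scaleR_conv_of_real field_simps)
qed

end

text \<open>Only the operations of the octonions, which are not associative, are needed.\<close>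

datatype oct = Oct (ofst: quat) (osnd: quat)

definition quat_conj :: "quat \<Rightarrow> quat" where
  "quat_conj q = Quat (cnj (qfst q)) (- qsnd q)"

instantiation oct :: "{real_vector, one, times}"
begin

definition "0 = Oct 0 0"
definition "1 = Oct 1 0"
definition "p + q = Oct (ofst p + ofst q) (osnd p + osnd q)"
definition "p - q = Oct (ofst p - ofst q) (osnd p - osnd q)"
definition "- q = Oct (- ofst q) (- osnd q)"
definition "r *\<^sub>R q = Oct (r *\<^sub>R ofst q) (r *\<^sub>R osnd q)"
definition "p * q = Oct (ofst p * ofst q - quat_conj (osnd q) * osnd p)
                        (osnd q * ofst p + osnd p * quat_conj (ofst q))"

instance
  by standard
    (simp_all add: zero_oct_def plus_oct_def minus_oct_def uminus_oct_def scaleR_oct_def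
      algebra_simps)

end

definition oct_conj :: "oct \<Rightarrow> oct" where
  "oct_conj x = Oct (quat_conj (ofst x)) (- osnd x)"

definition oct_re :: "oct \<Rightarrow> real" where
  "oct_re x = Re (qfst (ofst x))"

class conj_div_algebra = real_normed_div_algebra +
  fixes conj :: "'a \<Rightarrow> 'a"
  assumes conj_add: "conj (a + b) = conj a + conj b"
    and conj_mult: "conj (a * b) = conj b * conj a"
    and conj_conj: "conj (conj a) = a"
    and norm_conj: "norm (conj a) = norm a"

instantiation real :: conj_div_algebra
begin
definition "conj (x :: real) = x"
instance by standard (simp_all add: conj_real_def)
end

instantiation complex :: conj_div_algebra
begin
definition "conj (z :: complex) = cnj z"
instance by standard (simp_all add: conj_complex_def)
end

instantiation quat :: conj_div_algebra
begin
definition "conj (q :: quat) = quat_conj q"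
instance
  by standard (simp_all add: conj_quat_def quat_conj_def quat_defs norm_quat_def norm_Pair)
end

text \<open>
  Scalars act on the right; the Hermitian form is conjugate linear in its first argument.
\<close>

definition line :: "'f::conj_div_algebra ^ 'd \<Rightarrow> ('f ^ 'd) set" where
  "line v = {(\<chi> i. v $ i * c) |c. True}"

definition lines :: "('f::conj_div_algebra ^ 'd) set set" where
  "lines = {line v |v. v \<noteq> 0}"

definition hermitian_form :: "'f::conj_div_algebra ^ 'd \<Rightarrow> 'f ^ 'd \<Rightarrow> 'f" where
  "hermitian_form u v = (\<Sum>i\<in>UNIV. conj (u $ i) * v $ i)"

text \<open>The angle does not depend on the unit vectors, see \<open>line_angle_line\<close> below.\<close>

definition line_angle :: "('f::conj_div_algebra ^ 'd) set \<Rightarrow> ('f ^ 'd) set \<Rightarrow> real" where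
  "line_angle L M = (THE t. \<exists>u\<in>L. \<exists>v\<in>M. norm u = 1 \<and> norm v = 1 \<and>
                            t = arccos (norm (hermitian_form u v)))"

lemma norm_vec_mult_right:
  fixes v :: "'f::conj_div_algebra ^ 'd"
  shows "norm (\<chi> i. v $ i * c) = norm v * norm c"
  by (simp add: norm_vec_def norm_mult L2_set_left_distrib)

lemma norm_hermitian_form_mult_right:
  fixes u v :: "'f::conj_div_algebra ^ 'd"
  shows "norm (hermitian_form (\<chi> i. u $ i * a) (\<chi> i. v $ i * b))
    = norm a * norm (hermitian_form u v) * norm b"
proof -
  have "hermitian_form (\<chi> i. u $ i * a) (\<chi> i. v $ i * b) = conj a * hermitian_form u v * b"
    by (simp add: hermitian_form_def conj_mult sum_distrib_left sum_distrib_right mult.assoc)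
  then show ?thesis by (simp add: norm_mult norm_conj)
qed

lemma line_angle_line:
  fixes u v :: "'f::conj_div_algebra ^ 'd"
  assumes "norm u = 1" "norm v = 1"
  shows "line_angle (line u) (line v) = arccos (norm (hermitian_form u v))"
  unfolding line_angle_def
proof (rule the_equality)
  have "w \<in> line w" for w :: "'f ^ 'd"
    unfolding line_def by (auto intro!: exI[of _ 1])
  then show "\<exists>u'\<in>line u. \<exists>v'\<in>line v. norm u' = 1 \<and> norm v' = 1 \<and>
      arccos (norm (hermitian_form u v)) = arccos (norm (hermitian_form u' v'))"
    using assms by blast
next
  fix t assume "\<exists>u'\<in>line u. \<exists>v'\<in>line v. norm u' = 1 \<and> norm v' = 1 \<and>
      t = arccos (norm (hermitian_form u' v'))"
  then obtain a b where "norm (\<chi> i. u $ i * a) = 1" "norm (\<chi> i. v $ i * b) = 1"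
    and t: "t = arccos (norm (hermitian_form (\<chi> i. u $ i * a) (\<chi> i. v $ i * b)))"
    unfolding line_def by auto
  then have "norm a = 1" "norm b = 1"
    using assms by (simp_all add: norm_vec_mult_right)
  then show "t = arccos (norm (hermitian_form u v))"
    by (simp add: t norm_hermitian_form_mult_right)
qed

definition oct_mat_mult :: "oct ^ 'd ^ 'd \<Rightarrow> oct ^ 'd ^ 'd \<Rightarrow> oct ^ 'd ^ 'd" where
  "oct_mat_mult A B = (\<chi> i j. \<Sum>k\<in>UNIV. A $ i $ k * B $ k $ j)"

definition jordan_mult :: "oct ^ 'd ^ 'd \<Rightarrow> oct ^ 'd ^ 'd \<Rightarrow> oct ^ 'd ^ 'd" where
  "jordan_mult A B = (1 / 2) *\<^sub>R (oct_mat_mult A B + oct_mat_mult B A)"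

definition oct_trace :: "oct ^ 'd ^ 'd \<Rightarrow> oct" where
  "oct_trace A = (\<Sum>i\<in>UNIV. A $ i $ i)"

definition oct_hermitian :: "oct ^ 'd ^ 'd \<Rightarrow> bool" where
  "oct_hermitian A \<longleftrightarrow> (\<forall>i j. A $ i $ j = oct_conj (A $ j $ i))"

definition oct_points :: "(oct ^ 'd ^ 'd) set" where
  "oct_points = {P. oct_hermitian P \<and> jordan_mult P P = P \<and> oct_trace P = 1}"

text \<open>The trace of a Hermitian matrix is real, so no information is lost by \<open>oct_re\<close>.\<close>

definition oct_angle :: "oct ^ 'd ^ 'd \<Rightarrow> oct ^ 'd ^ 'd \<Rightarrow> real" where
  "oct_angle P Q = arccos (sqrt (oct_re (oct_trace (jordan_mult P Q))))"

text \<open>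
  The dimension \<open>d\<close> is the cardinality of the index type \<open>'d\<close>. The octonionic
  case is meaningful only for \<open>CARD('d) = 3\<close>.
\<close>

datatype scalars = Real_Scalars | Complex_Scalars | Quat_Scalars | Oct_Scalars

datatype 'd point =
    Real_Point "(real ^ 'd::finite) set"
  | Complex_Point "(complex ^ 'd) set"
  | Quat_Point "(quat ^ 'd) set"
  | Oct_Point "oct ^ 'd ^ 'd"

fun scalar_dim :: "scalars \<Rightarrow> nat" where
  "scalar_dim Real_Scalars = 1"
| "scalar_dim Complex_Scalars = 2"
| "scalar_dim Quat_Scalars = 4"
| "scalar_dim Oct_Scalars = 8"

fun proj_space :: "scalars \<Rightarrow> 'd::finite point set" where
  "proj_space Real_Scalars = Real_Point ` lines"
| "proj_space Complex_Scalars = Complex_Point ` lines"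
| "proj_space Quat_Scalars = Quat_Point ` lines"
| "proj_space Oct_Scalars = Oct_Point ` oct_points"

fun proj_dist :: "'d::finite point \<Rightarrow> 'd point \<Rightarrow> real" where
  "proj_dist (Real_Point L) (Real_Point M) = line_angle L M"
| "proj_dist (Complex_Point L) (Complex_Point M) = line_angle L M"
| "proj_dist (Quat_Point L) (Quat_Point M) = line_angle L M"
| "proj_dist (Oct_Point P) (Oct_Point Q) = oct_angle P Q"
| "proj_dist _ _ = undefined"

definition jacobi_alpha :: "scalars \<Rightarrow> nat \<Rightarrow> real" where
  "jacobi_alpha F d = (real d - 1) / 2 * real (scalar_dim F) - 1"

definition jacobi_beta :: "scalars \<Rightarrow> real" where
  "jacobi_beta F = real (scalar_dim F) / 2 - 1"

text \<open>Standard normalisation: the value at \<open>1\<close> is \<open>(n + \<alpha>) gchoose n\<close>.\<close>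

definition jacobi_poly :: "nat \<Rightarrow> real \<Rightarrow> real \<Rightarrow> real \<Rightarrow> real" where
  "jacobi_poly n \<alpha> \<beta> x =
    (\<Sum>s\<le>n. ((real n + \<alpha>) gchoose (n - s)) * ((real n + \<beta>) gchoose s)
           * ((x - 1) / 2) ^ s * ((x + 1) / 2) ^ (n - s))"

definition proj_ball :: "scalars \<Rightarrow> 'd::finite point \<Rightarrow> real \<Rightarrow> 'd point set" where
  "proj_ball F x r = {y \<in> proj_space F. proj_dist x y < r}"

definition proj_open :: "scalars \<Rightarrow> 'd::finite point set \<Rightarrow> bool" where
  "proj_open F U \<longleftrightarrow> U \<subseteq> proj_space F \<and> (\<forall>x\<in>U. \<exists>e>0. proj_ball F x e \<subseteq> U)"

definition proj_isometry :: "scalars \<Rightarrow> ('d::finite point \<Rightarrow> 'd point) \<Rightarrow> bool" where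
  "proj_isometry F T \<longleftrightarrow> bij_betw T (proj_space F) (proj_space F) \<and>
    (\<forall>x\<in>proj_space F. \<forall>y\<in>proj_space F. proj_dist (T x) (T y) = proj_dist x y)"

text \<open>
  The isometry group is compact and acts transitively, hence there is exactly one
  invariant Borel probability measure, the normalised surface measure.
\<close>

definition surface_measure :: "scalars \<Rightarrow> 'd::finite point measure \<Rightarrow> bool" where
  "surface_measure F \<sigma> \<longleftrightarrow> prob_space \<sigma> \<and> space \<sigma> = proj_space F \<and>
    sets \<sigma> = sigma_sets (proj_space F) {U. proj_open F U} \<and>
    (\<forall>T. proj_isometry F T \<longrightarrow> (\<forall>A\<in>sets \<sigma>. emeasure \<sigma> (T ` A) = emeasure \<sigma> A))"

definition number_variance ::
    "scalars \<Rightarrow> 'd::finite point measure \<Rightarrow> 'd point set \<Rightarrow> real \<Rightarrow> real" where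
  "number_variance F \<sigma> X r =
    (LINT x|\<sigma>. ((\<Sum>y\<in>X. indicator (proj_ball F x r) y)
                  - real (card X) * measure \<sigma> (proj_ball F x r))\<^sup>2)"

definition hyperuniform_large_balls ::
    "scalars \<Rightarrow> 'd::finite point measure \<Rightarrow> (nat \<Rightarrow> 'd point set) \<Rightarrow> bool" where
  "hyperuniform_large_balls F \<sigma> X \<longleftrightarrow>
    (\<forall>r\<in>{0<..<pi / 2}. (\<lambda>N. number_variance F \<sigma> (X N) r) \<in> o(\<lambda>N. real (card (X N))))"

definition uniformly_distributed ::
    "scalars \<Rightarrow> 'd::finite point measure \<Rightarrow> (nat \<Rightarrow> 'd point set) \<Rightarrow> bool" where
  "uniformly_distributed F \<sigma> X \<longleftrightarrow>
    (\<forall>x\<in>proj_space F. \<forall>r\<in>{0..pi / 2}.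
      (\<lambda>N. (\<Sum>y\<in>X N. indicator (proj_ball F x r) y) / real (card (X N)))
        \<longlonglongrightarrow> measure \<sigma> (proj_ball F x r))"

end

theory Submission
  imports Defs "HOL-Real_Asymp.Real_Asymp"
begin

text \<open>
  Let \<open>t x y = (cos (proj_dist x y))\<^sup>2\<close>, which is the inner product of the projection matrices of \<open>x\<close>
  and \<open>y\<close>.  Along a geodesic through two orthogonal points, \<open>t z\<close> is a quadratic form in
  \<open>cos \<theta>\<close> and \<open>sin \<theta>\<close> whose mixed coefficient changes sign under a reflection.  Together with two-point
  homogeneity this shows that convolution with a zonal kernel maps polynomials in \<open>t\<close> to polynomials
  in \<open>t\<close> without raising the degree, and it determines the moments of \<open>t\<close>, which are those of a beta
  distribution.  Hence the Jacobi polynomials are the orthogonal polynomials of \<open>t\<close>.  As convolution is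
  self-adjoint, each of them is an eigenfunction (Funk-Hecke formula).

  The eigenvalue of the indicator of a small ball is not zero.  The Jacobi energy of \<open>X N\<close>
  is therefore at most a constant times the number variance for one fixed small radius.  Uniform
  distribution follows from the variance bound by averaging over small balls of centres, because
  spheres are null sets.

  Lines over the reals, complex numbers and quaternions are two-point homogeneous by generalised
  Householder reflections.  In the octonionic plane the real orthogonal matrices and the maps given by
  the Moufang identities suffice.
\<close>

section \<open>Two-point homogeneous spaces\<close>

text \<open>The usual route through Laplace eigenfunctions, addition formulas and polar coordinates
  would have to be set up for each kind of scalars, and lines make no sense over the non-associative
  octonions. All four spaces are therefore reduced to one list of algebraic facts about unit vectors
  \<open>\<iota> x\<close> in a Euclidean space. The law of \<open>t\<close> is not computed
  geometrically. Its moments satisfy three linear relations: one from their constancy along the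
  curve through two orthogonal points, one from averaging over \<open>card K\<close> isometries that
  turn an off-diagonal entry, one from an orthogonal frame whose inner products with a point sum to
  1. The number \<open>card K\<close> is how the dimension of the scalars enters \<alpha> and
  \<beta>. The radius in the energy bound depends on the degree: a Jacobi polynomial is positive at
  1, hence on a whole cap around the centre, and the eigenvalue of that cap cannot vanish. The radii
  0 and \<open>pi / 2\<close> lie outside the hyperuniformity hypothesis; there the ball is empty or
  has full measure.\<close>

definition inner_isometry :: "'p set \<Rightarrow> ('p \<Rightarrow> 'e::real_inner) \<Rightarrow> ('p \<Rightarrow> 'p) \<Rightarrow> bool" where
  "inner_isometry S \<iota> T \<longleftrightarrow> bij_betw T S S \<and> (\<forall>x\<in>S. \<forall>y\<in>S. \<iota> (T x) \<bullet> \<iota> (T y) = \<iota> x \<bullet> \<iota> y)"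

text \<open>Distances enter only through inner products, which in the models are squared moduli,
  whence \<open>inner_nonneg\<close>. The point type carries no topology, so \<open>sets_eq\<close>
  spells out the Borel sets of the metric pulled back along \<open>\<iota>\<close>.\<close>

locale two_point_homogeneous = prob_space \<sigma>
  for \<sigma> :: "'p measure" +
  fixes \<iota> :: "'p \<Rightarrow> 'e::euclidean_space"
  assumes norm_embed: "x \<in> space \<sigma> \<Longrightarrow> norm (\<iota> x) = 1"
    and inner_nonneg: "x \<in> space \<sigma> \<Longrightarrow> y \<in> space \<sigma> \<Longrightarrow> 0 \<le> \<iota> x \<bullet> \<iota> y"
    and sets_eq: "sets \<sigma> = sigma_sets (space \<sigma>)
      {U. U \<subseteq> space \<sigma> \<and> (\<forall>x\<in>U. \<exists>e>0. \<forall>y\<in>space \<sigma>. dist (\<iota> x) (\<iota> y) < e \<longrightarrow> y \<in> U)}"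
    and invariant: "inner_isometry (space \<sigma>) \<iota> T \<Longrightarrow> A \<in> sets \<sigma> \<Longrightarrow> emeasure \<sigma> (T ` A) = emeasure \<sigma> A"
    and two_point: "x \<in> space \<sigma> \<Longrightarrow> y \<in> space \<sigma> \<Longrightarrow> x' \<in> space \<sigma> \<Longrightarrow> y' \<in> space \<sigma> \<Longrightarrow>
      \<iota> x \<bullet> \<iota> y = \<iota> x' \<bullet> \<iota> y' \<Longrightarrow> \<exists>T. inner_isometry (space \<sigma>) \<iota> T \<and> T x = x' \<and> T y = y'"
begin

section \<open>Isometries and invariance of integrals\<close>

abbreviation t :: "'p \<Rightarrow> 'p \<Rightarrow> real" where
  "t x y \<equiv> \<iota> x \<bullet> \<iota> y"

abbreviation isom :: "('p \<Rightarrow> 'p) \<Rightarrow> bool" where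
  "isom \<equiv> inner_isometry (space \<sigma>) \<iota>"

lemma isom_space: "isom T \<Longrightarrow> x \<in> space \<sigma> \<Longrightarrow> T x \<in> space \<sigma>"
  by (auto simp: inner_isometry_def bij_betw_def)

lemma isom_inner: "isom T \<Longrightarrow> x \<in> space \<sigma> \<Longrightarrow> y \<in> space \<sigma> \<Longrightarrow> t (T x) (T y) = t x y"
  by (auto simp: inner_isometry_def)

lemma t_self: "x \<in> space \<sigma> \<Longrightarrow> t x x = 1"
  using norm_embed[of x] by (simp add: norm_eq_1)

lemma t_le_1: "x \<in> space \<sigma> \<Longrightarrow> y \<in> space \<sigma> \<Longrightarrow> t x y \<le> 1"
  using norm_cauchy_schwarz[of "\<iota> x" "\<iota> y"] by (simp add: norm_embed)

lemma t_range: "x \<in> space \<sigma> \<Longrightarrow> y \<in> space \<sigma> \<Longrightarrow> t x y \<in> {0..1}"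
  by (simp add: t_le_1 inner_nonneg)

lemma dist_embed:
  assumes "x \<in> space \<sigma>" "y \<in> space \<sigma>"
  shows "(dist (\<iota> x) (\<iota> y))\<^sup>2 = 2 - 2 * t x y"
  using assms by (simp add: dist_norm power2_norm_eq_inner algebra_simps t_self inner_commute)

text \<open>Moving a centre by \<open>d\<close> costs at most \<open>d\<close> in the threshold of a
  cap. The averaging over centres rests on this Lipschitz bound.\<close>

lemma t_diff_le:
  assumes "x \<in> space \<sigma>" "x' \<in> space \<sigma>" "y \<in> space \<sigma>"
  shows "\<bar>t x y - t x' y\<bar> \<le> dist (\<iota> x) (\<iota> x')"
  using Cauchy_Schwarz_ineq2[of "\<iota> x - \<iota> x'" "\<iota> y"] assms
  by (simp add: inner_diff_left norm_embed dist_norm)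

lemma measurable_embed [measurable]: "\<iota> \<in> borel_measurable \<sigma>"
proof (rule borel_measurableI)
  fix V :: "'e set" assume "open V"
  have "\<iota> -` V \<inter> space \<sigma> \<in> {U. U \<subseteq> space \<sigma> \<and>
      (\<forall>x\<in>U. \<exists>e>0. \<forall>y\<in>space \<sigma>. dist (\<iota> x) (\<iota> y) < e \<longrightarrow> y \<in> U)}"
  proof safe
    fix x assume "\<iota> x \<in> V"
    then obtain e where "e > 0" "\<And>y. dist y (\<iota> x) < e \<Longrightarrow> y \<in> V"
      using \<open>open V\<close> unfolding open_dist by blast
    then show "\<exists>e>0. \<forall>y\<in>space \<sigma>. dist (\<iota> x) (\<iota> y) < e \<longrightarrow> y \<in> \<iota> -` V \<inter> space \<sigma>"
      by (auto simp: dist_commute)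
  qed
  then show "\<iota> -` V \<inter> space \<sigma> \<in> sets \<sigma>"
    unfolding sets_eq by (rule sigma_sets.Basic)
qed

lemma measurable_isom:
  assumes "isom T"
  shows "T \<in> measurable \<sigma> \<sigma>"
proof (rule measurable_sigma_sets[OF sets_eq])
  show "T \<in> space \<sigma> \<rightarrow> space \<sigma>" using isom_space[OF assms] by auto
  fix U assume U: "U \<in> {U. U \<subseteq> space \<sigma> \<and>
      (\<forall>x\<in>U. \<exists>e>0. \<forall>y\<in>space \<sigma>. dist (\<iota> x) (\<iota> y) < e \<longrightarrow> y \<in> U)}"
  have d: "dist (\<iota> (T x)) (\<iota> (T y)) = dist (\<iota> x) (\<iota> y)" if "x \<in> space \<sigma>" "y \<in> space \<sigma>" for x y
    using dist_embed[of x y] dist_embed[of "T x" "T y"] that isom_space[OF assms] isom_inner[OF assms]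
    by (metis power2_eq_iff_nonneg zero_le_dist)
  have "T -` U \<inter> space \<sigma> \<in> {U. U \<subseteq> space \<sigma> \<and>
      (\<forall>x\<in>U. \<exists>e>0. \<forall>y\<in>space \<sigma>. dist (\<iota> x) (\<iota> y) < e \<longrightarrow> y \<in> U)}"
  proof safe
    fix x assume "T x \<in> U" "x \<in> space \<sigma>"
    then obtain e where "e > 0" "\<forall>y\<in>space \<sigma>. dist (\<iota> (T x)) (\<iota> y) < e \<longrightarrow> y \<in> U"
      using U by blast
    then show "\<exists>e>0. \<forall>y\<in>space \<sigma>. dist (\<iota> x) (\<iota> y) < e \<longrightarrow> y \<in> T -` U \<inter> space \<sigma>"
      using \<open>x \<in> space \<sigma>\<close> by (auto intro!: exI[of _ e] simp: d isom_space[OF assms])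
  qed
  then show "T -` U \<inter> space \<sigma> \<in> sets \<sigma>"
    unfolding sets_eq by (rule sigma_sets.Basic)
qed auto

text \<open>\<open>invariant\<close> speaks of images, \<open>distr\<close> of preimages;
  bijectivity on the space turns one into the other.\<close>

lemma distr_isom:
  assumes "isom T"
  shows "distr \<sigma> \<sigma> T = \<sigma>"
proof (rule measure_eqI)
  fix A assume "A \<in> sets (distr \<sigma> \<sigma> T)"
  then have A: "A \<in> sets \<sigma>" by simp
  have "T ` (T -` A \<inter> space \<sigma>) = A"
  proof (intro equalityI subsetI)
    fix y assume y: "y \<in> A"
    then have "y \<in> T ` space \<sigma>"
      using assms sets.sets_into_space[OF A] unfolding inner_isometry_def bij_betw_def by auto
    then show "y \<in> T ` (T -` A \<inter> space \<sigma>)" using y by auto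
  qed auto
  moreover have "T -` A \<inter> space \<sigma> \<in> sets \<sigma>"
    by (rule measurable_sets[OF measurable_isom[OF assms] A])
  ultimately have "emeasure \<sigma> A = emeasure \<sigma> (T -` A \<inter> space \<sigma>)"
    using invariant[OF assms] by metis
  then show "emeasure (distr \<sigma> \<sigma> T) A = emeasure \<sigma> A"
    by (simp add: emeasure_distr[OF measurable_isom[OF assms] A])
qed simp

lemma integral_isom:
  fixes f :: "'p \<Rightarrow> real"
  assumes "isom T" "f \<in> borel_measurable \<sigma>"
  shows "(\<integral>z. f (T z) \<partial>\<sigma>) = (\<integral>z. f z \<partial>\<sigma>)"
  using integral_distr[OF measurable_isom[OF assms(1)] assms(2)] distr_isom[OF assms(1)] by simp

lemma transitive:
  assumes "x \<in> space \<sigma>" "y \<in> space \<sigma>"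
  obtains T where "isom T" "T x = y"
  using two_point[of x x y y] assms t_self by metis

section \<open>Bounded measurable functions and zonal integrals\<close>

definition bounded_measurable :: "('p \<Rightarrow> real) \<Rightarrow> bool" where
  "bounded_measurable f \<longleftrightarrow> f \<in> borel_measurable \<sigma> \<and> (\<exists>B. \<forall>z\<in>space \<sigma>. \<bar>f z\<bar> \<le> B)"

lemma bm_measurable: "bounded_measurable f \<Longrightarrow> f \<in> borel_measurable \<sigma>"
  by (simp add: bounded_measurable_def)

text \<open>On a probability space boundedness gives integrability and, unlike integrability,
  survives products. The closure rules that follow discharge most integrability goals below.\<close>

lemma bm_integrable:
  assumes "bounded_measurable f"
  shows "integrable \<sigma> f"
proof -
  obtain B where "\<forall>z\<in>space \<sigma>. \<bar>f z\<bar> \<le> B" "f \<in> borel_measurable \<sigma>"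
    using assms bounded_measurable_def by auto
  then show ?thesis
    by (intro integrable_const_bound[of _ B]) auto
qed

lemma bm_const [intro, simp]: "bounded_measurable (\<lambda>z. c)"
  by (auto simp: bounded_measurable_def)

lemma bm_add [intro]:
  assumes "bounded_measurable f" "bounded_measurable g" shows "bounded_measurable (\<lambda>z. f z + g z)"
proof -
  obtain B C where "\<forall>z\<in>space \<sigma>. \<bar>f z\<bar> \<le> B" "\<forall>z\<in>space \<sigma>. \<bar>g z\<bar> \<le> C"
    using assms bounded_measurable_def by auto
  then have "\<forall>z\<in>space \<sigma>. \<bar>f z + g z\<bar> \<le> B + C"
    by (meson abs_triangle_ineq add_mono order_trans)
  then show ?thesis using assms by (auto simp: bounded_measurable_def)
qed

lemma bm_mult [intro]:
  assumes "bounded_measurable f" "bounded_measurable g" shows "bounded_measurable (\<lambda>z. f z * g z)"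
proof -
  obtain B C where "\<forall>z\<in>space \<sigma>. \<bar>f z\<bar> \<le> B" "\<forall>z\<in>space \<sigma>. \<bar>g z\<bar> \<le> C"
    using assms bounded_measurable_def by auto
  then have "\<forall>z\<in>space \<sigma>. \<bar>f z * g z\<bar> \<le> B * C"
    unfolding abs_mult by (meson abs_ge_zero mult_mono order_trans)
  then show ?thesis using assms by (auto simp: bounded_measurable_def)
qed

lemma bm_uminus [intro]: "bounded_measurable f \<Longrightarrow> bounded_measurable (\<lambda>z. - f z)"
  using bm_mult[OF bm_const[of "-1"]] by simp

lemma bm_diff [intro]: "bounded_measurable f \<Longrightarrow> bounded_measurable g \<Longrightarrow> bounded_measurable (\<lambda>z. f z - g z)"
  using bm_add[OF _ bm_uminus] by simp

lemma bm_power [intro]: "bounded_measurable f \<Longrightarrow> bounded_measurable (\<lambda>z. f z ^ k)"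
  by (induction k) auto

lemma bm_if: "bounded_measurable f \<Longrightarrow> bounded_measurable g \<Longrightarrow> bounded_measurable (\<lambda>z. if P then f z else g z)"
  by (cases P) auto

lemma bm_sum [intro]: "(\<And>i. i \<in> I \<Longrightarrow> bounded_measurable (f i)) \<Longrightarrow> bounded_measurable (\<lambda>z. \<Sum>i\<in>I. f i z)"
  by (induction I rule: infinite_finite_induct) auto

text \<open>Zonal kernels have the form \<open>h (t z y)\<close> with \<open>h\<close> a function of
  one real variable. Boundedness is asked for on \<open>{0..1}\<close>, which contains all values of
  \<open>t\<close>, so that polynomials qualify.\<close>

definition profile :: "(real \<Rightarrow> real) \<Rightarrow> bool" where
  "profile h \<longleftrightarrow> h \<in> borel_measurable borel \<and> (\<exists>B. \<forall>x\<in>{0..1}. \<bar>h x\<bar> \<le> B)"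

lemma profile_measurable: "profile h \<Longrightarrow> h \<in> borel_measurable borel"
  by (simp add: profile_def)

lemma profile_continuous: 
  assumes "continuous_on UNIV h"
  shows "profile h"
proof -
  have "bounded (h ` {0..1})"
    by (intro compact_imp_bounded compact_continuous_image continuous_on_subset[OF assms]) auto
  then show ?thesis
    using borel_measurable_continuous_onI[OF assms] by (auto simp: profile_def bounded_iff)
qed

lemma profile_poly [intro, simp]: "profile (poly p)"
  by (intro profile_continuous continuous_intros)

lemma profile_indicator [intro, simp]: "A \<in> sets borel \<Longrightarrow> profile (indicator A)"
  by (auto simp: profile_def intro!: exI[of _ 1] split: split_indicator)

lemma bm_profile:
  assumes "profile h" "y \<in> space \<sigma>"
  shows "bounded_measurable (\<lambda>z. h (t z y))"
proof -
  obtain B where "\<forall>x\<in>{0..1}. \<bar>h x\<bar> \<le> B" using assms(1) profile_def by auto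
  then have "\<forall>z\<in>space \<sigma>. \<bar>h (t z y)\<bar> \<le> B" using t_range assms(2) by blast
  moreover have "(\<lambda>z. h (t z y)) \<in> borel_measurable \<sigma>"
    using profile_measurable[OF assms(1)] by measurable
  ultimately show ?thesis unfolding bounded_measurable_def by blast
qed

lemma bm_t: "y \<in> space \<sigma> \<Longrightarrow> bounded_measurable (\<lambda>z. t z y)"
  using bm_profile[of "poly [:0, 1:]" y] by simp

lemma integral_zonal:
  assumes "profile h" "x \<in> space \<sigma>" "y \<in> space \<sigma>"
  shows "(\<integral>z. h (t z x) \<partial>\<sigma>) = (\<integral>z. h (t z y) \<partial>\<sigma>)"
proof -
  obtain T where T: "isom T" "T x = y" using transitive[OF assms(2,3)] .
  have "(\<integral>z. h (t z y) \<partial>\<sigma>) = (\<integral>z. h (t (T z) y) \<partial>\<sigma>)"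
    by (rule integral_isom[OF T(1), symmetric]) (rule bm_measurable[OF bm_profile[OF assms(1,3)]])
  also have "\<dots> = (\<integral>z. h (t z x) \<partial>\<sigma>)"
    using isom_inner[OF T(1) _ assms(2)] T(2) by (intro Bochner_Integration.integral_cong) auto
  finally show ?thesis by simp
qed

text \<open>By transitivity all balls of radius \<open>e\<close> have the same measure. The image of
  the space is totally bounded, so finitely many of them cover the space and they cannot all be
  null.\<close>

lemma measure_ball_pos:
  assumes "x \<in> space \<sigma>" "e > 0"
  shows "0 < measure \<sigma> {y\<in>space \<sigma>. dist (\<iota> x) (\<iota> y) < e}"
proof (rule ccontr)
  define B where "B x = {y\<in>space \<sigma>. dist (\<iota> x) (\<iota> y) < e}" for x
  have B [measurable]: "B x \<in> sets \<sigma>" for x unfolding B_def by measurable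
  assume "\<not> ?thesis"
  then have 0: "measure \<sigma> (B x) = 0" by (simp add: B_def zero_less_measure_iff)
  have B0: "emeasure \<sigma> (B y) = 0" if y: "y \<in> space \<sigma>" for y
  proof -
    obtain T where T: "isom T" "T x = y" using transitive[OF assms(1) y] .
    have "T -` B y \<inter> space \<sigma> = B x"
    proof -
      have "dist (\<iota> y) (\<iota> (T z)) = dist (\<iota> x) (\<iota> z)" if "z \<in> space \<sigma>" for z
        using dist_embed[of x z] dist_embed[of "T x" "T z"] that assms(1) isom_space[OF T(1)]
          isom_inner[OF T(1)] T(2) by (metis power2_eq_iff_nonneg zero_le_dist)
      then show ?thesis by (auto simp: B_def isom_space[OF T(1)])
    qed
    then have "emeasure \<sigma> (B y) = emeasure \<sigma> (B x)"
      using emeasure_distr[OF measurable_isom[OF T(1)] B, of y] distr_isom[OF T(1)] by simp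
    then show ?thesis using 0 by (simp add: emeasure_eq_measure)
  qed
  have "bounded (\<iota> ` space \<sigma>)" by (auto simp: bounded_iff norm_embed intro!: exI[of _ 1])
  then have "compact (closure (\<iota> ` space \<sigma>))" by (simp add: compact_closure)
  then have "\<forall>d>0. \<exists>k. finite k \<and> k \<subseteq> closure (\<iota> ` space \<sigma>) \<and> closure (\<iota> ` space \<sigma>) \<subseteq> (\<Union>x\<in>k. ball x d)"
    using seq_compact_imp_totally_bounded compact_eq_seq_compact_metric by blast
  from this[rule_format, OF half_gt_zero[OF assms(2)]]
  obtain k where k: "finite k" "k \<subseteq> closure (\<iota> ` space \<sigma>)" "closure (\<iota> ` space \<sigma>) \<subseteq> (\<Union>x\<in>k. ball x (e/2))"
    by blast
  \<comment> \<open>The net consists of points of the closure. Each is replaced by a nearby point of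
    the space itself, which is why the net has radius \<open>e/2\<close>.\<close>
  have "\<forall>v\<in>k. \<exists>y\<in>space \<sigma>. dist (\<iota> y) v < e/2"
  proof
    fix v assume "v \<in> k"
    then have "v \<in> closure (\<iota> ` space \<sigma>)" using k(2) by blast
    then show "\<exists>y\<in>space \<sigma>. dist (\<iota> y) v < e/2"
      using half_gt_zero[OF assms(2)] unfolding closure_approachable by fast
  qed
  then obtain f where f: "\<And>v. v \<in> k \<Longrightarrow> f v \<in> space \<sigma> \<and> dist (\<iota> (f v)) v < e/2" by metis
  have "space \<sigma> \<subseteq> (\<Union>v\<in>k. B (f v))"
  proof
    fix y assume y: "y \<in> space \<sigma>"
    then have "\<iota> y \<in> closure (\<iota> ` space \<sigma>)" by (intro closure_subset[THEN subsetD] imageI)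
    then obtain v where v: "v \<in> k" "dist v (\<iota> y) < e/2" using k(3) by auto
    have "dist (\<iota> (f v)) v < e / 2" using f[OF v(1)] by blast
    then have "dist (\<iota> (f v)) (\<iota> y) < e"
      using dist_triangle[of "\<iota> (f v)" "\<iota> y" v] v(2) by linarith
    then show "y \<in> (\<Union>v\<in>k. B (f v))" using v y by (auto simp: B_def)
  qed
  then have "emeasure \<sigma> (space \<sigma>) \<le> emeasure \<sigma> (\<Union>v\<in>k. B (f v))"
    using k(1) by (intro emeasure_mono) auto
  also have "\<dots> \<le> (\<Sum>v\<in>k. emeasure \<sigma> (B (f v)))"
    using k(1) by (intro emeasure_subadditive_finite) auto
  also have "\<dots> = 0" using B0 f by simp
  finally show False by (simp add: emeasure_space_1)
qed

lemma cap_pos: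
  assumes "y \<in> space \<sigma>" "s < 1"
  shows "0 < measure \<sigma> {z\<in>space \<sigma>. s < t z y}"
proof -
  have "{z\<in>space \<sigma>. dist (\<iota> y) (\<iota> z) < sqrt (2 - 2 * s)} \<subseteq> {z\<in>space \<sigma>. s < t z y}"
  proof clarify
    fix z assume z: "z \<in> space \<sigma>" "dist (\<iota> y) (\<iota> z) < sqrt (2 - 2 * s)"
    then have "(dist (\<iota> y) (\<iota> z))\<^sup>2 < (sqrt (2 - 2 * s))\<^sup>2"
      by (intro power_strict_mono) auto
    then show "s < t z y" using dist_embed[OF assms(1) z(1)] assms(2) by (simp add: inner_commute)
  qed
  then have "measure \<sigma> {z\<in>space \<sigma>. dist (\<iota> y) (\<iota> z) < sqrt (2 - 2 * s)} \<le> measure \<sigma> {z\<in>space \<sigma>. s < t z y}"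
    by (intro finite_measure_mono) measurable
  then show ?thesis using measure_ball_pos[OF assms(1), of "sqrt (2 - 2 * s)"] assms(2) by simp
qed

text \<open>Full support: a nonzero value of a continuous function of \<open>t\<close> persists on a
  ball, and balls have positive measure.\<close>

lemma integral_square_eq_0:
  fixes h :: "real \<Rightarrow> real"
  assumes "y \<in> space \<sigma>" "continuous_on UNIV h" "(\<integral>z. (h (t z y))\<^sup>2 \<partial>\<sigma>) = 0" "z \<in> space \<sigma>"
  shows "h (t z y) = 0"
proof (rule ccontr)
  assume nz: "h (t z y) \<noteq> 0"
  have bm: "bounded_measurable (\<lambda>z. (h (t z y))\<^sup>2)"
    using profile_continuous[OF assms(2)] assms(1) by (intro bm_power bm_profile)
  have "AE z in \<sigma>. (h (t z y))\<^sup>2 = 0"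
    using integral_nonneg_eq_0_iff_AE[OF bm_integrable[OF bm]] assms(3) by simp
  then have AE: "AE z in \<sigma>. h (t z y) = 0" by simp
  have "isCont h (t z y)" using assms(2) by (simp add: continuous_on_eq_continuous_at)
  then obtain d where d: "d > 0" "\<And>x. \<bar>x - t z y\<bar> < d \<Longrightarrow> h x \<noteq> 0"
    using continuous_at_avoid[of "t z y" h 0] nz by (auto simp: dist_real_def abs_minus_commute)
  have "AE w in \<sigma>. w \<notin> {w\<in>space \<sigma>. dist (\<iota> z) (\<iota> w) < d}"
    using AE
  proof eventually_elim
    case (elim w)
    show ?case
    proof safe
      assume w: "w \<in> space \<sigma>" "dist (\<iota> z) (\<iota> w) < d"
      then have "\<bar>t w y - t z y\<bar> < d"
        using t_diff_le[of w z y] assms by (simp add: dist_commute)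
      then show False using d(2) elim by blast
    qed
  qed
  moreover have "{w\<in>space \<sigma>. dist (\<iota> z) (\<iota> w) < d} \<in> sets \<sigma>" by measurable
  ultimately have "measure \<sigma> {w\<in>space \<sigma>. dist (\<iota> z) (\<iota> w) < d} = 0"
    using measure_eq_0_null_sets AE_iff_null_sets by blast
  then show False using measure_ball_pos[OF assms(4) d(1)] by simp
qed

end

section \<open>Convolution of zonal kernels and moments\<close>

text \<open>In the models points are rank-one projections. The \<open>E i\<close> are the coordinate
  points, \<open>u c s\<close> is the point with coordinates \<open>c\<close> and \<open>s\<close>
  at \<open>a\<close> and \<open>b\<close>, and \<open>\<rho> z\<close> is the real part of the
  matrix entry of \<open>z\<close> at \<open>a, b\<close>. The maps \<open>\<phi> k\<close> turn
  that entry by the units of a real basis, so that \<open>\<phi>_sum\<close> says that its squared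
  norm is the product of two diagonal entries. The set \<open>S\<close> stands free of any measure,
  so a frame can be built before a measure is given.\<close>

locale orthogonal_frame =
  fixes S :: "'p set" and \<iota> :: "'p \<Rightarrow> 'e::euclidean_space"
    and E :: "'d::finite \<Rightarrow> 'p" and a b :: 'd and u :: "real \<Rightarrow> real \<Rightarrow> 'p" and \<rho> :: "'p \<Rightarrow> real"
    and \<phi> :: "'k \<Rightarrow> 'p \<Rightarrow> 'p" and K :: "'k set"
  assumes E_space: "E i \<in> S"
    and E_orth: "i \<noteq> j \<Longrightarrow> \<iota> (E i) \<bullet> \<iota> (E j) = 0"
    and E_sum: "z \<in> S \<Longrightarrow> (\<Sum>i\<in>UNIV. \<iota> z \<bullet> \<iota> (E i)) = 1"
    and ab: "a \<noteq> b"
    and u_space: "c\<^sup>2 + s\<^sup>2 = 1 \<Longrightarrow> u c s \<in> S"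
    and u_inner: "c\<^sup>2 + s\<^sup>2 = 1 \<Longrightarrow> z \<in> S \<Longrightarrow>
      \<iota> z \<bullet> \<iota> (u c s) = c\<^sup>2 * (\<iota> z \<bullet> \<iota> (E a)) + s\<^sup>2 * (\<iota> z \<bullet> \<iota> (E b)) + 2 * c * s * \<rho> z"
    and reflection: "\<exists>T. inner_isometry S \<iota> T \<and> T (E a) = E a \<and> T (E b) = E b \<and> (\<forall>z\<in>S. \<rho> (T z) = - \<rho> z)"
    and K: "finite K" "K \<noteq> {}"
    and \<phi>_isom: "k \<in> K \<Longrightarrow> inner_isometry S \<iota> (\<phi> k)"
    and \<phi>_fix: "k \<in> K \<Longrightarrow> \<phi> k (E a) = E a" "k \<in> K \<Longrightarrow> \<phi> k (E b) = E b"
    and \<phi>_sum: "z \<in> S \<Longrightarrow> (\<Sum>k\<in>K. (\<rho> (\<phi> k z))\<^sup>2) = (\<iota> z \<bullet> \<iota> (E a)) * (\<iota> z \<bullet> \<iota> (E b))"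

locale framed_space = two_point_homogeneous \<sigma> \<iota> + orthogonal_frame "space \<sigma>" \<iota> E a b u \<rho> \<phi> K
  for \<sigma> :: "'p measure" and \<iota> :: "'p \<Rightarrow> 'e::euclidean_space" and E :: "'d::finite \<Rightarrow> 'p"
    and a b u \<rho> and \<phi> :: "'k \<Rightarrow> 'p \<Rightarrow> 'p" and K
begin

lemma rho_E: "\<rho> (E a) = 0"
  using reflection E_space[of a] by fastforce

lemma t_E_u: 
  assumes "c\<^sup>2 + s\<^sup>2 = 1" shows "t (E a) (u c s) = c\<^sup>2"
  using u_inner[OF assms E_space[of a]] by (simp add: rho_E t_self E_space E_orth ab)

text \<open>At \<open>c = s = 1 / sqrt 2\<close> the mixed coefficient \<open>2 * c * s\<close> is
  1, which expresses \<open>\<rho>\<close> through three functions of the form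
  \<open>t z y\<close>.\<close>

lemma bm_rho: "bounded_measurable \<rho>"
proof -
  define r where "r = 1 / sqrt 2"
  have r: "r\<^sup>2 + r\<^sup>2 = 1" "r * r = 1 / 2" by (auto simp: r_def field_simps power2_eq_square)
  have eq: "\<rho> z = t z (u r r) - (t z (E a) + t z (E b)) / 2" if "z \<in> space \<sigma>" for z
    using u_inner[OF r(1) that] r(2) by (simp add: power2_eq_square field_simps)
  have "bounded_measurable (\<lambda>z. t z (u r r) - (t z (E a) + t z (E b)) * (1 / 2))"
    by (intro bm_diff bm_mult bm_add bm_const bm_t E_space u_space r(1))
  then show ?thesis
    unfolding bounded_measurable_def using eq by (simp cong: measurable_cong)
qed

lemma bm_tE: "bounded_measurable (\<lambda>z. t z (E i))"
  by (intro bm_t E_space)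

lemma isom_t_fix:
  assumes "isom T" "T y = y" "y \<in> space \<sigma>" "z \<in> space \<sigma>"
  shows "t (T z) y = t z y"
  using isom_inner[OF assms(1,4,3)] assms(2) by simp

text \<open>The reflection preserves both \<open>t\<close> factors and reverses the sign of the odd
  power, so the integral equals its own negative.\<close>

lemma integral_odd:
  assumes "profile h" "odd j"
  shows "(\<integral>z. h (t z (E a)) * (t z (E a) ^ i * t z (E b) ^ l * \<rho> z ^ j) \<partial>\<sigma>) = 0" (is "(\<integral>z. ?f z \<partial>\<sigma>) = 0")
proof -
  obtain T where T: "isom T" "T (E a) = E a" "T (E b) = E b" "\<forall>z\<in>space \<sigma>. \<rho> (T z) = - \<rho> z"
    using reflection by blast
  have "(\<integral>z. ?f z \<partial>\<sigma>) = (\<integral>z. ?f (T z) \<partial>\<sigma>)"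
    by (rule integral_isom[OF T(1), symmetric])
      (intro bm_measurable bm_mult bm_power bm_tE bm_rho bm_profile assms E_space)
  also have "\<dots> = (\<integral>z. - ?f z \<partial>\<sigma>)"
    using T assms(2) isom_t_fix[OF T(1,2) E_space] isom_t_fix[OF T(1,3) E_space]
    by (intro Bochner_Integration.integral_cong) auto
  finally show ?thesis by simp
qed

text \<open>With \<open>w\<close> at \<open>E a\<close> and \<open>y\<close> at
  \<open>u c s\<close>, where \<open>c = sqrt \<tau>\<close> and
  \<open>s = sqrt (1 - \<tau>)\<close> for \<open>\<tau> = t w y\<close>, the only terms that are
  not polynomial in \<open>\<tau>\<close> are the odd powers of \<open>2 * c * s\<close>; their
  integrals vanish. An even power \<open>(2 * c * s) ^ j\<close> has degree \<open>j\<close> in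
  \<open>\<tau>\<close> and comes with a factor of degree at most \<open>k - j\<close>.\<close>

lemma convolution_monomial:
  assumes h: "profile h"
  shows "\<exists>q. degree q \<le> k \<and> (\<forall>w\<in>space \<sigma>. \<forall>y\<in>space \<sigma>. (\<integral>z. h (t z w) * t z y ^ k \<partial>\<sigma>) = poly q (t w y))"
proof -
  define C where "C i j = (\<integral>z. h (t z (E a)) * (t z (E a) ^ i * t z (E b) ^ (k - j - i) * \<rho> z ^ j) \<partial>\<sigma>)" for i j
  define R where "R j = (\<Sum>i\<le>k-j. smult (of_nat ((k - j) choose i) * C i j) ([:0, 1:] ^ i * [:1, -1:] ^ (k - j - i)))" for j
  \<comment> \<open>\<open>[:0, 4, -4:]\<close> is \<open>4 * \<tau> * (1 - \<tau>)\<close>, the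
    square of \<open>2 * c * s\<close>.\<close>
  define q where "q = (\<Sum>j\<in>{j. j \<le> k \<and> even j}. smult (of_nat (k choose j)) ([:0, 4, -4:] ^ (j div 2) * R j))"
  have degR: "degree (R j) \<le> k - j" for j
    unfolding R_def
  proof (rule degree_sum_le)
    fix i assume "i \<in> {..k-j}"
    have "degree ([:0, 1::real:] ^ i * [:1, -1:] ^ (k - j - i)) \<le> 1 * i + 1 * (k - j - i)"
      by (intro order.trans[OF degree_mult_le] add_mono order.trans[OF degree_power_le]) auto
    then show "degree (smult (of_nat ((k - j) choose i) * C i j) ([:0, 1:] ^ i * [:1, -1:] ^ (k - j - i))) \<le> k - j"
      using \<open>i \<in> {..k-j}\<close> by (intro order.trans[OF degree_smult_le]) auto
  qed simp
  have "degree q \<le> k"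
    unfolding q_def
  proof (rule degree_sum_le)
    fix j assume j: "j \<in> {j. j \<le> k \<and> even j}"
    have "degree ([:0, 4, -4::real:] ^ (j div 2) * R j) \<le> 2 * (j div 2) + (k - j)"
      by (intro order.trans[OF degree_mult_le] add_mono degR order.trans[OF degree_power_le]) auto
    then show "degree (smult (of_nat (k choose j)) ([:0, 4, -4:] ^ (j div 2) * R j)) \<le> k"
      using j by (intro order.trans[OF degree_smult_le]) auto
  qed simp
  moreover have "(\<integral>z. h (t z w) * t z y ^ k \<partial>\<sigma>) = poly q (t w y)" if wy: "w \<in> space \<sigma>" "y \<in> space \<sigma>" for w y
  proof -
    define \<tau> where "\<tau> = t w y"
    define c s where "c = sqrt \<tau>" and "s = sqrt (1 - \<tau>)"
    have \<tau>: "0 \<le> \<tau>" "\<tau> \<le> 1" using t_range[OF wy] by (auto simp: \<tau>_def)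
    then have c2: "c\<^sup>2 = \<tau>" and s2: "s\<^sup>2 = 1 - \<tau>" by (auto simp: c_def s_def)
    then have cs: "c\<^sup>2 + s\<^sup>2 = 1" by simp
    \<comment> \<open>Both pairs have inner product \<open>c\<^sup>2\<close>, so they are
      congruent.\<close>
    obtain T where T: "isom T" "T w = E a" "T y = u c s"
      using two_point[OF wy E_space u_space[OF cs], of a] t_E_u[OF cs] c2 \<tau>_def by auto
    have "(\<integral>z. h (t z w) * t z y ^ k \<partial>\<sigma>) = (\<integral>z. h (t (T z) (E a)) * t (T z) (u c s) ^ k \<partial>\<sigma>)"
      using isom_inner[OF T(1) _ wy(1)] isom_inner[OF T(1) _ wy(2)] T(2,3)
      by (intro Bochner_Integration.integral_cong) auto
    also have "\<dots> = (\<integral>z. h (t z (E a)) * t z (u c s) ^ k \<partial>\<sigma>)"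
      by (rule integral_isom[OF T(1)])
        (intro bm_measurable bm_mult bm_power bm_t bm_profile h E_space u_space cs)
    also have "\<dots> = (\<integral>z. (\<Sum>j\<le>k. \<Sum>i\<le>k-j. of_nat (k choose j) * of_nat ((k - j) choose i) * (2 * c * s) ^ j * \<tau> ^ i * (1 - \<tau>) ^ (k - j - i)
        * (h (t z (E a)) * (t z (E a) ^ i * t z (E b) ^ (k - j - i) * \<rho> z ^ j))) \<partial>\<sigma>)"
    proof (rule Bochner_Integration.integral_cong[OF refl])
      fix z assume z: "z \<in> space \<sigma>"
      have "t z (u c s) ^ k = (2 * c * s * \<rho> z + (\<tau> * t z (E a) + (1 - \<tau>) * t z (E b))) ^ k"
        using u_inner[OF cs z] c2 s2 by (simp add: add.commute)
      also have "\<dots> = (\<Sum>j\<le>k. of_nat (k choose j) * (2 * c * s * \<rho> z) ^ j *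
           (\<Sum>i\<le>k-j. of_nat ((k - j) choose i) * (\<tau> * t z (E a)) ^ i * ((1 - \<tau>) * t z (E b)) ^ (k - j - i)))"
        by (simp only: binomial_ring)
      finally show "h (t z (E a)) * t z (u c s) ^ k = (\<Sum>j\<le>k. \<Sum>i\<le>k-j. of_nat (k choose j) * of_nat ((k - j) choose i) * (2 * c * s) ^ j * \<tau> ^ i * (1 - \<tau>) ^ (k - j - i)
        * (h (t z (E a)) * (t z (E a) ^ i * t z (E b) ^ (k - j - i) * \<rho> z ^ j)))"
        by (simp add: sum_distrib_left power_mult_distrib mult_ac)
    qed
    also have "\<dots> = (\<Sum>j\<le>k. \<Sum>i\<le>k-j. of_nat (k choose j) * of_nat ((k - j) choose i) * (2 * c * s) ^ j * \<tau> ^ i * (1 - \<tau>) ^ (k - j - i) * C i j)"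
    proof -
      have bm: "bounded_measurable (\<lambda>z. h (t z (E a)) * (t z (E a) ^ i * t z (E b) ^ l * \<rho> z ^ j))" for i j l
        by (intro bm_mult bm_power bm_tE bm_rho bm_profile h E_space)
      show ?thesis
        unfolding C_def
        by (subst Bochner_Integration.integral_sum, 
            force intro!: bm_integrable bm_sum bm_mult[OF bm_const bm],
            subst Bochner_Integration.integral_sum, 
            force intro!: bm_integrable bm_mult[OF bm_const bm]) simp
    qed
    also have "\<dots> = (\<Sum>j\<le>k. of_nat (k choose j) * (2 * c * s) ^ j * poly (R j) \<tau>)"
      by (simp add: R_def poly_sum sum_distrib_left mult_ac)
    also have "\<dots> = (\<Sum>j\<in>{j. j \<le> k \<and> even j}. of_nat (k choose j) * (2 * c * s) ^ j * poly (R j) \<tau>)"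
    proof (rule sum.mono_neutral_right)
      have "R j = 0" if "odd j" for j
        using integral_odd[OF h that] by (simp add: R_def C_def)
      then show "\<forall>j\<in>{..k} - {j. j \<le> k \<and> even j}. of_nat (k choose j) * (2 * c * s) ^ j * poly (R j) \<tau> = 0"
        by auto
    qed auto
    also have "\<dots> = poly q \<tau>"
    proof -
      have "(2 * c * s) ^ j = (4 * \<tau> * (1 - \<tau>)) ^ (j div 2)" if "even j" for j
      proof -
        have "(2 * c * s) ^ j = ((2 * c * s)\<^sup>2) ^ (j div 2)"
          using that by (simp flip: power_mult)
        then show ?thesis by (simp add: power_mult_distrib c2 s2)
      qed
      then show ?thesis by (simp add: q_def poly_sum algebra_simps)
    qed
    finally show ?thesis by (simp add: \<tau>_def)
  qed
  ultimately show ?thesis by blast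
qed

lemma convolution_poly:
  assumes h: "profile h"
  shows "\<exists>q. degree q \<le> degree p \<and>
    (\<forall>w\<in>space \<sigma>. \<forall>y\<in>space \<sigma>. (\<integral>z. h (t z w) * poly p (t z y) \<partial>\<sigma>) = poly q (t w y))"
proof -
  have "\<forall>k. \<exists>q. degree q \<le> k \<and>
      (\<forall>w\<in>space \<sigma>. \<forall>y\<in>space \<sigma>. (\<integral>z. h (t z w) * t z y ^ k \<partial>\<sigma>) = poly q (t w y))"
    using convolution_monomial[OF h] by (rule allI)
  from choice[OF this] obtain Q where Q: "\<And>k. degree (Q k) \<le> k"
    "\<And>k w y. w\<in>space \<sigma> \<Longrightarrow> y\<in>space \<sigma> \<Longrightarrow> (\<integral>z. h (t z w) * t z y ^ k \<partial>\<sigma>) = poly (Q k) (t w y)"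
    by blast
  define q where "q = (\<Sum>k\<le>degree p. smult (coeff p k) (Q k))"
  have "degree q \<le> degree p"
    unfolding q_def
    by (intro degree_sum_le order.trans[OF degree_smult_le] order.trans[OF Q(1)]) auto
  moreover have "(\<integral>z. h (t z w) * poly p (t z y) \<partial>\<sigma>) = poly q (t w y)" if "w\<in>space \<sigma>" "y\<in>space \<sigma>" for w y
  proof -
    have bm: "bounded_measurable (\<lambda>z. h (t z w) * t z y ^ k)" for k
      by (intro bm_mult bm_power bm_t bm_profile h that)
    have "(\<integral>z. h (t z w) * poly p (t z y) \<partial>\<sigma>) = (\<integral>z. (\<Sum>k\<le>degree p. coeff p k * (h (t z w) * t z y ^ k)) \<partial>\<sigma>)"
      by (simp add: poly_altdef sum_distrib_left mult_ac)
    also have "\<dots> = (\<Sum>k\<le>degree p. coeff p k * (\<integral>z. h (t z w) * t z y ^ k \<partial>\<sigma>))"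
      by (subst Bochner_Integration.integral_sum) (force intro!: bm_integrable bm_mult[OF bm_const bm])+
    finally show ?thesis by (simp add: q_def poly_sum Q(2) that)
  qed
  ultimately show ?thesis by blast
qed

section \<open>The recursion for the moments of \<open>t\<close>\<close>

lemma coeff_quadratic_power:
  fixes x y w :: real
  shows "coeff ([:x, y, w:] ^ k) 0 = x ^ k"
    and "coeff ([:x, y, w:] ^ Suc k) (Suc 0) = (1 + real k) * x ^ k * y"
    and "coeff ([:x, y, w:] ^ Suc (Suc k)) 2 = (2 + real k) * x ^ Suc k * w + (2 + real k) * (1 + real k) / 2 * x ^ k * y\<^sup>2"
proof -
  show 0: "coeff ([:x, y, w:] ^ k) 0 = x ^ k" for k
    by (induction k) auto
  show 1: "coeff ([:x, y, w:] ^ Suc k) (Suc 0) = (1 + real k) * x ^ k * y" for k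
  proof (induction k)
    case (Suc k)
    then show ?case
      by (subst power_Suc) (simp add: mult_pCons_left coeff_pCons 0 algebra_simps del: power_Suc, simp add: algebra_simps)
  qed simp
  show "coeff ([:x, y, w:] ^ Suc (Suc k)) 2 = (2 + real k) * x ^ Suc k * w + (2 + real k) * (1 + real k) / 2 * x ^ k * y\<^sup>2"
  proof (induction k)
    case 0
    show ?case by (simp add: numeral_2_eq_2 power2_eq_square)
  next
    case (Suc k)
    have "coeff ([:x, y, w:] ^ Suc (Suc (Suc k))) 2 = x * coeff ([:x, y, w:] ^ Suc (Suc k)) 2
        + y * coeff ([:x, y, w:] ^ Suc (Suc k)) (Suc 0) + w * coeff ([:x, y, w:] ^ Suc (Suc k)) 0"
      by (subst power_Suc) (simp add: mult_pCons_left coeff_pCons numeral_2_eq_2 del: power_Suc)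
    then show ?case
      unfolding Suc.IH 0 1 by (simp add: field_simps power2_eq_square)
  qed
qed

text \<open>At \<open>k = 0\<close> the factor \<open>real k\<close> cancels the term with the
  truncated exponent \<open>k - 1\<close>, so that one formula serves all positive
  exponents.\<close>

lemma coeff_quadratic_power_1:
  "coeff ([:x, y, w:] ^ Suc k) 2 = (1 + real k) * x ^ k * w + (1 + real k) * real k / 2 * x ^ (k - 1) * y\<^sup>2"
  for x y w :: real
  using coeff_quadratic_power(3)[of x y w "k - 1"]
  by (cases k) (auto simp: numeral_2_eq_2 algebra_simps)

text \<open>\<open>1 / sqrt N\<close> and \<open>s / sqrt N\<close> are the coordinates of the curve
  point in direction \<open>(1, s)\<close>. The moment about that point equals the moment about
  \<open>E a\<close>; clearing denominators leaves an identity between polynomials in the free real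
  parameter \<open>s\<close>.\<close>

lemma moment_curve:
  "(\<integral>z. poly ([:t z (E a), 2 * \<rho> z, t z (E b):] ^ k) s \<partial>\<sigma>) = (1 + s\<^sup>2) ^ k * (\<integral>z. t z (E a) ^ k \<partial>\<sigma>)"
proof -
  define N where "N = 1 + s\<^sup>2"
  define c s' where "c = 1 / sqrt N" and "s' = s / sqrt N"
  have N: "N > 0" by (simp add: N_def add_pos_nonneg)
  have cs: "c\<^sup>2 + s'\<^sup>2 = 1" using N by (simp add: c_def s'_def power_divide N_def flip: add_divide_distrib)
  have "poly ([:t z (E a), 2 * \<rho> z, t z (E b):] ^ k) s = N ^ k * t z (u c s') ^ k" if "z \<in> space \<sigma>" for z
  proof -
    have "N * t z (u c s') = t z (E a) + s\<^sup>2 * t z (E b) + 2 * s * \<rho> z"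
    proof -
      have "N * c\<^sup>2 = 1" "N * s'\<^sup>2 = s\<^sup>2" "N * (c * s') = s"
        using N by (auto simp: c_def s'_def power_divide)
      moreover have "N * t z (u c s') = N * c\<^sup>2 * t z (E a) + N * s'\<^sup>2 * t z (E b) + 2 * (N * (c * s')) * \<rho> z"
        by (simp add: u_inner[OF cs that] algebra_simps)
      ultimately show ?thesis by simp
    qed
    then show ?thesis
      by (simp add: poly_power power2_eq_square algebra_simps flip: power_mult_distrib)
  qed
  then have "(\<integral>z. poly ([:t z (E a), 2 * \<rho> z, t z (E b):] ^ k) s \<partial>\<sigma>) = (\<integral>z. N ^ k * t z (u c s') ^ k \<partial>\<sigma>)"
    by (intro Bochner_Integration.integral_cong) auto
  also have "\<dots> = N ^ k * (\<integral>z. t z (E a) ^ k \<partial>\<sigma>)"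
    using integral_zonal[OF profile_poly[of "monom 1 k"] u_space[OF cs] E_space[of a]]
    by (simp add: poly_monom)
  finally show ?thesis by (simp add: N_def)
qed

text \<open>Coefficients of \<open>s\<^sup>2\<close> on both sides of \<open>moment_curve\<close>,
  taken with exponent \<open>Suc k\<close>.\<close>

lemma moment_identity:
  "(1 + real k) * (\<integral>z. t z (E a) ^ k * t z (E b) \<partial>\<sigma>) + 2 * (1 + real k) * real k * (\<integral>z. t z (E a) ^ (k - 1) * (\<rho> z)\<^sup>2 \<partial>\<sigma>)
    = (1 + real k) * (\<integral>z. t z (E a) ^ Suc k \<partial>\<sigma>)"
proof -
  define Q where "Q z = [:t z (E a), 2 * \<rho> z, t z (E b):]" for z
  \<comment> \<open>Every coefficient has to be integrable before the integral can be taken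
    coefficientwise; splitting off one factor \<open>Q z\<close> gives an induction.\<close>
  have bmQ: "bounded_measurable (\<lambda>z. coeff (Q z ^ n) i)" for n i
  proof (induction n arbitrary: i)
    case (Suc n)
    have eq: "(\<lambda>z. coeff (Q z ^ Suc n) i) = (\<lambda>z. t z (E a) * coeff (Q z ^ n) i
      + (2 * \<rho> z) * (if i = 0 then 0 else coeff (Q z ^ n) (i - 1)) + t z (E b) * (if i < 2 then 0 else coeff (Q z ^ n) (i - 2)))"
      by (auto simp: Q_def mult_pCons_left coeff_pCons numeral_2_eq_2 fun_eq_iff split: nat.splits)
    show ?case
      unfolding eq using Suc by (intro bm_add bm_mult bm_tE bm_rho bm_const bm_if)
  qed simp
  define L where "L = (\<Sum>i\<le>2 * Suc k. monom (\<integral>z. coeff (Q z ^ Suc k) i \<partial>\<sigma>) i)"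
  have "poly L s = poly (smult (\<integral>z. t z (E a) ^ Suc k \<partial>\<sigma>) ([:1, 0, 1:] ^ Suc k)) s" for s
  proof -
    have deg: "degree (Q z ^ Suc k) \<le> 2 * Suc k" for z
      by (intro order.trans[OF degree_power_le]) (auto simp: Q_def)
    have "poly L s = (\<Sum>i\<le>2 * Suc k. (\<integral>z. coeff (Q z ^ Suc k) i * s ^ i \<partial>\<sigma>))"
      by (simp add: L_def poly_sum poly_monom)
    also have "\<dots> = (\<integral>z. (\<Sum>i\<le>2 * Suc k. coeff (Q z ^ Suc k) i * s ^ i) \<partial>\<sigma>)"
      by (rule Bochner_Integration.integral_sum[symmetric]) (intro bm_integrable bm_mult bmQ bm_const)
    also have "\<dots> = (\<integral>z. poly (Q z ^ Suc k) s \<partial>\<sigma>)"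
      unfolding poly_altdef
      by (intro Bochner_Integration.integral_cong[OF refl] sum.mono_neutral_right)
        (use deg in \<open>auto simp: coeff_eq_0 simp del: power_Suc\<close>)
    also have "\<dots> = (1 + s\<^sup>2) ^ Suc k * (\<integral>z. t z (E a) ^ Suc k \<partial>\<sigma>)"
      unfolding Q_def by (rule moment_curve)
    finally show ?thesis by (simp add: poly_power power2_eq_square del: power_Suc)
  qed
  then have "L = smult (\<integral>z. t z (E a) ^ Suc k \<partial>\<sigma>) ([:1, 0, 1:] ^ Suc k)"
    using poly_eq_poly_eq_iff by blast
  then have "coeff L 2 = (\<integral>z. t z (E a) ^ Suc k \<partial>\<sigma>) * (1 + real k)"
    by (simp add: coeff_quadratic_power_1 del: power_Suc)
  moreover have "coeff L 2 = (\<integral>z. coeff (Q z ^ Suc k) 2 \<partial>\<sigma>)"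
    by (simp add: L_def coeff_sum coeff_monom numeral_2_eq_2 del: power_Suc)
  moreover have "\<dots> = (\<integral>z. (1 + real k) * (t z (E a) ^ k * t z (E b)) +
      (2 * (1 + real k) * real k) * (t z (E a) ^ (k - 1) * (\<rho> z)\<^sup>2) \<partial>\<sigma>)"
    unfolding Q_def coeff_quadratic_power_1
    by (intro Bochner_Integration.integral_cong) (auto simp: power_mult_distrib algebra_simps)
  moreover have "\<dots> = (1 + real k) * (\<integral>z. t z (E a) ^ k * t z (E b) \<partial>\<sigma>)
      + (2 * (1 + real k) * real k) * (\<integral>z. t z (E a) ^ (k - 1) * (\<rho> z)\<^sup>2 \<partial>\<sigma>)"
    by (subst Bochner_Integration.integral_add)
      (auto intro!: bm_integrable bm_mult bm_power bm_tE bm_rho)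
  ultimately show ?thesis by (simp add: mult_ac)
qed

text \<open>Each \<open>\<phi> i\<close> preserves \<open>\<sigma>\<close> and the factor
  \<open>t z (E a)\<close>, so the \<open>card K\<close> integrals with
  \<open>\<rho> (\<phi> i z)\<close> agree; \<open>\<phi>_sum\<close> evaluates their sum.\<close>

lemma moment_rho:
  "real (card K) * (\<integral>z. t z (E a) ^ k * (\<rho> z)\<^sup>2 \<partial>\<sigma>) = (\<integral>z. t z (E a) ^ Suc k * t z (E b) \<partial>\<sigma>)"
proof -
  have bm: "bounded_measurable (\<lambda>z. t z (E a) ^ k * (\<rho> z)\<^sup>2)"
    by (intro bm_mult bm_power bm_tE bm_rho)
  have eq: "(\<integral>z. t z (E a) ^ k * (\<rho> z)\<^sup>2 \<partial>\<sigma>) = (\<integral>z. t z (E a) ^ k * (\<rho> (\<phi> i z))\<^sup>2 \<partial>\<sigma>)" if "i \<in> K" for i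
  proof -
    have "(\<integral>z. t z (E a) ^ k * (\<rho> z)\<^sup>2 \<partial>\<sigma>) = (\<integral>z. t (\<phi> i z) (E a) ^ k * (\<rho> (\<phi> i z))\<^sup>2 \<partial>\<sigma>)"
      using integral_isom[OF \<phi>_isom[OF that] bm_measurable[OF bm]] by simp
    also have "\<dots> = (\<integral>z. t z (E a) ^ k * (\<rho> (\<phi> i z))\<^sup>2 \<partial>\<sigma>)"
      using isom_t_fix[OF \<phi>_isom[OF that] \<phi>_fix(1)[OF that] E_space]
      by (intro Bochner_Integration.integral_cong) auto
    finally show ?thesis .
  qed
  have "real (card K) * (\<integral>z. t z (E a) ^ k * (\<rho> z)\<^sup>2 \<partial>\<sigma>) = (\<Sum>i\<in>K. (\<integral>z. t z (E a) ^ k * (\<rho> (\<phi> i z))\<^sup>2 \<partial>\<sigma>))"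
    by (simp add: sum.cong[OF refl eq[symmetric]])
  also have "\<dots> = (\<integral>z. (\<Sum>i\<in>K. t z (E a) ^ k * (\<rho> (\<phi> i z))\<^sup>2) \<partial>\<sigma>)"
  proof (rule Bochner_Integration.integral_sum[symmetric])
    fix i assume i: "i \<in> K"
    have "bounded_measurable (\<lambda>z. \<rho> (\<phi> i z))"
      using bm_rho isom_space[OF \<phi>_isom[OF i]] measurable_compose[OF measurable_isom[OF \<phi>_isom[OF i]]]
      unfolding bounded_measurable_def by blast
    then show "integrable \<sigma> (\<lambda>z. t z (E a) ^ k * (\<rho> (\<phi> i z))\<^sup>2)"
      by (intro bm_integrable bm_mult bm_power bm_tE)
  qed
  also have "\<dots> = (\<integral>z. t z (E a) ^ Suc k * t z (E b) \<partial>\<sigma>)"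
    by (intro Bochner_Integration.integral_cong) (auto simp: \<phi>_sum simp flip: sum_distrib_left)
  finally show ?thesis .
qed

text \<open>A factor 1 is inserted as the frame sum. All indices other than \<open>a\<close>
  contribute equally, because \<open>E a, E i\<close> and \<open>E a, E b\<close> are both
  orthogonal pairs and hence congruent.\<close>

lemma moment_sum:
  "(\<integral>z. t z (E a) ^ k \<partial>\<sigma>) = (\<integral>z. t z (E a) ^ Suc k \<partial>\<sigma>) + (real CARD('d) - 1) * (\<integral>z. t z (E a) ^ k * t z (E b) \<partial>\<sigma>)"
proof -
  have eq: "(\<integral>z. t z (E a) ^ k * t z (E i) \<partial>\<sigma>) = (\<integral>z. t z (E a) ^ k * t z (E b) \<partial>\<sigma>)" if i: "i \<noteq> a" for i
  proof -
    obtain T where T: "isom T" "T (E a) = E a" "T (E i) = E b"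
      using two_point[OF E_space E_space E_space E_space, of a i a b] E_orth[of a i] E_orth[of a b] i ab by auto
    have "(\<integral>z. t z (E a) ^ k * t z (E b) \<partial>\<sigma>) = (\<integral>z. t (T z) (E a) ^ k * t (T z) (E b) \<partial>\<sigma>)"
      by (rule integral_isom[OF T(1), symmetric]) (intro bm_measurable bm_mult bm_power bm_tE)
    also have "\<dots> = (\<integral>z. t z (E a) ^ k * t z (E i) \<partial>\<sigma>)"
      using isom_inner[OF T(1) _ E_space[of a]] isom_inner[OF T(1) _ E_space[of i]] T
      by (intro Bochner_Integration.integral_cong) auto
    finally show ?thesis ..
  qed
  have "(\<integral>z. t z (E a) ^ k \<partial>\<sigma>) = (\<integral>z. (\<Sum>i\<in>UNIV. t z (E a) ^ k * t z (E i)) \<partial>\<sigma>)"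
    by (intro Bochner_Integration.integral_cong) (auto simp: E_sum simp flip: sum_distrib_left)
  also have "\<dots> = (\<Sum>i\<in>UNIV. (\<integral>z. t z (E a) ^ k * t z (E i) \<partial>\<sigma>))"
    by (rule Bochner_Integration.integral_sum) (intro bm_integrable bm_mult bm_power bm_tE)
  also have "\<dots> = (\<integral>z. t z (E a) ^ k * t z (E a) \<partial>\<sigma>) + (\<Sum>i\<in>UNIV - {a}. (\<integral>z. t z (E a) ^ k * t z (E b) \<partial>\<sigma>))"
    by (subst sum.remove[of _ a]) (auto simp: eq)
  also have "(\<Sum>i\<in>UNIV - {a}. (\<integral>z. t z (E a) ^ k * t z (E b) \<partial>\<sigma>)) = (real CARD('d) - 1) * (\<integral>z. t z (E a) ^ k * t z (E b) \<partial>\<sigma>)"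
    by (simp add: card_Diff_singleton of_nat_diff Suc_leI)
  finally show ?thesis by (simp add: mult.commute)
qed

lemma card_d: "CARD('d) \<ge> 2"
  using card_mono[of UNIV "{a, b}"] ab by simp

text \<open>Elimination of \<open>B\<close> and \<open>C\<close> from
  \<open>moment_identity\<close>, \<open>moment_rho\<close> and \<open>moment_sum\<close>. With
  \<open>card K / 2 = \<beta> + 1\<close> and \<open>card K * d / 2 = \<alpha> + \<beta> + 2\<close>
  this is the ratio of consecutive moments of a beta distribution.\<close>

lemma moment_Suc:
  "(real (card K) * real CARD('d) / 2 + real k) * (\<integral>z. t z (E a) ^ Suc k \<partial>\<sigma>) = (real (card K) / 2 + real k) * (\<integral>z. t z (E a) ^ k \<partial>\<sigma>)"
proof -
  define m where "m = real (card K)"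
  define d where "d = real CARD('d)"
  define A where "A = (\<integral>z. t z (E a) ^ Suc k \<partial>\<sigma>)"
  define B where "B = (\<integral>z. t z (E a) ^ k * t z (E b) \<partial>\<sigma>)"
  define C where "C = (\<integral>z. t z (E a) ^ (k - 1) * (\<rho> z)\<^sup>2 \<partial>\<sigma>)"
  have "(1 + real k) * (B + 2 * real k * C) = (1 + real k) * A"
    using moment_identity[of k] by (simp add: A_def B_def C_def algebra_simps)
  then have 1: "B + 2 * real k * C = A"
    by (subst (asm) mult_cancel_left) auto
  \<comment> \<open>The factor \<open>real k\<close> stays: for \<open>k = 0\<close> the exponent in
    \<open>C\<close> is truncated and \<open>moment_rho\<close> says nothing about \<open>B\<close>,
    but then \<open>C\<close> has coefficient 0 in the first relation.\<close>
  have 2: "real k * (m * C) = real k * B"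
    using moment_rho[of "k - 1"] by (cases k) (auto simp: m_def B_def C_def)
  have 3: "(\<integral>z. t z (E a) ^ k \<partial>\<sigma>) = A + (d - 1) * B"
    using moment_sum[of k] by (simp add: A_def B_def d_def)
  have "m * A = (m + 2 * real k) * B" using 1 2 by (auto simp: algebra_simps)
  then show ?thesis
    unfolding 3 A_def[symmetric] m_def[symmetric] d_def[symmetric]
  proof -
    assume mA: "m * A = (m + 2 * real k) * B"
    have "(m / 2 + real k) * (A + (d - 1) * B) = (m / 2 + real k) * A + (d - 1) / 2 * ((m + 2 * real k) * B)"
      by (simp add: algebra_simps add_divide_distrib diff_divide_distrib)
    also have "\<dots> = (m * d / 2 + real k) * A"
      unfolding mA[symmetric] by (simp add: algebra_simps add_divide_distrib diff_divide_distrib)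
    finally show "(m * d / 2 + real k) * A = (m / 2 + real k) * (A + (d - 1) * B)" ..
  qed
qed

end

section \<open>Jacobi polynomials and the Funk-Hecke formula\<close>

lemma sum_choose_alternating_Suc:
  fixes f :: "nat \<Rightarrow> real"
  shows "(\<Sum>s\<le>Suc n. (-1) ^ s * of_nat (Suc n choose s) * f s) = (\<Sum>s\<le>n. (-1) ^ s * of_nat (n choose s) * (f s - f (Suc s)))"
proof -
  have "(\<Sum>s\<le>n. (-1) ^ s * of_nat (n choose s) * f s) = (\<Sum>s\<le>Suc n. (-1) ^ s * of_nat (n choose s) * f s)"
    by simp
  also have "\<dots> = f 0 + (\<Sum>s\<le>n. (-1) ^ Suc s * of_nat (n choose Suc s) * f (Suc s))"
    by (subst sum.atMost_Suc_shift) simp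
  finally have 1: "(\<Sum>s\<le>n. (-1) ^ s * of_nat (n choose s) * f s) = f 0 + (\<Sum>s\<le>n. (-1) ^ Suc s * of_nat (n choose Suc s) * f (Suc s))" .
  have "(\<Sum>s\<le>Suc n. (-1) ^ s * of_nat (Suc n choose s) * f s) = f 0 + (\<Sum>s\<le>n. (-1) ^ Suc s * of_nat (Suc n choose Suc s) * f (Suc s))"
    by (subst sum.atMost_Suc_shift) simp
  also have "\<dots> = f 0 + (\<Sum>s\<le>n. (-1) ^ Suc s * of_nat (n choose Suc s) * f (Suc s)) - (\<Sum>s\<le>n. (-1) ^ s * of_nat (n choose s) * f (Suc s))"
  proof -
    have "(-1) ^ Suc s * of_nat (Suc n choose Suc s) * f (Suc s)
        = (-1) ^ Suc s * of_nat (n choose Suc s) * f (Suc s) - (-1) ^ s * of_nat (n choose s) * f (Suc s)" for s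
      by (simp add: algebra_simps)
    then show ?thesis by (simp only: sum_subtractf)
  qed
  finally show ?thesis
    unfolding 1[symmetric] by (simp add: right_diff_distrib sum_subtractf)
qed

text \<open>This is an \<open>n\<close>-th finite difference of a polynomial of degree
  \<open>k < n\<close> in \<open>s\<close>. Each differencing shortens the Pochhammer product by one
  factor.\<close>

lemma alternating_sum_pochhammer:
  fixes x :: real
  shows "k < n \<Longrightarrow> (\<Sum>s\<le>n. (-1) ^ s * of_nat (n choose s) * pochhammer (x - of_nat s) k) = 0"
proof (induction n arbitrary: k)
  case (Suc n)
  have diff: "pochhammer (x - of_nat s) k - pochhammer (x - of_nat (Suc s)) k = of_nat k * pochhammer (x - of_nat s) (k - 1)" for s
  proof (cases k)
    case (Suc j)
    have "pochhammer (x - of_nat s) (Suc j) = pochhammer (x - of_nat s) j * (x - of_nat s + of_nat j)"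
      by (rule pochhammer_Suc)
    moreover have "pochhammer (x - of_nat (Suc s)) (Suc j) = (x - of_nat (Suc s)) * pochhammer (x - of_nat s) j"
      by (simp add: pochhammer_rec)
    ultimately show ?thesis using Suc by (simp add: algebra_simps)
  qed simp
  have "(\<Sum>s\<le>Suc n. (-1) ^ s * of_nat (Suc n choose s) * pochhammer (x - of_nat s) k)
     = of_nat k * (\<Sum>s\<le>n. (-1) ^ s * of_nat (n choose s) * pochhammer (x - of_nat s) (k - 1))"
    unfolding sum_choose_alternating_Suc diff by (simp add: sum_distrib_left mult_ac)
  then show ?case using Suc by (cases "k = 0") auto
qed simp

section \<open>Jacobi polynomials in the variable \<open>t\<close>\<close>

definition jacobi_weight :: "nat \<Rightarrow> real \<Rightarrow> real \<Rightarrow> nat \<Rightarrow> real" where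
  "jacobi_weight n \<alpha> \<beta> s = ((real n + \<alpha>) gchoose (n - s)) * ((real n + \<beta>) gchoose s)"

text \<open>Since \<open>cos (2 * \<theta>) = 2 * (cos \<theta>)\<^sup>2 - 1\<close>, a Jacobi
  polynomial in \<open>cos (2 * \<theta>)\<close> becomes one in \<open>t\<close> under the
  substitution \<open>2 * x - 1\<close>.\<close>

definition shifted_jacobi :: "nat \<Rightarrow> real \<Rightarrow> real \<Rightarrow> real poly" where
  "shifted_jacobi n \<alpha> \<beta> = (\<Sum>s\<le>n. smult (jacobi_weight n \<alpha> \<beta> s) ([:-1, 1:] ^ s * [:0, 1:] ^ (n - s)))"

lemma poly_shifted_jacobi: "poly (shifted_jacobi n \<alpha> \<beta>) x = jacobi_poly n \<alpha> \<beta> (2 * x - 1)"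
proof -
  have e: "(2 * x - 2) / 2 = x - 1" by simp
  show ?thesis
    by (simp add: e shifted_jacobi_def jacobi_poly_def jacobi_weight_def poly_sum poly_power mult.assoc)
qed

text \<open>Rising factorials make positivity for \<open>\<alpha>, \<beta> > -1\<close> visible and
  combine with the numerators of the mixed moments.\<close>

lemma jacobi_weight_pochhammer:
  assumes "s \<le> n"
  shows "jacobi_weight n \<alpha> \<beta> s = pochhammer (\<alpha> + 1 + real s) (n - s) * pochhammer (\<beta> + 1 + real (n - s)) s / (fact s * fact (n - s))"
  using assms by (simp add: jacobi_weight_def gbinomial_pochhammer' of_nat_diff algebra_simps)

lemma jacobi_weight_pos:
  assumes "s \<le> n" "\<alpha> > -1" "\<beta> > -1"
  shows "jacobi_weight n \<alpha> \<beta> s > 0"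
  unfolding jacobi_weight_pochhammer[OF assms(1)] using assms(2,3)
  by (intro divide_pos_pos mult_pos_pos pochhammer_pos) auto

lemma shifted_jacobi_summand:
  fixes s n :: nat assumes "s \<le> n"
  shows "degree ([:-1, 1::real:] ^ s * [:0, 1:] ^ (n - s)) = n"
    and "coeff ([:-1, 1::real:] ^ s * [:0, 1:] ^ (n - s)) n = 1"
proof -
  show 1: "degree ([:-1, 1::real:] ^ s * [:0, 1:] ^ (n - s)) = n"
    using assms by (subst degree_mult_eq) (auto simp: degree_power_eq)
  have "lead_coeff ([:-1, 1::real:] ^ s * [:0, 1:] ^ (n - s)) = 1"
    by (simp add: lead_coeff_mult lead_coeff_power)
  then show "coeff ([:-1, 1::real:] ^ s * [:0, 1:] ^ (n - s)) n = 1" unfolding 1 .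
qed

lemma degree_shifted_jacobi: "degree (shifted_jacobi n \<alpha> \<beta>) \<le> n"
  unfolding shifted_jacobi_def
  by (intro degree_sum_le order.trans[OF degree_smult_le]) (auto simp: shifted_jacobi_summand)

text \<open>Every summand is monic of degree \<open>n\<close> and has a positive weight, so the top
  coefficients cannot cancel. \<open>P_unique\<close> divides by this coefficient.\<close>

lemma coeff_shifted_jacobi_pos:
  assumes "\<alpha> > -1" "\<beta> > -1"
  shows "coeff (shifted_jacobi n \<alpha> \<beta>) n > 0"
  unfolding shifted_jacobi_def coeff_sum coeff_smult
  using assms by (intro sum_pos) (auto simp: shifted_jacobi_summand jacobi_weight_pos)

lemma shifted_jacobi_1_pos:
  assumes "\<alpha> > -1" "\<beta> > -1"
  shows "poly (shifted_jacobi n \<alpha> \<beta>) 1 > 0"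
proof -
  have "poly (shifted_jacobi n \<alpha> \<beta>) 1 = (\<Sum>s\<le>n. jacobi_weight n \<alpha> \<beta> s * 0 ^ s)"
    by (simp add: shifted_jacobi_def poly_sum poly_power)
  also have "\<dots> = jacobi_weight n \<alpha> \<beta> 0"
    by (subst sum.mono_neutral_right[of _ "{0}"]) auto
  finally show ?thesis using jacobi_weight_pos[of 0 n] assms by simp
qed

context framed_space
begin

section \<open>Orthogonality of the Jacobi polynomials under the law of \<open>t\<close>\<close>

definition \<alpha> :: real where "\<alpha> = (real CARD('d) - 1) / 2 * real (card K) - 1"
definition \<beta> :: real where "\<beta> = real (card K) / 2 - 1"

lemma card_K: "card K > 0"
  using K by (simp add: card_gt_0_iff)

lemma alpha_gt: "\<alpha> > -1" and beta_gt: "\<beta> > -1"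
  using card_d card_K by (auto simp: \<alpha>_def \<beta>_def)

lemma moment: "(\<integral>z. t z (E a) ^ k \<partial>\<sigma>) = pochhammer (\<beta> + 1) k / pochhammer (\<alpha> + \<beta> + 2) k"
proof (induction k)
  case 0
  show ?case by (simp add: prob_space)
next
  case (Suc k)
  have G: "\<alpha> + \<beta> + 2 = real (card K) * real CARD('d) / 2"
    by (simp add: \<alpha>_def \<beta>_def field_simps)
  have "\<alpha> + \<beta> + 2 > 0" using alpha_gt beta_gt by simp
  then have pos: "\<alpha> + \<beta> + 2 + real k > 0" "pochhammer (\<alpha> + \<beta> + 2) k > 0"
    by (auto intro: pochhammer_pos add_pos_nonneg)
  have "(\<alpha> + \<beta> + 2 + real k) * (\<integral>z. t z (E a) ^ Suc k \<partial>\<sigma>) = (\<beta> + 1 + real k) * (\<integral>z. t z (E a) ^ k \<partial>\<sigma>)"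
    unfolding G using moment_Suc[of k] by (simp add: \<beta>_def)
  then have "(\<integral>z. t z (E a) ^ Suc k \<partial>\<sigma>) = (\<beta> + 1 + real k) * (\<integral>z. t z (E a) ^ k \<partial>\<sigma>) / (\<alpha> + \<beta> + 2 + real k)"
    using pos(1) by (subst nonzero_eq_divide_eq) (simp_all add: mult.commute)
  then show ?case
    unfolding Suc pochhammer_Suc by (simp add: mult_ac)
qed

lemma mixed_moment:
  "(\<integral>z. (1 - t z (E a)) ^ i * t z (E a) ^ j \<partial>\<sigma>) = pochhammer (\<alpha> + 1) i * pochhammer (\<beta> + 1) j / pochhammer (\<alpha> + \<beta> + 2) (i + j)"
proof (induction i arbitrary: j)
  case 0
  show ?case by (simp add: moment)
next
  case (Suc i)
  have "(\<integral>z. (1 - t z (E a)) ^ Suc i * t z (E a) ^ j \<partial>\<sigma>)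
      = (\<integral>z. (1 - t z (E a)) ^ i * t z (E a) ^ j - (1 - t z (E a)) ^ i * t z (E a) ^ Suc j \<partial>\<sigma>)"
    by (simp add: algebra_simps)
  also have "\<dots> = (\<integral>z. (1 - t z (E a)) ^ i * t z (E a) ^ j \<partial>\<sigma>) - (\<integral>z. (1 - t z (E a)) ^ i * t z (E a) ^ Suc j \<partial>\<sigma>)"
    by (rule Bochner_Integration.integral_diff) (intro bm_integrable bm_mult bm_power bm_diff bm_tE bm_const)+
  also have "\<dots> = pochhammer (\<alpha> + 1) (Suc i) * pochhammer (\<beta> + 1) j / pochhammer (\<alpha> + \<beta> + 2) (Suc i + j)"
  proof -
    have "\<alpha> + \<beta> + 2 > 0" using alpha_gt beta_gt by simp
    then have pos: "\<alpha> + \<beta> + 2 + real (i + j) \<noteq> 0" "pochhammer (\<alpha> + \<beta> + 2) (i + j) \<noteq> 0"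
      using pochhammer_pos[of "\<alpha> + \<beta> + 2" "i + j"] by auto
    have field: "A * B / G - A * (B * b) / (G * g) = A * (g - b) * B / (G * g)"
      if "G \<noteq> 0" "g \<noteq> 0" for A B G g b :: real
      using that by (simp add: field_simps)
    \<comment> \<open>The factor gained by \<open>pochhammer (\<alpha> + 1)\<close> is the
      difference of those gained by the denominator and by
      \<open>pochhammer (\<beta> + 1)\<close>.\<close>
    have "\<alpha> + 1 + real i = \<alpha> + \<beta> + 2 + real (i + j) - (\<beta> + 1 + real j)" by simp
    then show ?thesis
      unfolding Suc pochhammer_Suc add_Suc add_Suc_right using field[OF pos(2,1)] by simp
  qed
  finally show ?case .
qed

definition P :: "nat \<Rightarrow> real poly" where "P n = shifted_jacobi n \<alpha> \<beta>"

text \<open>Once the mixed moments are inserted, most factors depending on \<open>s\<close> combine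
  to Pochhammer symbols of length \<open>n\<close> and a binomial coefficient. What remains under
  the alternating sum is a Pochhammer symbol of length \<open>k\<close>, a polynomial of degree
  \<open>k < n\<close> in \<open>s\<close>.\<close>

lemma P_orth_monomial:
  assumes "k < n"
  shows "(\<integral>z. poly (P n) (t z (E a)) * t z (E a) ^ k \<partial>\<sigma>) = 0"
proof -
  let ?A = "\<alpha> + 1" and ?B = "\<beta> + 1" and ?G = "\<alpha> + \<beta> + 2"
  have bm: "bounded_measurable (\<lambda>z. (1 - t z (E a)) ^ i * t z (E a) ^ j)" for i j
    by (intro bm_mult bm_power bm_diff bm_tE bm_const)
  have "(\<integral>z. poly (P n) (t z (E a)) * t z (E a) ^ k \<partial>\<sigma>)
     = (\<integral>z. (\<Sum>s\<le>n. jacobi_weight n \<alpha> \<beta> s * (-1) ^ s * ((1 - t z (E a)) ^ s * t z (E a) ^ (n - s + k))) \<partial>\<sigma>)"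
  proof (intro Bochner_Integration.integral_cong[OF refl])
    fix z
    have "(t z (E a) - 1) ^ s = (-1) ^ s * (1 - t z (E a)) ^ s" for s
      by (simp flip: power_mult_distrib)
    then have "poly (P n) (t z (E a)) = (\<Sum>s\<le>n. jacobi_weight n \<alpha> \<beta> s * ((-1) ^ s * (1 - t z (E a)) ^ s * t z (E a) ^ (n - s)))"
      by (simp add: P_def shifted_jacobi_def poly_sum)
    then show "poly (P n) (t z (E a)) * t z (E a) ^ k = (\<Sum>s\<le>n. jacobi_weight n \<alpha> \<beta> s * (-1) ^ s * ((1 - t z (E a)) ^ s * t z (E a) ^ (n - s + k)))"
      by (simp only: sum_distrib_right, intro sum.cong refl) (simp only: power_add mult_ac)
  qed
  also have "\<dots> = (\<Sum>s\<le>n. jacobi_weight n \<alpha> \<beta> s * (-1) ^ s * (\<integral>z. (1 - t z (E a)) ^ s * t z (E a) ^ (n - s + k) \<partial>\<sigma>))"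
    by (subst Bochner_Integration.integral_sum) (force intro!: bm_integrable bm_mult[OF bm_const bm])+
  also have "\<dots> = (\<Sum>s\<le>n. pochhammer ?A n * pochhammer ?B n / (fact n * pochhammer ?G (n + k)) *
      ((-1) ^ s * of_nat (n choose s) * pochhammer (?B + real n - real s) k))"
  proof (rule sum.cong[OF refl])
    fix s assume "s \<in> {..n}"
    then have s: "s \<le> n" by simp
    have A: "pochhammer ?A n = pochhammer ?A s * pochhammer (?A + real s) (n - s)"
      by (rule pochhammer_product[OF s])
    have B: "pochhammer ?B n = pochhammer ?B (n - s) * pochhammer (?B + real (n - s)) s"
      using pochhammer_product[of "n - s" n ?B] s by simp
    have B': "pochhammer ?B (n - s + k) = pochhammer ?B (n - s) * pochhammer (?B + real (n - s)) k"
      using pochhammer_product'[of ?B "n - s" k] by simp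
    have c: "real (n choose s) = fact n / (fact s * fact (n - s))"
      by (rule binomial_fact[OF s])
    have e: "?B + real n - real s = ?B + real (n - s)" "s + (n - s + k) = n + k"
      using s by (auto simp: of_nat_diff)
    show "jacobi_weight n \<alpha> \<beta> s * (-1) ^ s * (\<integral>z. (1 - t z (E a)) ^ s * t z (E a) ^ (n - s + k) \<partial>\<sigma>)
      = pochhammer ?A n * pochhammer ?B n / (fact n * pochhammer ?G (n + k)) *
      ((-1) ^ s * of_nat (n choose s) * pochhammer (?B + real n - real s) k)"
      unfolding mixed_moment jacobi_weight_pochhammer[OF s] e A B B' c by (simp add: mult_ac)
  qed
  also have "\<dots> = 0"
    unfolding sum_distrib_left[symmetric] alternating_sum_pochhammer[OF assms] by simp
  finally show ?thesis .
qed

lemma P_orth: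
  assumes "degree p < n" "y \<in> space \<sigma>"
  shows "(\<integral>z. poly (P n) (t z y) * poly p (t z y) \<partial>\<sigma>) = 0"
proof -
  have bm: "bounded_measurable (\<lambda>z. poly (P n) (t z (E a)) * t z (E a) ^ k)" for k
    by (intro bm_mult bm_power bm_tE bm_profile E_space profile_poly)
  have "(\<integral>z. poly (P n * p) (t z y) \<partial>\<sigma>) = (\<integral>z. poly (P n * p) (t z (E a)) \<partial>\<sigma>)"
    by (rule integral_zonal[OF profile_poly assms(2) E_space])
  also have "\<dots> = (\<integral>z. (\<Sum>k\<le>degree p. coeff p k * (poly (P n) (t z (E a)) * t z (E a) ^ k)) \<partial>\<sigma>)"
    by (simp add: poly_altdef[of p] sum_distrib_left mult_ac)
  also have "\<dots> = (\<Sum>k\<le>degree p. coeff p k * (\<integral>z. poly (P n) (t z (E a)) * t z (E a) ^ k \<partial>\<sigma>))"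
    by (subst Bochner_Integration.integral_sum) (force intro!: bm_integrable bm_mult[OF bm_const bm])+
  also have "\<dots> = 0" using assms(1) by (simp add: P_orth_monomial)
  finally show ?thesis by simp
qed

text \<open>Subtracting the multiple of \<open>P n\<close> with the same top coefficient leaves a
  polynomial of degree below \<open>n\<close> that is orthogonal to itself; full support makes it
  vanish at all values of \<open>t\<close>.\<close>

lemma P_unique:
  assumes "degree R \<le> n" "y \<in> space \<sigma>"
    and "\<And>p. degree p < n \<Longrightarrow> (\<integral>z. poly R (t z y) * poly p (t z y) \<partial>\<sigma>) = 0"
  shows "\<exists>l. \<forall>z\<in>space \<sigma>. poly R (t z y) = l * poly (P n) (t z y)"
proof -
  define l where "l = coeff R n / coeff (P n) n"
  define r where "r = R - smult l (P n)"
  have lead: "coeff (P n) n \<noteq> 0"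
    using coeff_shifted_jacobi_pos[OF alpha_gt beta_gt, of n] by (simp add: P_def)
  have "coeff r n = 0" using lead by (simp add: r_def l_def)
  moreover have "degree r \<le> n"
    unfolding r_def P_def using assms(1) degree_shifted_jacobi
    by (intro degree_diff_le order.trans[OF degree_smult_le]) auto
  ultimately have r: "degree r < n \<or> r = 0"
    using eq_zero_or_degree_less by blast
  have bm: "bounded_measurable (\<lambda>z. poly p (t z y) * poly q (t z y))" for p q
    by (intro bm_mult bm_profile profile_poly assms)
  have "(\<integral>z. (poly r (t z y))\<^sup>2 \<partial>\<sigma>) = 0"
  proof (cases "r = 0")
    case False
    then have deg: "degree r < n" using r by simp
    have "(\<integral>z. (poly r (t z y))\<^sup>2 \<partial>\<sigma>) = (\<integral>z. poly R (t z y) * poly r (t z y) - l * (poly (P n) (t z y) * poly r (t z y)) \<partial>\<sigma>)"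
      by (rule Bochner_Integration.integral_cong[OF refl]) (simp add: r_def algebra_simps power2_eq_square)
    also have "\<dots> = (\<integral>z. poly R (t z y) * poly r (t z y) \<partial>\<sigma>) - l * (\<integral>z. poly (P n) (t z y) * poly r (t z y) \<partial>\<sigma>)"
      by (subst Bochner_Integration.integral_diff) (auto intro!: bm_integrable bm)
    also have "\<dots> = 0" by (simp add: assms(3) P_orth deg assms(2))
    finally show ?thesis .
  qed simp
  then have "poly r (t z y) = 0" if "z \<in> space \<sigma>" for z
    using integral_square_eq_0[OF assms(2) _ _ that, of "poly r"] by (simp add: continuous_on_poly[OF continuous_on_id, unfolded id_def])
  then show ?thesis by (auto simp: r_def)
qed

text \<open>Self-adjointness of convolution with \<open>h\<close>: the kernel is symmetric because
  the inner product is, and boundedness on the product space permits Fubini.\<close>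

lemma convolution_swap:
  assumes "profile h" "profile f" "profile g" "y \<in> space \<sigma>"
  shows "(\<integral>w. (\<integral>z. h (t z w) * f (t z y) \<partial>\<sigma>) * g (t w y) \<partial>\<sigma>) = (\<integral>z. f (t z y) * (\<integral>w. h (t w z) * g (t w y) \<partial>\<sigma>) \<partial>\<sigma>)"
proof -
  interpret pp: pair_prob_space \<sigma> \<sigma> ..
  obtain A B C where A: "\<And>x. x \<in> {0..1} \<Longrightarrow> \<bar>h x\<bar> \<le> A" and B: "\<And>x. x \<in> {0..1} \<Longrightarrow> \<bar>f x\<bar> \<le> B" and C: "\<And>x. x \<in> {0..1} \<Longrightarrow> \<bar>g x\<bar> \<le> C"
    using assms(1-3) unfolding profile_def by blast
  note [measurable] = assms(1-3)[THEN profile_measurable]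
  define H where "H z w = h (t z w) * f (t z y) * g (t w y)" for z w
  have "norm (case_prod H p) \<le> A * B * C" if "p \<in> space (\<sigma> \<Otimes>\<^sub>M \<sigma>)" for p
  proof -
    have "norm (H z w) \<le> A * B * C" if "z \<in> space \<sigma>" "w \<in> space \<sigma>" for z w
    proof -
      have "0 \<le> A" "0 \<le> B" using A[of 0] B[of 0] by auto
      then have "\<bar>h (t z w)\<bar> * \<bar>f (t z y)\<bar> * \<bar>g (t w y)\<bar> \<le> A * B * C"
        by (intro mult_mono mult_nonneg_nonneg abs_ge_zero A[OF t_range[OF that]]
            B[OF t_range[OF that(1) assms(4)]] C[OF t_range[OF that(2) assms(4)]])
      then show ?thesis by (simp add: H_def abs_mult)
    qed
    then show ?thesis using that by (auto simp: space_pair_measure)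
  qed
  moreover have [measurable]: "case_prod H \<in> borel_measurable (\<sigma> \<Otimes>\<^sub>M \<sigma>)"
    unfolding H_def by measurable
  ultimately have int: "integrable (\<sigma> \<Otimes>\<^sub>M \<sigma>) (case_prod H)"
    by (intro pp.P.integrable_const_bound[of _ "A * B * C"]) auto
  have "(\<integral>w. (\<integral>z. h (t z w) * f (t z y) \<partial>\<sigma>) * g (t w y) \<partial>\<sigma>) = (\<integral>w. (\<integral>z. H z w \<partial>\<sigma>) \<partial>\<sigma>)"
    by (simp add: H_def)
  also have "\<dots> = (\<integral>z. (\<integral>w. H z w \<partial>\<sigma>) \<partial>\<sigma>)"
    by (rule pp.Fubini_integral[OF int])
  also have "\<dots> = (\<integral>z. f (t z y) * (\<integral>w. h (t w z) * g (t w y) \<partial>\<sigma>) \<partial>\<sigma>)"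
    unfolding H_def
    by (subst Bochner_Integration.integral_mult_right_zero[symmetric]) (simp add: mult_ac inner_commute)
  finally show ?thesis .
qed

text \<open>
  Convolution with a zonal kernel is self-adjoint and does not raise degrees,
  hence it maps each orthogonal polynomial to a multiple of itself.
\<close>

lemma funk_hecke:
  assumes h: "profile h"
  shows "\<exists>l. \<forall>w\<in>space \<sigma>. \<forall>y\<in>space \<sigma>. (\<integral>z. h (t z w) * poly (P n) (t z y) \<partial>\<sigma>) = l * poly (P n) (t w y)"
proof -
  obtain R where R: "degree R \<le> degree (P n)"
    "\<And>w y. w \<in> space \<sigma> \<Longrightarrow> y \<in> space \<sigma> \<Longrightarrow> (\<integral>z. h (t z w) * poly (P n) (t z y) \<partial>\<sigma>) = poly R (t w y)"
    using convolution_poly[OF h, of "P n"] by blast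
  let ?o = "E a"
  have "(\<integral>w. poly R (t w ?o) * poly p (t w ?o) \<partial>\<sigma>) = 0" if p: "degree p < n" for p
  proof -
    obtain q where q: "degree q \<le> degree p"
      "\<And>w y. w \<in> space \<sigma> \<Longrightarrow> y \<in> space \<sigma> \<Longrightarrow> (\<integral>z. h (t z w) * poly p (t z y) \<partial>\<sigma>) = poly q (t w y)"
      using convolution_poly[OF h, of p] by blast
    have "(\<integral>w. poly R (t w ?o) * poly p (t w ?o) \<partial>\<sigma>) = (\<integral>w. (\<integral>z. h (t z w) * poly (P n) (t z ?o) \<partial>\<sigma>) * poly p (t w ?o) \<partial>\<sigma>)"
      by (intro Bochner_Integration.integral_cong) (auto simp: R(2) E_space)
    also have "\<dots> = (\<integral>z. poly (P n) (t z ?o) * (\<integral>w. h (t w z) * poly p (t w ?o) \<partial>\<sigma>) \<partial>\<sigma>)"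
      by (rule convolution_swap[OF h profile_poly profile_poly E_space])
    also have "\<dots> = (\<integral>z. poly (P n) (t z ?o) * poly q (t z ?o) \<partial>\<sigma>)"
      by (intro Bochner_Integration.integral_cong) (auto simp: q(2) E_space)
    also have "\<dots> = 0"
      using q(1) p by (intro P_orth E_space) simp
    finally show ?thesis .
  qed
  moreover have "degree R \<le> n"
    using R(1) degree_shifted_jacobi[of n \<alpha> \<beta>] by (simp add: P_def)
  ultimately obtain l where l: "\<And>z. z \<in> space \<sigma> \<Longrightarrow> poly R (t z ?o) = l * poly (P n) (t z ?o)"
    using P_unique[OF _ E_space, of R n] by blast
  \<comment> \<open>So far the relation is known about the centre \<open>E a\<close>; transitivity
    carries it to an arbitrary centre \<open>y\<close>.\<close>
  have "poly R (t w y) = l * poly (P n) (t w y)" if wy: "w \<in> space \<sigma>" "y \<in> space \<sigma>" for w y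
  proof -
    obtain T where T: "isom T" "T y = ?o" using transitive[OF wy(2) E_space] .
    then show ?thesis using l[OF isom_space[OF T(1) wy(1)]] isom_inner[OF T(1) wy] by simp
  qed
  then show ?thesis by (intro exI[of _ l] ballI) (simp add: R(2))
qed

end

section \<open>Energy and number variance\<close>

context framed_space
begin

text \<open>The threshold \<open>s\<close> is the squared cosine of the radius, so a large
  \<open>s\<close> means a small ball.\<close>

definition cap :: "real \<Rightarrow> real" where
  "cap s = (\<integral>z. indicator {s<..} (t z (E a)) \<partial>\<sigma>)"

lemma cap_eq: "y \<in> space \<sigma> \<Longrightarrow> (\<integral>z. indicator {s<..} (t z y) \<partial>\<sigma>) = cap s"
  unfolding cap_def by (intro integral_zonal profile_indicator E_space) auto

lemma cap_measure:
  assumes "y \<in> space \<sigma>" shows "measure \<sigma> {z\<in>space \<sigma>. s < t z y} = cap s"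
proof -
  have "measure \<sigma> {z\<in>space \<sigma>. s < t z y} = (\<integral>z. indicator {z\<in>space \<sigma>. s < t z y} z \<partial>\<sigma>)"
  proof -
    have "{z\<in>space \<sigma>. s < t z y} \<inter> space \<sigma> = {z\<in>space \<sigma>. s < t z y}" by auto
    then show ?thesis by simp
  qed
  also have "\<dots> = (\<integral>z. indicator {s<..} (t z y) \<partial>\<sigma>)"
    by (intro Bochner_Integration.integral_cong) (auto split: split_indicator)
  finally show ?thesis using cap_eq[OF assms] by simp
qed

definition discrepancy :: "'p set \<Rightarrow> real \<Rightarrow> 'p \<Rightarrow> real" where
  "discrepancy X s x = (\<Sum>y\<in>X. indicator {s<..} (t x y)) - real (card X) * cap s"

definition cap_variance :: "'p set \<Rightarrow> real \<Rightarrow> real" where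
  "cap_variance X s = (\<integral>x. (discrepancy X s x)\<^sup>2 \<partial>\<sigma>)"

lemma bm_discrepancy:
  assumes "X \<subseteq> space \<sigma>" shows "bounded_measurable (discrepancy X s)"
  unfolding discrepancy_def using assms
  by (intro bm_diff bm_sum bm_const bm_profile profile_indicator) auto

text \<open>The difference of the two sides is the variance of \<open>f\<close>.\<close>

lemma square_integral_le:
  assumes "bounded_measurable f" shows "(\<integral>z. f z \<partial>\<sigma>)\<^sup>2 \<le> (\<integral>z. (f z)\<^sup>2 \<partial>\<sigma>)"
  using variance_positive[of f] variance_eq[OF bm_integrable[OF assms] bm_integrable[OF bm_power[OF assms]]]
  by simp

text \<open>\<open>P n\<close> is positive near 1. For a threshold close to 1 the left side at
  \<open>w = y\<close> therefore integrates a nonnegative function that is positive on a cap of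
  positive measure, which a zero eigenvalue would contradict.\<close>

lemma multiplier_nonzero:
  "\<exists>s l. 0 < s \<and> s < 1 \<and> l \<noteq> 0 \<and> (\<forall>w\<in>space \<sigma>. \<forall>y\<in>space \<sigma>.
     (\<integral>z. indicator {s<..} (t z w) * poly (P n) (t z y) \<partial>\<sigma>) = l * poly (P n) (t w y))"
proof -
  have P1: "poly (P n) 1 > 0"
    using shifted_jacobi_1_pos[OF alpha_gt beta_gt] by (simp add: P_def)
  have "isCont (poly (P n)) 1" by simp
  then obtain d where d: "d > 0" "\<And>x. \<bar>x - 1\<bar> < d \<Longrightarrow> \<bar>poly (P n) x - poly (P n) 1\<bar> < poly (P n) 1"
    using P1 unfolding continuous_at_eps_delta dist_real_def by metis
  \<comment> \<open>\<open>1 - d\<close> secures positivity on the cap; \<open>1 / 2\<close> keeps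
    the threshold away from 0, inside the range that hyperuniformity covers.\<close>
  define s where "s = max (1 / 2) (1 - d)"
  have s: "0 < s" "s < 1" "1 - d \<le> s" using d(1) by (auto simp: s_def)
  have pos: "poly (P n) x > 0" if "s < x" "x \<le> 1" for x
  proof -
    have "\<bar>x - 1\<bar> < d" using that s by linarith
    then show ?thesis using d(2)[of x] by linarith
  qed
  have prof: "profile (indicator {s<..})" by (rule profile_indicator) simp
  obtain l where l: "\<forall>w\<in>space \<sigma>. \<forall>y\<in>space \<sigma>.
     (\<integral>z. indicator {s<..} (t z w) * poly (P n) (t z y) \<partial>\<sigma>) = l * poly (P n) (t w y)"
    using funk_hecke[OF prof, of n] by (elim exE)
  let ?o = "E a"
  let ?f = "\<lambda>z. indicator {s<..} (t z ?o) * poly (P n) (t z ?o)"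
  have nonneg: "0 \<le> ?f z" if "z \<in> space \<sigma>" for z
    using pos[of "t z ?o"] t_le_1[OF that E_space, of a] by (auto split: split_indicator intro: less_imp_le)
  have int: "integrable \<sigma> ?f"
    by (intro bm_integrable bm_mult bm_profile prof profile_poly E_space)
  have "l \<noteq> 0"
  proof
    assume "l = 0"
    then have "(\<integral>z. ?f z \<partial>\<sigma>) = 0" using l E_space by simp
    then have "AE z in \<sigma>. ?f z = 0"
      using integral_nonneg_eq_0_iff_AE[OF int] nonneg by (simp add: AE_I2)
    then have "AE z in \<sigma>. z \<notin> {z\<in>space \<sigma>. s < t z ?o}"
    proof eventually_elim
      case (elim z)
      then show ?case using pos[of "t z ?o"] t_le_1[of z ?o] E_space by (auto simp: indicator_def)
    qed
    moreover have "{z\<in>space \<sigma>. s < t z ?o} \<in> sets \<sigma>" by measurable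
    ultimately have "measure \<sigma> {z\<in>space \<sigma>. s < t z ?o} = 0"
      using measure_eq_0_null_sets AE_iff_null_sets by blast
    then show False using cap_pos[OF E_space s(2), of a] by simp
  qed
  then show ?thesis using s l by (intro exI[of _ s] exI[of _ l]) simp
qed

text \<open>The vanishing mean lets the expected number of points be subtracted without changing a
  convolution with \<open>P n\<close>. For \<open>n = 0\<close> it fails.\<close>

lemma P_mean_zero: "n \<ge> 1 \<Longrightarrow> y \<in> space \<sigma> \<Longrightarrow> (\<integral>z. poly (P n) (t z y) \<partial>\<sigma>) = 0"
  using P_orth[of "[:1:]" n y] by simp

definition energy :: "nat \<Rightarrow> 'p set \<Rightarrow> real" where
  "energy n X = (\<Sum>x\<in>X. \<Sum>y\<in>X. poly (P n) (t x y))"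

text \<open>By \<open>funk_hecke\<close> with kernel \<open>P n\<close>, convolving
  \<open>P n\<close> with itself reproduces it up to a factor \<open>c\<close>. At coinciding points
  \<open>c * poly (P n) 1\<close> is a squared norm, hence \<open>c > 0\<close>, and the energy is
  nonnegative.\<close>

lemma energy_eq_norm:
  "\<exists>c>0. \<forall>X. finite X \<and> X \<subseteq> space \<sigma> \<longrightarrow> (\<integral>z. (\<Sum>y\<in>X. poly (P n) (t z y))\<^sup>2 \<partial>\<sigma>) = c * energy n X"
proof -
  obtain c where c: "\<forall>w\<in>space \<sigma>. \<forall>y\<in>space \<sigma>.
     (\<integral>z. poly (P n) (t z w) * poly (P n) (t z y) \<partial>\<sigma>) = c * poly (P n) (t w y)"
    using funk_hecke[OF profile_poly[of "P n"], of n] by (elim exE)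
  have P1: "poly (P n) 1 > 0"
    using shifted_jacobi_1_pos[OF alpha_gt beta_gt] by (simp add: P_def)
  let ?o = "E a"
  have "c * poly (P n) 1 = (\<integral>z. (poly (P n) (t z ?o))\<^sup>2 \<partial>\<sigma>)"
    using c E_space[of a] by (simp add: t_self power2_eq_square)
  moreover have "(\<integral>z. (poly (P n) (t z ?o))\<^sup>2 \<partial>\<sigma>) \<noteq> 0"
    using integral_square_eq_0[OF E_space, of "poly (P n)" a ?o] P1 E_space[of a]
    by (auto simp: t_self continuous_on_poly[OF continuous_on_id, unfolded id_def])
  moreover have "(\<integral>z. (poly (P n) (t z ?o))\<^sup>2 \<partial>\<sigma>) \<ge> 0" by simp
  ultimately have "c > 0" using P1 by (metis less_eq_real_def zero_less_mult_pos2)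
  moreover have "(\<integral>z. (\<Sum>y\<in>X. poly (P n) (t z y))\<^sup>2 \<partial>\<sigma>) = c * energy n X"
    if X: "finite X" "X \<subseteq> space \<sigma>" for X
  proof -
    have bm: "bounded_measurable (\<lambda>z. poly (P n) (t z x) * poly (P n) (t z y))" if "x \<in> X" "y \<in> X" for x y
      using that X by (intro bm_mult bm_profile profile_poly) auto
    have "(\<integral>z. (\<Sum>y\<in>X. poly (P n) (t z y))\<^sup>2 \<partial>\<sigma>) = (\<integral>z. (\<Sum>x\<in>X. \<Sum>y\<in>X. poly (P n) (t z x) * poly (P n) (t z y)) \<partial>\<sigma>)"
      by (simp add: power2_eq_square sum_product)
    also have "\<dots> = (\<Sum>x\<in>X. \<integral>z. (\<Sum>y\<in>X. poly (P n) (t z x) * poly (P n) (t z y)) \<partial>\<sigma>)"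
      by (rule Bochner_Integration.integral_sum) (intro bm_integrable bm_sum bm)
    also have "\<dots> = (\<Sum>x\<in>X. \<Sum>y\<in>X. \<integral>z. poly (P n) (t z x) * poly (P n) (t z y) \<partial>\<sigma>)"
      by (intro sum.cong refl Bochner_Integration.integral_sum bm_integrable bm)
    also have "\<dots> = (\<Sum>x\<in>X. \<Sum>y\<in>X. c * poly (P n) (t x y))"
      by (intro sum.cong refl c[rule_format] subsetD[OF X(2)])
    finally show ?thesis by (simp add: energy_def sum_distrib_left)
  qed
  ultimately show ?thesis by blast
qed

text \<open>Let \<open>f\<close> be the sum of the kernels at the points of \<open>X\<close>. Then
  \<open>l * f\<close> is the convolution of the discrepancy with \<open>P n\<close>. Cauchy-Schwarz
  with a bound \<open>M\<close> on \<open>P n\<close> bounds the square of \<open>f\<close>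
  pointwise by \<open>M\<^sup>2 / l\<^sup>2\<close> times the variance, and division by the constant
  \<open>c\<close> of \<open>energy_eq_norm\<close> gives
  \<open>C = M\<^sup>2 / (c * l\<^sup>2)\<close>.\<close>

lemma energy_le_variance:
  assumes n: "n \<ge> 1"
  shows "\<exists>s C. 0 < s \<and> s < 1 \<and> (\<forall>X. finite X \<and> X \<subseteq> space \<sigma> \<longrightarrow>
    0 \<le> energy n X \<and> energy n X \<le> C * cap_variance X s)"
proof -
  obtain s l where sl: "0 < s" "s < 1" "l \<noteq> 0" and l: "\<forall>w\<in>space \<sigma>. \<forall>y\<in>space \<sigma>.
     (\<integral>z. indicator {s<..} (t z w) * poly (P n) (t z y) \<partial>\<sigma>) = l * poly (P n) (t w y)"
    using multiplier_nonzero[of n] by (elim exE conjE)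
  obtain c where c: "c > 0" "\<forall>X. finite X \<and> X \<subseteq> space \<sigma> \<longrightarrow> (\<integral>z. (\<Sum>y\<in>X. poly (P n) (t z y))\<^sup>2 \<partial>\<sigma>) = c * energy n X"
    using energy_eq_norm[of n] by (elim exE conjE)
  obtain M where M: "\<And>x. x \<in> {0..1} \<Longrightarrow> \<bar>poly (P n) x\<bar> \<le> M"
    using profile_poly[of "P n"] unfolding profile_def by (elim conjE exE) blast
  have prof: "profile (indicator {s<..})" by (rule profile_indicator) simp
  have "0 \<le> energy n X \<and> energy n X \<le> M\<^sup>2 / (c * l\<^sup>2) * cap_variance X s"
    if X: "finite X" "X \<subseteq> space \<sigma>" for X
  proof -
    define f where "f z = (\<Sum>y\<in>X. poly (P n) (t z y))" for z
    have bmf: "bounded_measurable f" unfolding f_def using X by (intro bm_sum bm_profile profile_poly) auto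
    have norm_f: "(\<integral>z. (f z)\<^sup>2 \<partial>\<sigma>) = c * energy n X" using c(2) X by (simp add: f_def)
    then have "0 \<le> c * energy n X" by (metis Bochner_Integration.integral_nonneg zero_le_power2)
    then have "0 \<le> energy n X" using c(1) by (simp add: zero_le_mult_iff)
    have bound: "(f z)\<^sup>2 \<le> M\<^sup>2 / l\<^sup>2 * cap_variance X s" if z: "z \<in> space \<sigma>" for z
    proof -
      have bmP: "bounded_measurable (\<lambda>w. poly (P n) (t w z))" by (intro bm_profile profile_poly z)
      have bmI: "bounded_measurable (\<lambda>w. indicator {s<..} (t w y) * poly (P n) (t w z))" if "y \<in> X" for y
        using that X by (intro bm_mult bmP bm_profile prof) auto
      have bmD: "bounded_measurable (\<lambda>w. discrepancy X s w * poly (P n) (t w z))"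
        by (intro bm_mult bm_discrepancy X bmP)
      have "l * f z = (\<Sum>y\<in>X. l * poly (P n) (t y z))"
        by (simp add: f_def sum_distrib_left inner_commute)
      also have "\<dots> = (\<Sum>y\<in>X. \<integral>w. indicator {s<..} (t w y) * poly (P n) (t w z) \<partial>\<sigma>)"
        by (intro sum.cong refl l[rule_format, symmetric] z subsetD[OF X(2)])
      \<comment> \<open>The subtracted term is zero by \<open>P_mean_zero\<close>; it completes the
        count to the discrepancy.\<close>
      also have "\<dots> = (\<integral>w. (\<Sum>y\<in>X. indicator {s<..} (t w y) * poly (P n) (t w z)) \<partial>\<sigma>)
          - real (card X) * cap s * (\<integral>w. poly (P n) (t w z) \<partial>\<sigma>)"
        using P_mean_zero[OF n z] bmI by (subst Bochner_Integration.integral_sum) (auto intro: bm_integrable)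
      also have "\<dots> = (\<integral>w. (\<Sum>y\<in>X. indicator {s<..} (t w y) * poly (P n) (t w z))
          - real (card X) * cap s * poly (P n) (t w z) \<partial>\<sigma>)"
        by (subst Bochner_Integration.integral_diff) (auto intro!: bm_integrable bm_sum bmI bmP bm_mult[OF bm_const])
      also have "\<dots> = (\<integral>w. discrepancy X s w * poly (P n) (t w z) \<partial>\<sigma>)"
        by (intro Bochner_Integration.integral_cong refl)
          (simp add: discrepancy_def left_diff_distrib sum_distrib_right)
      finally have "(l * f z)\<^sup>2 \<le> (\<integral>w. (discrepancy X s w * poly (P n) (t w z))\<^sup>2 \<partial>\<sigma>)"
        using square_integral_le[OF bmD] by simp
      also have "\<dots> \<le> (\<integral>w. M\<^sup>2 * (discrepancy X s w)\<^sup>2 \<partial>\<sigma>)"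
      proof (rule integral_mono)
        show "integrable \<sigma> (\<lambda>w. (discrepancy X s w * poly (P n) (t w z))\<^sup>2)"
          by (intro bm_integrable bm_power bmD)
        show "integrable \<sigma> (\<lambda>w. M\<^sup>2 * (discrepancy X s w)\<^sup>2)"
          by (intro bm_integrable bm_mult bm_power bm_const bm_discrepancy X)
        fix w assume w: "w \<in> space \<sigma>"
        have "(poly (P n) (t w z))\<^sup>2 \<le> M\<^sup>2"
          using M[OF t_range[OF w z]] by (simp add: abs_le_square_iff[symmetric])
        then show "(discrepancy X s w * poly (P n) (t w z))\<^sup>2 \<le> M\<^sup>2 * (discrepancy X s w)\<^sup>2"
          unfolding power_mult_distrib by (subst mult.commute) (rule mult_right_mono, auto)
      qed
      also have "\<dots> = M\<^sup>2 * cap_variance X s" by (simp add: cap_variance_def)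
      finally show ?thesis using sl(3) by (simp add: power_mult_distrib field_simps)
    qed
    have "c * energy n X = (\<integral>z. (f z)\<^sup>2 \<partial>\<sigma>)" using norm_f by simp
    also have "\<dots> \<le> (\<integral>z. M\<^sup>2 / l\<^sup>2 * cap_variance X s \<partial>\<sigma>)"
      by (intro integral_mono bm_integrable bm_power bmf bm_const bound)
    also have "\<dots> = M\<^sup>2 / l\<^sup>2 * cap_variance X s" by (simp add: prob_space)
    finally have "energy n X \<le> M\<^sup>2 / (c * l\<^sup>2) * cap_variance X s"
      using c(1) sl(3) by (simp add: field_simps)
    then show ?thesis using \<open>0 \<le> energy n X\<close> by simp
  qed
  then show ?thesis using sl by blast
qed

theorem energy_tendsto:
  assumes "\<And>N. finite (X N)" "\<And>N. X N \<subseteq> space \<sigma>"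
    and V: "\<And>s. 0 < s \<Longrightarrow> s < 1 \<Longrightarrow> (\<lambda>N. cap_variance (X N) s / real (card (X N))) \<longlonglongrightarrow> 0"
    and "n \<ge> 1"
  shows "(\<lambda>N. energy n (X N) / real (card (X N))) \<longlonglongrightarrow> 0"
proof -
  obtain s C where sC: "0 < s" "s < 1" "\<forall>X. finite X \<and> X \<subseteq> space \<sigma> \<longrightarrow>
    0 \<le> energy n X \<and> energy n X \<le> C * cap_variance X s"
    using energy_le_variance[OF assms(4)] by (elim exE conjE)
  have lim: "(\<lambda>N. C * (cap_variance (X N) s / real (card (X N)))) \<longlonglongrightarrow> 0"
    using tendsto_mult_left[OF V[OF sC(1,2)], of C] by simp
  have "0 \<le> energy n (X N) / real (card (X N))"
    "energy n (X N) / real (card (X N)) \<le> C * (cap_variance (X N) s / real (card (X N)))" for N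
    using sC(3) assms(1,2) by (simp_all add: divide_right_mono)
  then show ?thesis
    by (intro tendsto_sandwich[OF _ _ tendsto_const lim] always_eventually allI)
qed

end

section \<open>Uniform distribution of caps\<close>

lemma Beta_add_nat:
  fixes x y :: real
  assumes "x > 0" "y > 0"
  shows "Beta (x + real k) y = Beta x y * (pochhammer x k / pochhammer (x + y) k)"
proof (induction k)
  case (Suc k)
  have "x + real k \<notin> \<int>\<^sub>\<le>\<^sub>0" using assms nonpos_Ints_nonpos by fastforce
  then have "(x + real k + y) * Beta (x + real k + 1) y = (x + real k) * Beta (x + real k) y"
    by (rule Beta_plus1_left)
  moreover have "x + real k + y > 0" using assms by simp
  ultimately have "Beta (x + real (Suc k)) y = (x + real k) * Beta (x + real k) y / (x + y + real k)"
    by (simp add: field_simps)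
  then show ?case
    unfolding Suc pochhammer_Suc by (simp add: mult_ac)
qed simp

text \<open>Denominators start at 2 so that the thresholds approximating \<open>s\<close> in the two
  continuity lemmas stay strictly inside the allowed interval.\<close>

lemma divide_nat_less:
  fixes v :: real
  assumes "v > 0"
  shows "0 < v / real (k + 2)" "v / real (k + 2) < v"
  using mult_strict_left_mono[of 1 "real (k + 2)" v] assms by (auto simp: divide_less_eq)

context framed_space
begin

definition beta_density :: "real \<Rightarrow> real" where
  "beta_density x = x powr \<beta> * (1 - x) powr \<alpha>"

text \<open>The comparison of the law of \<open>t\<close> with the beta density is confined to
  polynomials, which avoids a moment problem; powers of a single polynomial suffice for null
  spheres.\<close>

lemma poly_beta_integral:
  "((\<lambda>x. poly p x * beta_density x) has_integral
     Beta (\<beta> + 1) (\<alpha> + 1) * (\<integral>z. poly p (t z (E a)) \<partial>\<sigma>)) {0..1}"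
proof -
  have pos: "\<beta> + 1 > 0" "\<alpha> + 1 > 0" using alpha_gt beta_gt by auto
  have mono: "((\<lambda>x. x ^ k * beta_density x) has_integral Beta (\<beta> + 1) (\<alpha> + 1) * (\<integral>z. t z (E a) ^ k \<partial>\<sigma>)) {0..1}" for k
  proof -
    have "((\<lambda>x. x powr (\<beta> + 1 + real k - 1) * (1 - x) powr (\<alpha> + 1 - 1)) has_integral Beta (\<beta> + 1 + real k) (\<alpha> + 1)) {0..1}"
      using pos by (intro has_integral_Beta_real) auto
    \<comment> \<open>At \<open>x = 0\<close> both sides are 0 because \<open>0 powr _\<close> is 0,
      also for negative \<beta> and for \<open>k = 0\<close>.\<close>
    moreover have "x powr (\<beta> + 1 + real k - 1) * (1 - x) powr (\<alpha> + 1 - 1) = x ^ k * beta_density x" if "x \<in> {0..1}" for x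
      using that by (cases "x = 0") (auto simp: beta_density_def powr_add powr_realpow)
    ultimately have "((\<lambda>x. x ^ k * beta_density x) has_integral Beta (\<beta> + 1 + real k) (\<alpha> + 1)) {0..1}"
      by (rule has_integral_eq[rotated])
    moreover have "\<beta> + 1 + (\<alpha> + 1) = \<alpha> + \<beta> + 2" by simp
    ultimately show ?thesis
      unfolding Beta_add_nat[OF pos] moment by simp
  qed
  have "((\<lambda>x. \<Sum>k\<le>degree p. coeff p k * (x ^ k * beta_density x)) has_integral
      (\<Sum>k\<le>degree p. coeff p k * (Beta (\<beta> + 1) (\<alpha> + 1) * (\<integral>z. t z (E a) ^ k \<partial>\<sigma>)))) {0..1}"
    by (intro has_integral_sum has_integral_mult_right mono) auto
  moreover have "(\<Sum>k\<le>degree p. coeff p k * (Beta (\<beta> + 1) (\<alpha> + 1) * (\<integral>z. t z (E a) ^ k \<partial>\<sigma>)))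
      = Beta (\<beta> + 1) (\<alpha> + 1) * (\<integral>z. (\<Sum>k\<le>degree p. coeff p k * t z (E a) ^ k) \<partial>\<sigma>)"
    by (subst Bochner_Integration.integral_sum)
       (auto simp: sum_distrib_left mult_ac intro!: bm_integrable bm_mult bm_power bm_tE)
  ultimately show ?thesis
    by (simp add: poly_altdef sum_distrib_right mult.assoc)
qed

lemma beta_density_nonneg: "x \<in> {0..1} \<Longrightarrow> 0 \<le> beta_density x"
  by (simp add: beta_density_def)

text \<open>
  The powers of \<open>1 - (x - s)\<^sup>2\<close> decrease to the indicator of \<open>s\<close>, and by the moment
  formula their means are integrals against the beta density.
\<close>

lemma measure_sphere:
  assumes "0 \<le> s" "s \<le> 1"
  shows "measure \<sigma> {z\<in>space \<sigma>. t z (E a) = s} = 0"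
proof -
  define q where "q = [:1:] - [:-s, 1:]\<^sup>2"
  have q: "poly q x = 1 - (x - s)\<^sup>2" for x by (simp add: q_def poly_power)
  have q01: "0 \<le> poly q x" "poly q x \<le> 1" if "x \<in> {0..1}" for x
  proof -
    have "\<bar>x - s\<bar> \<le> 1" using that assms by auto
    then show "0 \<le> poly q x" "poly q x \<le> 1" by (auto simp: q abs_square_le_1)
  qed
  have q1: "poly q x < 1" if "x \<noteq> s" for x using that by (simp add: q)
  define b where "b = Beta (\<beta> + 1) (\<alpha> + 1)"
  have b: "b > 0" unfolding b_def Beta_def using alpha_gt beta_gt
    by (auto intro!: mult_pos_pos divide_pos_pos Gamma_real_pos)
  have int: "((\<lambda>x. poly (q ^ k) x * beta_density x) has_integral b * (\<integral>z. poly (q ^ k) (t z (E a)) \<partial>\<sigma>)) {0..1}" for k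
    unfolding b_def by (rule poly_beta_integral)
  have "(\<lambda>k. integral {0..1} (\<lambda>x. poly (q ^ k) x * beta_density x)) \<longlonglongrightarrow> integral {0..1} (\<lambda>x. if x = s then beta_density s else 0)"
  proof (rule dominated_convergence)
    show "(\<lambda>x. poly (q ^ k) x * beta_density x) integrable_on {0..1}" for k using int by blast
    \<comment> \<open>The density may be unbounded at an end point; its integrability is the case
      \<open>q ^ 0 = 1\<close>.\<close>
    show "beta_density integrable_on {0..1}" using int[of 0] by auto
    show "norm (poly (q ^ k) x * beta_density x) \<le> beta_density x" if "x \<in> {0..1}" for k x
      using q01[OF that] beta_density_nonneg[OF that]
      by (auto simp: poly_power abs_mult power_le_one intro!: mult_left_le_one_le)
    show "(\<lambda>k. poly (q ^ k) x * beta_density x) \<longlonglongrightarrow> (if x = s then beta_density s else 0)" if "x \<in> {0..1}" for x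
    proof (cases "x = s")
      case False
      have "(\<lambda>k. poly q x ^ k) \<longlonglongrightarrow> 0"
        using q01[OF that] q1[OF False] by (intro LIMSEQ_realpow_zero)
      then show ?thesis using False tendsto_mult_left_zero by (auto simp: poly_power)
    qed (simp add: poly_power q)
  qed
  moreover have "integral {0..1} (\<lambda>x. if x = s then beta_density s else 0) = 0"
    by (intro integral_unique has_integral_spike[OF negligible_sing[of s] _ has_integral_0]) auto
  ultimately have "(\<lambda>k. b * (\<integral>z. poly (q ^ k) (t z (E a)) \<partial>\<sigma>)) \<longlonglongrightarrow> 0"
    by (simp add: integral_unique[OF int] del: poly_power)
  then have "(\<lambda>k. inverse b * (b * (\<integral>z. poly (q ^ k) (t z (E a)) \<partial>\<sigma>))) \<longlonglongrightarrow> inverse b * 0"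
    by (rule tendsto_mult_left)
  then have lim: "(\<lambda>k. (\<integral>z. poly (q ^ k) (t z (E a)) \<partial>\<sigma>)) \<longlonglongrightarrow> 0"
    using b by (simp del: poly_power)
  have "measure \<sigma> {z\<in>space \<sigma>. t z (E a) = s} \<le> (\<integral>z. poly (q ^ k) (t z (E a)) \<partial>\<sigma>)" for k
  proof -
    have "{z\<in>space \<sigma>. t z (E a) = s} \<inter> space \<sigma> = {z\<in>space \<sigma>. t z (E a) = s}" by auto
    then have "measure \<sigma> {z\<in>space \<sigma>. t z (E a) = s} = (\<integral>z. indicator {z\<in>space \<sigma>. t z (E a) = s} z \<partial>\<sigma>)"
      by simp
    also have "\<dots> \<le> (\<integral>z. poly (q ^ k) (t z (E a)) \<partial>\<sigma>)"
    proof (rule integral_mono)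
      show "integrable \<sigma> (indicat_real {z\<in>space \<sigma>. t z (E a) = s})"
        by (intro integrable_real_indicator) (auto simp: emeasure_eq_measure)
      show "integrable \<sigma> (\<lambda>z. poly (q ^ k) (t z (E a)))"
        by (intro bm_integrable bm_profile profile_poly E_space)
      show "indicat_real {z\<in>space \<sigma>. t z (E a) = s} z \<le> poly (q ^ k) (t z (E a))" if "z \<in> space \<sigma>" for z
        using q01(1)[OF t_range[OF that E_space]] by (auto simp: poly_power q split: split_indicator)
    qed
    finally show ?thesis .
  qed
  then have "measure \<sigma> {z\<in>space \<sigma>. t z (E a) = s} \<le> 0"
    by (intro LIMSEQ_le_const[OF lim]) auto
  then show ?thesis by (simp add: measure_le_0_iff)
qed

text \<open>The open caps with larger thresholds increase to the cap of \<open>s\<close>, so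
  continuity from below applies.\<close>

lemma cap_right_continuous:
  assumes "c < cap s" "s < 1"
  shows "\<exists>s'. s < s' \<and> s' < 1 \<and> c < cap s'"
proof -
  define A where "A k = {z\<in>space \<sigma>. s + (1 - s) / real (k + 2) < t z (E a)}" for k
  have "(\<lambda>k. measure \<sigma> (A k)) \<longlonglongrightarrow> measure \<sigma> (\<Union>k. A k)"
  proof (rule finite_Lim_measure_incseq)
    show "range A \<subseteq> sets \<sigma>" unfolding A_def by auto
    show "incseq A"
    proof (rule incseq_SucI, unfold A_def, clarify)
      fix k z assume "s + (1 - s) / real (k + 2) < t z (E a)"
      moreover have "(1 - s) / real (Suc k + 2) \<le> (1 - s) / real (k + 2)"
        using assms(2) by (intro divide_left_mono) auto
      ultimately show "s + (1 - s) / real (Suc k + 2) < t z (E a)" by linarith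
    qed
  qed
  moreover have "(\<Union>k. A k) = {z\<in>space \<sigma>. s < t z (E a)}"
  proof (intro equalityI subsetI)
    fix z assume z: "z \<in> {z\<in>space \<sigma>. s < t z (E a)}"
    have "(\<lambda>k. s + (1 - s) / real (k + 2)) \<longlonglongrightarrow> s" by real_asymp
    then have "eventually (\<lambda>k. s + (1 - s) / real (k + 2) < t z (E a)) sequentially"
      using z by (intro order_tendstoD) auto
    then obtain k where "s + (1 - s) / real (k + 2) < t z (E a)"
      by (auto simp: eventually_sequentially)
    then show "z \<in> (\<Union>k. A k)" using z by (auto simp: A_def)
  next
    fix z assume "z \<in> (\<Union>k. A k)"
    then obtain k where "z \<in> space \<sigma>" "s + (1 - s) / real (k + 2) < t z (E a)" by (auto simp: A_def)
    moreover have "(1 - s) / real (k + 2) \<ge> 0" using assms(2) by simp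
    ultimately show "z \<in> {z\<in>space \<sigma>. s < t z (E a)}" by auto
  qed
  ultimately have "(\<lambda>k. cap (s + (1 - s) / real (k + 2))) \<longlonglongrightarrow> cap s"
    unfolding A_def by (simp only: cap_measure[OF E_space])
  then have "eventually (\<lambda>k. c < cap (s + (1 - s) / real (k + 2))) sequentially"
    using assms(1) by (rule order_tendstoD)
  then obtain k where "c < cap (s + (1 - s) / real (k + 2))" by (auto simp: eventually_sequentially)
  moreover have "0 < (1 - s) / real (k + 2)" "(1 - s) / real (k + 2) < 1 - s"
    using divide_nat_less[of "1 - s" k] assms(2) by auto
  ultimately show ?thesis by (intro exI[of _ "s + (1 - s) / real (k + 2)"]) auto
qed

text \<open>The caps with smaller thresholds decrease to the closed cap, which exceeds the open one
  by a sphere; \<open>measure_sphere\<close> removes the difference.\<close>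

lemma cap_left_continuous:
  assumes "cap s < c" "0 < s" "s \<le> 1"
  shows "\<exists>s'. 0 < s' \<and> s' < s \<and> cap s' < c"
proof -
  define A where "A k = {z\<in>space \<sigma>. s - s / real (k + 2) < t z (E a)}" for k
  have "(\<lambda>k. measure \<sigma> (A k)) \<longlonglongrightarrow> measure \<sigma> (\<Inter>k. A k)"
  proof (rule finite_Lim_measure_decseq)
    show "range A \<subseteq> sets \<sigma>" unfolding A_def by auto
    show "decseq A"
    proof (rule decseq_SucI, unfold A_def, clarify)
      fix k z assume "s - s / real (Suc k + 2) < t z (E a)"
      moreover have "s / real (Suc k + 2) \<le> s / real (k + 2)"
        using assms(2) by (intro divide_left_mono) auto
      ultimately show "s - s / real (k + 2) < t z (E a)" by linarith
    qed
  qed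
  moreover have "measure \<sigma> (\<Inter>k. A k) = cap s"
  proof -
    have "(\<Inter>k. A k) = {z\<in>space \<sigma>. s < t z (E a)} \<union> {z\<in>space \<sigma>. t z (E a) = s}"
    proof (intro equalityI subsetI)
      fix z assume z: "z \<in> (\<Inter>k. A k)"
      have "(\<lambda>k. s - s / real (k + 2)) \<longlonglongrightarrow> s" by real_asymp
      then have "s \<le> t z (E a)"
        by (rule LIMSEQ_le_const2) (use z in \<open>auto simp: A_def less_imp_le\<close>)
      then show "z \<in> {z\<in>space \<sigma>. s < t z (E a)} \<union> {z\<in>space \<sigma>. t z (E a) = s}"
        using z by (auto simp: A_def)
    next
      fix z assume z: "z \<in> {z\<in>space \<sigma>. s < t z (E a)} \<union> {z\<in>space \<sigma>. t z (E a) = s}"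
      have "s - s / real (k + 2) < t z (E a)" for k
      proof -
        have "s / real (k + 2) > 0" using assms(2) by simp
        then show ?thesis using z by auto
      qed
      then show "z \<in> (\<Inter>k. A k)" using z by (auto simp: A_def)
    qed
    moreover have "measure \<sigma> ({z\<in>space \<sigma>. s < t z (E a)} \<union> {z\<in>space \<sigma>. t z (E a) = s})
       = measure \<sigma> {z\<in>space \<sigma>. s < t z (E a)} + measure \<sigma> {z\<in>space \<sigma>. t z (E a) = s}"
      by (rule finite_measure_Union) auto
    ultimately show ?thesis using measure_sphere[of s] assms cap_measure[OF E_space] by simp
  qed
  ultimately have "(\<lambda>k. cap (s - s / real (k + 2))) \<longlonglongrightarrow> cap s"
    unfolding A_def by (simp only: cap_measure[OF E_space])
  then have "eventually (\<lambda>k. cap (s - s / real (k + 2)) < c) sequentially"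
    using assms(1) by (rule order_tendstoD)
  then obtain k where "cap (s - s / real (k + 2)) < c" by (auto simp: eventually_sequentially)
  moreover have "0 < s / real (k + 2)" "s / real (k + 2) < s"
    using divide_nat_less[OF assms(2)] by auto
  ultimately show ?thesis by (intro exI[of _ "s - s / real (k + 2)"]) auto
qed

text \<open>Threshold 0 belongs to the radius \<open>pi / 2\<close>. As \<open>t\<close> is
  nonnegative, the cap misses only the points orthogonal to the centre, which form a null
  sphere.\<close>

lemma cap_0: "cap 0 = 1"
proof -
  have "{z\<in>space \<sigma>. 0 < t z (E a)} = space \<sigma> - {z\<in>space \<sigma>. t z (E a) = 0}"
    using inner_nonneg[OF _ E_space, of _ a] by (auto simp: less_le)
  then have "measure \<sigma> {z\<in>space \<sigma>. 0 < t z (E a)} = 1"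
    using measure_sphere[of 0] by (simp add: prob_compl)
  then show ?thesis by (simp add: cap_measure[OF E_space])
qed

text \<open>A Chebyshev bound restricted to the centres in one ball.\<close>

lemma variance_ge:
  assumes "X \<subseteq> space \<sigma>" "x \<in> space \<sigma>" "c \<ge> 0"
    and "\<And>x'. x' \<in> space \<sigma> \<Longrightarrow> dist (\<iota> x) (\<iota> x') < d \<Longrightarrow> c \<le> \<bar>discrepancy X s x'\<bar>"
  shows "c\<^sup>2 * measure \<sigma> {x'\<in>space \<sigma>. dist (\<iota> x) (\<iota> x') < d} \<le> cap_variance X s"
proof -
  let ?A = "{x'\<in>space \<sigma>. dist (\<iota> x) (\<iota> x') < d}"
  have "?A \<inter> space \<sigma> = ?A" by auto
  then have "c\<^sup>2 * measure \<sigma> ?A = (\<integral>z. c\<^sup>2 * indicator ?A z \<partial>\<sigma>)" by simp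
  also have "\<dots> \<le> cap_variance X s"
    unfolding cap_variance_def
  proof (rule integral_mono)
    show "integrable \<sigma> (\<lambda>z. c\<^sup>2 * indicat_real ?A z)"
      by (intro integrable_mult_right integrable_real_indicator) (auto simp: emeasure_eq_measure)
    show "integrable \<sigma> (\<lambda>z. (discrepancy X s z)\<^sup>2)"
      by (intro bm_integrable bm_power bm_discrepancy assms)
    fix z assume "z \<in> space \<sigma>"
    then show "c\<^sup>2 * indicat_real ?A z \<le> (discrepancy X s z)\<^sup>2"
      using assms(3) assms(4)[of z] by (auto split: split_indicator simp: abs_le_square_iff[symmetric])
  qed
  finally show ?thesis .
qed

text \<open>Were the discrepancy at least \<open>e * card (X N)\<close> on the whole ball around
  \<open>x\<close>, the variance divided by the squared cardinality would be at least
  \<open>e\<^sup>2 * m\<close>, whereas this quotient tends to 0. The good centre \<open>x'\<close>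
  may vary with \<open>N\<close>.\<close>

lemma eventually_small_discrepancy:
  assumes X: "\<And>N. finite (X N)" "\<And>N. X N \<subseteq> space \<sigma>"
    and card: "filterlim (\<lambda>N. card (X N)) at_top sequentially"
    and V: "(\<lambda>N. cap_variance (X N) s / real (card (X N))) \<longlonglongrightarrow> 0"
    and "x \<in> space \<sigma>" "d > 0" "e > 0"
  shows "eventually (\<lambda>N. \<exists>x'\<in>space \<sigma>. dist (\<iota> x) (\<iota> x') < d \<and>
    \<bar>discrepancy (X N) s x'\<bar> < e * real (card (X N)) \<and> card (X N) > 0) sequentially"
proof -
  define m where "m = measure \<sigma> {x'\<in>space \<sigma>. dist (\<iota> x) (\<iota> x') < d}"
  have m: "m > 0" unfolding m_def by (rule measure_ball_pos) fact+
  have "filterlim (\<lambda>N. real (card (X N))) at_top sequentially"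
    by (rule filterlim_compose[OF filterlim_real_sequentially card])
  then have "(\<lambda>N. inverse (real (card (X N)))) \<longlonglongrightarrow> 0"
    by (rule tendsto_inverse_0_at_top)
  from tendsto_mult[OF V this]
  have "(\<lambda>N. cap_variance (X N) s / (real (card (X N)))\<^sup>2) \<longlonglongrightarrow> 0"
    by (simp add: power2_eq_square divide_simps)
  then have "eventually (\<lambda>N. cap_variance (X N) s / (real (card (X N)))\<^sup>2 < e\<^sup>2 * m) sequentially"
    using m assms(7) by (intro order_tendstoD) auto
  moreover have "eventually (\<lambda>N. card (X N) > 0) sequentially"
    using filterlim_at_top[THEN iffD1, rule_format, OF card, of 1] by eventually_elim simp
  ultimately show ?thesis
  proof eventually_elim
    case (elim N)
    show ?case
    proof (rule ccontr)
      assume no: "\<not> ?thesis"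
      have "(e * real (card (X N)))\<^sup>2 * m \<le> cap_variance (X N) s"
        unfolding m_def using no elim assms(7)
        by (intro variance_ge X assms(5)) (auto simp: not_less)
      then show False using elim by (simp add: divide_less_eq power_mult_distrib mult_ac)
    qed
  qed
qed

text \<open>If \<open>x'\<close> is closer to \<open>x\<close> than the gap between two thresholds,
  the cap of the larger threshold about one centre lies in the cap of the smaller threshold about
  the other. Each bound compares with a centre \<open>x'\<close> of small discrepancy at a shifted
  threshold \<open>s'\<close>; the intermediate \<open>c'\<close> shares the error between the
  continuity of \<open>cap\<close> and the discrepancy.\<close>

theorem caps_uniformly_distributed:
  assumes X: "\<And>N. finite (X N)" "\<And>N. X N \<subseteq> space \<sigma>"
    and card: "filterlim (\<lambda>N. card (X N)) at_top sequentially"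
    and V: "\<And>s. 0 < s \<Longrightarrow> s < 1 \<Longrightarrow> (\<lambda>N. cap_variance (X N) s / real (card (X N))) \<longlonglongrightarrow> 0"
    and x: "x \<in> space \<sigma>" and s: "0 \<le> s" "s < 1"
  shows "(\<lambda>N. (\<Sum>y\<in>X N. indicator {s<..} (t x y)) / real (card (X N))) \<longlonglongrightarrow> cap s"
proof (rule order_tendstoI)
  fix c assume "c < cap s"
  then obtain c' where c': "c < c'" "c' < cap s" using dense by blast
  obtain s' where s': "s < s'" "s' < 1" "c' < cap s'"
    using cap_right_continuous[OF c'(2) s(2)] by blast
  have "eventually (\<lambda>N. \<exists>x'\<in>space \<sigma>. dist (\<iota> x) (\<iota> x') < s' - s \<and>
    \<bar>discrepancy (X N) s' x'\<bar> < (c' - c) * real (card (X N)) \<and> card (X N) > 0) sequentially"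
    using s s' c' by (intro eventually_small_discrepancy X card V x) auto
  then show "eventually (\<lambda>N. c < (\<Sum>y\<in>X N. indicator {s<..} (t x y)) / real (card (X N))) sequentially"
  proof eventually_elim
    case (elim N)
    then obtain x' where x': "x' \<in> space \<sigma>" "dist (\<iota> x) (\<iota> x') < s' - s"
      "\<bar>discrepancy (X N) s' x'\<bar> < (c' - c) * real (card (X N))" "card (X N) > 0" by blast
    have "c * real (card (X N)) < real (card (X N)) * cap s' - (c' - c) * real (card (X N))"
      using s'(3) x'(4) by (simp add: algebra_simps)
    also have "\<dots> \<le> (\<Sum>y\<in>X N. indicator {s'<..} (t x' y))"
      using x'(3) by (simp add: discrepancy_def)
    also have "\<dots> \<le> (\<Sum>y\<in>X N. indicator {s<..} (t x y))"
    proof (rule sum_mono)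
      fix y assume "y \<in> X N"
      then have "y \<in> space \<sigma>" using X(2) by blast
      then have "\<bar>t x y - t x' y\<bar> < s' - s" using t_diff_le[OF x x'(1)] x'(2) by fastforce
      then show "indicator {s'<..} (t x' y) \<le> (indicator {s<..} (t x y) :: real)"
        by (auto split: split_indicator)
    qed
    finally show ?case using x'(4) by (simp add: less_divide_eq)
  qed
next
  fix c assume c: "cap s < c"
  show "eventually (\<lambda>N. (\<Sum>y\<in>X N. indicator {s<..} (t x y)) / real (card (X N)) < c) sequentially"
  proof (cases "s = 0")
    \<comment> \<open>No smaller admissible threshold exists here; the proportion never exceeds 1,
      which is \<open>cap 0\<close>.\<close>
    case True
    have "(\<Sum>y\<in>X N. indicator {s<..} (t x y)) / real (card (X N)) \<le> 1" for N
      using sum_bounded_above[of "X N" "\<lambda>y. indicator {s<..} (t x y)" "1::real"]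
      by (auto simp: divide_le_eq_1 split: split_indicator)
    moreover have "1 < c" using c cap_0 True by simp
    ultimately show ?thesis by (intro always_eventually allI) (rule le_less_trans)
  next
    case False
    then have "0 < s" using s by simp
    obtain c' where c': "cap s < c'" "c' < c" using dense[OF c] by blast
    obtain s' where s': "0 < s'" "s' < s" "cap s' < c'"
      using cap_left_continuous[OF c'(1) \<open>0 < s\<close>] s by auto
    have "eventually (\<lambda>N. \<exists>x'\<in>space \<sigma>. dist (\<iota> x) (\<iota> x') < s - s' \<and>
      \<bar>discrepancy (X N) s' x'\<bar> < (c - c') * real (card (X N)) \<and> card (X N) > 0) sequentially"
      using s s' c' by (intro eventually_small_discrepancy X card V x) auto
    then show ?thesis
    proof eventually_elim
      case (elim N)
      then obtain x' where x': "x' \<in> space \<sigma>" "dist (\<iota> x) (\<iota> x') < s - s'"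
        "\<bar>discrepancy (X N) s' x'\<bar> < (c - c') * real (card (X N))" "card (X N) > 0" by blast
      have "(\<Sum>y\<in>X N. indicator {s<..} (t x y)) \<le> (\<Sum>y\<in>X N. indicator {s'<..} (t x' y) :: real)"
      proof (rule sum_mono)
        fix y assume "y \<in> X N"
        then have "y \<in> space \<sigma>" using X(2) by blast
        then have "\<bar>t x y - t x' y\<bar> < s - s'" using t_diff_le[OF x x'(1)] x'(2) by fastforce
        then show "indicator {s<..} (t x y) \<le> (indicator {s'<..} (t x' y) :: real)"
          by (auto split: split_indicator)
      qed
      also have "\<dots> \<le> real (card (X N)) * cap s' + (c - c') * real (card (X N))"
        using x'(3) by (simp add: discrepancy_def)
      also have "\<dots> < c * real (card (X N))"
        using s'(3) x'(4) by (simp add: algebra_simps)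
      finally show ?case using x'(4) by (simp add: divide_less_eq)
    qed
  qed
qed

end

section \<open>Models of projective spaces\<close>

text \<open>What has to be checked for each of the four spaces, before any measure is given. The
  condition on \<open>card K\<close> identifies the parameters of the frame with those of
  \<open>F\<close>.\<close>

locale projective_model = orthogonal_frame "proj_space F" \<iota> E a b u \<rho> \<phi> K
  for F :: scalars and \<iota> :: "'d::finite point \<Rightarrow> 'e::euclidean_space" and E :: "'d \<Rightarrow> 'd point"
    and a b u \<rho> and \<phi> :: "'k \<Rightarrow> 'd point \<Rightarrow> 'd point" and K +
  assumes proj_dist_eq: "x \<in> proj_space F \<Longrightarrow> y \<in> proj_space F \<Longrightarrow> proj_dist x y = arccos (sqrt (\<iota> x \<bullet> \<iota> y))"
    and norm_embed: "x \<in> proj_space F \<Longrightarrow> norm (\<iota> x) = 1"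
    and inner_nonneg: "x \<in> proj_space F \<Longrightarrow> y \<in> proj_space F \<Longrightarrow> 0 \<le> \<iota> x \<bullet> \<iota> y"
    and two_point: "x \<in> proj_space F \<Longrightarrow> y \<in> proj_space F \<Longrightarrow> x' \<in> proj_space F \<Longrightarrow> y' \<in> proj_space F \<Longrightarrow>
      \<iota> x \<bullet> \<iota> y = \<iota> x' \<bullet> \<iota> y' \<Longrightarrow> \<exists>T. inner_isometry (proj_space F) \<iota> T \<and> T x = x' \<and> T y = y'"
    and card_K: "card K = scalar_dim F"
begin

lemma t_range: 
  assumes "x \<in> proj_space F" "y \<in> proj_space F"
  shows "0 \<le> \<iota> x \<bullet> \<iota> y" "\<iota> x \<bullet> \<iota> y \<le> 1" "- 1 \<le> sqrt (\<iota> x \<bullet> \<iota> y)"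
  using norm_cauchy_schwarz[of "\<iota> x" "\<iota> y"] inner_nonneg[OF assms] assms
  by (auto simp: norm_embed intro: order.trans[of "- 1" 0])

lemma dist_embed:
  assumes "x \<in> proj_space F" "y \<in> proj_space F"
  shows "(dist (\<iota> x) (\<iota> y))\<^sup>2 = 2 - 2 * (\<iota> x \<bullet> \<iota> y)"
  using assms norm_embed[of x] norm_embed[of y]
  by (simp add: dist_norm power2_norm_eq_inner algebra_simps norm_eq_1 inner_commute)

lemma cos_proj_dist:
  assumes "x \<in> proj_space F" "y \<in> proj_space F"
  shows "cos (proj_dist x y) = sqrt (\<iota> x \<bullet> \<iota> y)"
  using t_range[OF assms] by (simp add: proj_dist_eq[OF assms] cos_arccos)

text \<open>The squared chordal distance is \<open>2 * (sin \<theta>)\<^sup>2\<close> for the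
  geodesic distance \<theta>, and the sine is at most its argument in modulus.\<close>

lemma dist_embed_le:
  assumes "x \<in> proj_space F" "y \<in> proj_space F"
  shows "(dist (\<iota> x) (\<iota> y))\<^sup>2 \<le> 2 * (proj_dist x y)\<^sup>2"
proof -
  have "(sin (proj_dist x y))\<^sup>2 = 1 - \<iota> x \<bullet> \<iota> y"
    using t_range[OF assms] by (simp add: sin_squared_eq cos_proj_dist[OF assms])
  moreover have "(sin (proj_dist x y))\<^sup>2 \<le> (proj_dist x y)\<^sup>2"
    using abs_sin_x_le_abs_x by (simp add: abs_le_square_iff[symmetric])
  ultimately show ?thesis by (simp add: dist_embed[OF assms])
qed

text \<open>For radii up to \<open>pi / 2\<close> the cosine of the radius is nonnegative, so
  cosines may be compared by their squares.\<close>

lemma proj_ball_iff: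
  assumes "x \<in> proj_space F" "0 \<le> r" "r \<le> pi / 2"
  shows "y \<in> proj_ball F x r \<longleftrightarrow> y \<in> proj_space F \<and> (cos r)\<^sup>2 < \<iota> x \<bullet> \<iota> y"
proof (cases "y \<in> proj_space F")
  case True
  note t = t_range[OF assms(1) True]
  have "proj_dist x y < r \<longleftrightarrow> cos r < cos (proj_dist x y)"
  proof -
    have "0 \<le> proj_dist x y" "proj_dist x y \<le> pi"
      using t arccos_bounded[of "sqrt (\<iota> x \<bullet> \<iota> y)"] by (auto simp: proj_dist_eq[OF assms(1) True])
    then show ?thesis using assms cos_mono_less_eq[of r "proj_dist x y"] by simp
  qed
  also have "\<dots> \<longleftrightarrow> (cos r)\<^sup>2 < \<iota> x \<bullet> \<iota> y"
  proof -
    have "0 \<le> cos r" using assms by (intro cos_ge_zero) auto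
    then show ?thesis
      unfolding cos_proj_dist[OF assms(1) True] using t
      by (metis real_less_rsqrt real_sqrt_less_iff real_sqrt_abs abs_of_nonneg)
  qed
  finally show ?thesis using True by (simp add: proj_ball_def)
qed (simp add: proj_ball_def)

text \<open>Chordal and geodesic metric have the same open sets, so the Borel sets of
  \<open>surface_measure\<close> are those of \<open>sets_eq\<close>.\<close>

lemma proj_open_iff:
  "proj_open F U \<longleftrightarrow> U \<subseteq> proj_space F \<and>
    (\<forall>x\<in>U. \<exists>e>0. \<forall>y\<in>proj_space F. dist (\<iota> x) (\<iota> y) < e \<longrightarrow> y \<in> U)"
proof -
  have "(\<exists>e>0. proj_ball F x e \<subseteq> U) \<longleftrightarrow> (\<exists>e>0. \<forall>y\<in>proj_space F. dist (\<iota> x) (\<iota> y) < e \<longrightarrow> y \<in> U)"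
    if x: "x \<in> proj_space F" for x
  proof
    assume "\<exists>e>0. proj_ball F x e \<subseteq> U"
    then obtain e where e: "e > 0" "proj_ball F x e \<subseteq> U" by blast
    \<comment> \<open>\<open>proj_ball_iff\<close> reaches only to \<open>pi / 2\<close>, hence the
      minimum.\<close>
    define r where "r = min e (pi / 2)"
    have r: "0 < r" "r \<le> pi / 2" "r \<le> e" using e(1) by (auto simp: r_def)
    have "(cos r)\<^sup>2 < 1"
      using r sin_gt_zero[of r] by (simp add: cos_squared_eq)
    then have "sqrt (2 - 2 * (cos r)\<^sup>2) > 0" by simp
    moreover have "y \<in> U" if y: "y \<in> proj_space F" "dist (\<iota> x) (\<iota> y) < sqrt (2 - 2 * (cos r)\<^sup>2)" for y
    proof -
      have "(dist (\<iota> x) (\<iota> y))\<^sup>2 < (sqrt (2 - 2 * (cos r)\<^sup>2))\<^sup>2"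
        using y(2) by (intro power_strict_mono) auto
      then have "(cos r)\<^sup>2 < \<iota> x \<bullet> \<iota> y"
        using \<open>(cos r)\<^sup>2 < 1\<close> by (simp add: dist_embed[OF x y(1)])
      then have "y \<in> proj_ball F x r" using proj_ball_iff[OF x] r y(1) by simp
      then show "y \<in> U" using e(2) r(3) by (auto simp: proj_ball_def)
    qed
    ultimately show "\<exists>e>0. \<forall>y\<in>proj_space F. dist (\<iota> x) (\<iota> y) < e \<longrightarrow> y \<in> U" by blast
  next
    assume "\<exists>e>0. \<forall>y\<in>proj_space F. dist (\<iota> x) (\<iota> y) < e \<longrightarrow> y \<in> U"
    then obtain e where e: "e > 0" "\<And>y. y \<in> proj_space F \<Longrightarrow> dist (\<iota> x) (\<iota> y) < e \<Longrightarrow> y \<in> U" by blast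
    \<comment> \<open>Half the radius absorbs the factor of \<open>dist_embed_le\<close>:
      \<open>2 * (e / 2)\<^sup>2\<close> is at most \<open>e\<^sup>2\<close>.\<close>
    have "y \<in> U" if y: "y \<in> proj_space F" "proj_dist x y < e / 2" for y
    proof -
      have "0 \<le> proj_dist x y"
        using t_range[OF x y(1)] arccos_lbound[of "sqrt (\<iota> x \<bullet> \<iota> y)"] by (simp add: proj_dist_eq[OF x y(1)])
      then have "(proj_dist x y)\<^sup>2 < (e / 2)\<^sup>2" using y(2) by (intro power_strict_mono) auto
      then have "(dist (\<iota> x) (\<iota> y))\<^sup>2 < 2 * (e / 2)\<^sup>2"
        using dist_embed_le[OF x y(1)] by linarith
      also have "\<dots> \<le> e\<^sup>2" by (simp add: power_divide)
      finally have "dist (\<iota> x) (\<iota> y) < e" using e(1) by (simp add: power_less_imp_less_base)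
      then show "y \<in> U" using e(2) y(1) by blast
    qed
    then have "proj_ball F x (e / 2) \<subseteq> U" by (auto simp: proj_ball_def)
    then show "\<exists>e>0. proj_ball F x e \<subseteq> U" using e(1) half_gt_zero by blast
  qed
  then show ?thesis unfolding proj_open_def by (meson subsetD)
qed

lemma framed_space:
  assumes "surface_measure F \<sigma>"
  shows "framed_space \<sigma> \<iota> E a b u \<rho> \<phi> K"
proof -
  have sp: "space \<sigma> = proj_space F" and "prob_space \<sigma>"
    and se: "sets \<sigma> = sigma_sets (proj_space F) {U. proj_open F U}"
    and inv: "\<And>T A. proj_isometry F T \<Longrightarrow> A \<in> sets \<sigma> \<Longrightarrow> emeasure \<sigma> (T ` A) = emeasure \<sigma> A"
    using assms by (auto simp: surface_measure_def)
  interpret prob_space \<sigma> by fact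
  have "two_point_homogeneous \<sigma> \<iota>"
  proof (unfold_locales, unfold sp)
    show "sets \<sigma> = sigma_sets (proj_space F)
      {U. U \<subseteq> proj_space F \<and> (\<forall>x\<in>U. \<exists>e>0. \<forall>y\<in>proj_space F. dist (\<iota> x) (\<iota> y) < e \<longrightarrow> y \<in> U)}"
      unfolding se proj_open_iff ..
    show "emeasure \<sigma> (T ` A) = emeasure \<sigma> A" if "inner_isometry (proj_space F) \<iota> T" "A \<in> sets \<sigma>" for T A
    proof (rule inv[OF _ that(2)])
      have "T x \<in> proj_space F" if "x \<in> proj_space F" for x
        using \<open>inner_isometry _ _ T\<close> that by (auto simp: inner_isometry_def bij_betw_def)
      then show "proj_isometry F T"
        using that(1) by (auto simp: proj_isometry_def inner_isometry_def proj_dist_eq)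
    qed
  qed (rule norm_embed inner_nonneg two_point; assumption)+
  moreover have "orthogonal_frame (space \<sigma>) \<iota> E a b u \<rho> \<phi> K"
    unfolding sp by (rule orthogonal_frame_axioms)
  ultimately show ?thesis by (rule framed_space.intro)
qed

theorem hyperuniform_imp_uniform:
  fixes \<sigma> :: "'d point measure"
  assumes \<sigma>: "surface_measure F \<sigma>"
    and X: "\<And>N. finite (X N)" "\<And>N. X N \<subseteq> proj_space F"
    and card: "filterlim (\<lambda>N. card (X N)) at_top sequentially"
    and hyper: "hyperuniform_large_balls F \<sigma> X"
  shows "uniformly_distributed F \<sigma> X"
    and "n \<ge> 1 \<Longrightarrow> (\<lambda>N. (\<Sum>x\<in>X N. \<Sum>y\<in>X N.
        jacobi_poly n (jacobi_alpha F CARD('d)) (jacobi_beta F) (cos (2 * proj_dist x y)))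
      / real (card (X N))) \<longlonglongrightarrow> 0"
proof -
  interpret fs: framed_space \<sigma> \<iota> E a b u \<rho> \<phi> K by (rule framed_space[OF \<sigma>])
  have sp: "space \<sigma> = proj_space F" using \<sigma> by (simp add: surface_measure_def)
  have ind: "indicator (proj_ball F x r) y = (indicator {(cos r)\<^sup>2<..} (\<iota> x \<bullet> \<iota> y) :: real)"
    if "x \<in> proj_space F" "y \<in> proj_space F" "0 \<le> r" "r \<le> pi / 2" for x y r
    using proj_ball_iff[OF that(1,3,4), of y] that(2) by (auto split: split_indicator)
  have meas: "measure \<sigma> (proj_ball F x r) = fs.cap ((cos r)\<^sup>2)"
    if "x \<in> proj_space F" "0 \<le> r" "r \<le> pi / 2" for x r
  proof -
    have "proj_ball F x r = {z \<in> space \<sigma>. (cos r)\<^sup>2 < \<iota> z \<bullet> \<iota> x}"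
      using proj_ball_iff[OF that] by (auto simp: sp inner_commute)
    then show ?thesis using fs.cap_measure[of x] that(1) by (simp add: sp)
  qed
  have var: "number_variance F \<sigma> (X N) r = fs.cap_variance (X N) ((cos r)\<^sup>2)"
    if "0 \<le> r" "r \<le> pi / 2" for N r
    unfolding number_variance_def fs.cap_variance_def fs.discrepancy_def
  proof (rule Bochner_Integration.integral_cong[OF refl])
    fix x assume "x \<in> space \<sigma>"
    then have x: "x \<in> proj_space F" by (simp add: sp)
    have "(\<Sum>y\<in>X N. indicator (proj_ball F x r) y) = (\<Sum>y\<in>X N. indicator {(cos r)\<^sup>2<..} (\<iota> x \<bullet> \<iota> y) :: real)"
      using X(2) by (intro sum.cong refl ind x that) auto
    then show "((\<Sum>y\<in>X N. indicator (proj_ball F x r) y) - real (card (X N)) * measure \<sigma> (proj_ball F x r))\<^sup>2 =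
        ((\<Sum>y\<in>X N. indicator {(cos r)\<^sup>2<..} (\<iota> x \<bullet> \<iota> y)) - real (card (X N)) * fs.cap ((cos r)\<^sup>2))\<^sup>2"
      by (simp add: meas[OF x that])
  qed
  have V: "(\<lambda>N. fs.cap_variance (X N) s / real (card (X N))) \<longlonglongrightarrow> 0" if s: "0 < s" "s < 1" for s
  proof -
    \<comment> \<open>This inverts \<open>s = (cos r)\<^sup>2\<close>; thresholds strictly between 0
      and 1 correspond to radii strictly between 0 and \<open>pi / 2\<close>.\<close>
    define r where "r = arccos (sqrt s)"
    have s': "0 < sqrt s" "sqrt s < 1" using s by auto
    then have "cos r = sqrt s" unfolding r_def by (intro cos_arccos) linarith+
    then have cr: "(cos r)\<^sup>2 = s" using s by simp
    have "arccos 1 < r" unfolding r_def using s' by (intro arccos_less_arccos) linarith+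
    then have "0 < r" by simp
    moreover have "r < arccos 0" unfolding r_def using s' by (intro arccos_less_arccos) linarith+
    then have "r < pi / 2" by simp
    ultimately have "(\<lambda>N. number_variance F \<sigma> (X N) r) \<in> o(\<lambda>N. real (card (X N)))" "0 \<le> r" "r \<le> pi / 2"
      using hyper by (auto simp: hyperuniform_large_balls_def)
    then show ?thesis using smalloD_tendsto by (fastforce simp: var cr)
  qed
  have X': "X N \<subseteq> space \<sigma>" for N using X(2) by (simp add: sp)
  show "uniformly_distributed F \<sigma> X"
    unfolding uniformly_distributed_def
  proof (intro ballI)
    fix x :: "'d point" and r :: real
    assume x: "x \<in> proj_space F" and "r \<in> {0..pi / 2}"
    then have r: "0 \<le> r" "r \<le> pi / 2" by auto
    have eq: "(\<Sum>y\<in>X N. indicator (proj_ball F x r) y) = (\<Sum>y\<in>X N. indicator {(cos r)\<^sup>2<..} (\<iota> x \<bullet> \<iota> y) :: real)" for N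
      using X(2) by (intro sum.cong refl ind x r) auto
    show "(\<lambda>N. (\<Sum>y\<in>X N. indicator (proj_ball F x r) y) / real (card (X N))) \<longlonglongrightarrow> measure \<sigma> (proj_ball F x r)"
    proof (cases "r = 0")
      \<comment> \<open>Radius 0 means threshold 1, which \<open>caps_uniformly_distributed\<close>
        excludes; the ball is empty.\<close>
      case True
      then have "proj_ball F x r = {}" using proj_ball_iff[OF x r] t_range[OF x] by fastforce
      then show ?thesis by simp
    next
      case False
      then have "(cos r)\<^sup>2 < 1" using r sin_gt_zero[of r] by (simp add: cos_squared_eq)
      then show ?thesis
        unfolding eq meas[OF x r] using x
        by (intro fs.caps_uniformly_distributed X(1) X' card V) (auto simp: sp)
    qed
  qed
  assume n: "n \<ge> 1"
  have "jacobi_poly n (jacobi_alpha F CARD('d)) (jacobi_beta F) (cos (2 * proj_dist x y)) = poly (fs.P n) (\<iota> x \<bullet> \<iota> y)"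
    if "x \<in> proj_space F" "y \<in> proj_space F" for x y
    using t_range[OF that]
    by (simp add: fs.P_def poly_shifted_jacobi fs.\<alpha>_def fs.\<beta>_def jacobi_alpha_def jacobi_beta_def card_K
        cos_double_cos cos_proj_dist[OF that])
  then have eq: "(\<Sum>x\<in>X N. \<Sum>y\<in>X N. jacobi_poly n (jacobi_alpha F CARD('d)) (jacobi_beta F) (cos (2 * proj_dist x y)))
      = fs.energy n (X N)" for N
    unfolding fs.energy_def using X(2) by (intro sum.cong refl) (simp add: subset_iff)
  show "(\<lambda>N. (\<Sum>x\<in>X N. \<Sum>y\<in>X N.
        jacobi_poly n (jacobi_alpha F CARD('d)) (jacobi_beta F) (cos (2 * proj_dist x y)))
      / real (card (X N))) \<longlonglongrightarrow> 0"
    unfolding eq by (intro fs.energy_tendsto X(1) X' V n)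
qed

end

section \<open>Spaces of lines\<close>

text \<open>Treats the real, complex and quaternionic scalars at once. Associativity comes with
  \<open>real_normed_div_algebra\<close>, which keeps the octonions out.\<close>

class star_euclidean = conj_div_algebra + euclidean_space +
  assumes conj_mult_self_scaleR: "conj a * a = (norm a)\<^sup>2 *\<^sub>R 1"

lemma conj_mult_self: "conj a * a = of_real ((norm (a :: 'a::star_euclidean))\<^sup>2)"
  unfolding of_real_def by (rule conj_mult_self_scaleR)

instance real :: star_euclidean
  by standard (simp add: conj_real_def power2_eq_square)

instance complex :: star_euclidean
proof
  fix a :: complex
  show "conj a * a = (norm a)\<^sup>2 *\<^sub>R 1"
    unfolding conj_complex_def of_real_def[symmetric] by (subst complex_norm_square) (simp add: mult.commute)
qed

section \<open>Quaternions as a Euclidean space, and the calculus of conjugation\<close>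

instantiation quat :: euclidean_space
begin

definition "inner p q = qfst p \<bullet> qfst q + qsnd p \<bullet> qsnd (q :: quat)"
definition "(Basis :: quat set) = (\<lambda>b. Quat b 0) ` Basis \<union> (\<lambda>b. Quat 0 b) ` Basis"

instance
proof
  fix x y z :: quat and r :: real
  show "x \<bullet> y = y \<bullet> x" "(x + y) \<bullet> z = x \<bullet> z + y \<bullet> z" "r *\<^sub>R x \<bullet> y = r * (x \<bullet> y)" "0 \<le> x \<bullet> x"
    by (simp_all add: inner_quat_def quat_defs inner_commute inner_add_left inner_add_right distrib_left)
  show "x \<bullet> x = 0 \<longleftrightarrow> x = 0"
    by (cases x) (simp add: inner_quat_def quat_defs add_nonneg_eq_0_iff)
  show "norm x = sqrt (x \<bullet> x)"
    by (simp add: norm_quat_def inner_quat_def norm_Pair power2_norm_eq_inner)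
  show "(Basis :: quat set) \<noteq> {}" "finite (Basis :: quat set)"
    by (auto simp: Basis_quat_def)
  show "x \<bullet> y = (if x = y then 1 else 0)" if "x \<in> Basis" "y \<in> Basis"
    using that by (auto simp: Basis_quat_def inner_quat_def inner_Basis split: if_splits)
  have "(\<forall>u\<in>Basis. x \<bullet> u = 0) \<longleftrightarrow> qfst x = 0 \<and> qsnd x = 0"
    using euclidean_all_zero_iff[of "qfst x"] euclidean_all_zero_iff[of "qsnd x"]
    by (simp add: Basis_quat_def inner_quat_def ball_Un)
  then show "(\<forall>u\<in>Basis. x \<bullet> u = 0) \<longleftrightarrow> x = 0"
    by (cases x) (simp add: quat_defs)
qed

end

lemma DIM_quat: "DIM(quat) = 4"
proof -
  have "card ((\<lambda>b. Quat b 0) ` Basis) = 2" "card ((\<lambda>b. Quat 0 b) ` Basis) = 2"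
    by (subst card_image; auto simp: inj_on_def)+
  moreover have "(\<lambda>b. Quat b 0) ` Basis \<inter> (\<lambda>b. Quat 0 b) ` Basis = {}"
    by auto
  ultimately show ?thesis
    unfolding Basis_quat_def by (subst card_Un_disjoint) auto
qed

instance quat :: star_euclidean
proof
  fix a :: quat
  have "cnj z * z = of_real ((cmod z)\<^sup>2)" for z
    by (subst complex_norm_square) (simp add: mult.commute)
  then show "conj a * a = (norm a)\<^sup>2 *\<^sub>R 1"
    by (simp add: one_quat_def scaleR_quat_def scaleR_conv_of_real conj_quat_def quat_conj_def times_quat_def norm_quat_def norm_Pair mult.commute)
qed

text \<open>Cancel \<open>r\<close> in \<open>conj r * r = r * r\<close>; the zero case is settled
  by the norm.\<close>

lemma conj_of_real: "conj (of_real r :: 'f::star_euclidean) = of_real r"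
proof (cases "r = 0")
  case True
  then show ?thesis using norm_conj[of "0::'f"] by simp
next
  case False
  have "conj (of_real r :: 'f) * of_real r = of_real r * of_real r"
    using conj_mult_self[of "of_real r :: 'f"] by (simp add: power2_eq_square)
  then show ?thesis using False by (simp del: of_real_mult)
qed

lemma conj_one: "conj (1 :: 'f::star_euclidean) = 1"
  using conj_of_real[of 1] by simp

lemma conj_zero: "conj (0 :: 'f::star_euclidean) = 0"
  using conj_of_real[of 0] by simp

lemma conj_minus: "conj (- a) = - conj (a :: 'f::star_euclidean)"
  using conj_add[of a "- a"] by (simp add: conj_zero eq_neg_iff_add_eq_0 add.commute)

lemma conj_diff: "conj (a - b) = conj a - conj (b :: 'f::star_euclidean)"
  using conj_add[of a "- b"] by (simp add: conj_minus)

lemma conj_sum: "conj (\<Sum>i\<in>I. f i) = (\<Sum>i\<in>I. conj (f i :: 'f::star_euclidean))"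
  by (induction I rule: infinite_finite_induct) (simp_all add: conj_zero conj_add)

lemma conj_polar: "conj a * b + conj b * a = of_real (2 * (a \<bullet> (b :: 'f::star_euclidean)))"
proof -
  have "conj (a + b) * (a + b) = of_real ((norm (a + b))\<^sup>2)" by (rule conj_mult_self)
  also have "(norm (a + b))\<^sup>2 = (norm a)\<^sup>2 + (norm b)\<^sup>2 + 2 * (a \<bullet> b)"
    by (simp add: power2_norm_eq_inner inner_add_left inner_add_right inner_commute)
  finally show ?thesis
    using conj_mult_self[of a] conj_mult_self[of b] by (simp add: conj_add algebra_simps)
qed

lemma inner_conj: "conj a \<bullet> conj b = a \<bullet> (b :: 'f::star_euclidean)"
proof -
  have n: "conj w \<bullet> conj w = w \<bullet> w" for w :: 'f
    by (simp add: norm_conj flip: power2_norm_eq_inner)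
  show ?thesis
    using n[of "a + b"] n[of a] n[of b]
    by (simp add: conj_add inner_add_left inner_add_right inner_commute)
qed

lemma inner_eq_re: "a \<bullet> b = 1 \<bullet> (conj a * (b :: 'f::star_euclidean))"
proof -
  have "(of_real (2 * (a \<bullet> b)) :: 'f) = of_real (2 * (1 \<bullet> (conj a * b)))"
    using conj_polar[of a b] conj_polar[of 1 "conj a * b"] by (simp add: conj_one conj_mult conj_conj)
  then show ?thesis by (simp only: of_real_eq_iff)
qed

text \<open>Polarisation of the multiplicativity of the norm.\<close>

lemma inner_mult_left_same: "(z * x) \<bullet> (z * y) = (norm z)\<^sup>2 * (x \<bullet> (y :: 'f::star_euclidean))"
proof -
  have n: "(z * w) \<bullet> (z * w) = (norm z)\<^sup>2 * (w \<bullet> w)" for w :: 'f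
    by (simp add: norm_mult power_mult_distrib flip: power2_norm_eq_inner)
  show ?thesis
    using n[of "x + y"] n[of x] n[of y]
    by (simp add: distrib_left inner_add_left inner_add_right inner_commute)
qed

lemma inner_mult_right_same: "(x * z) \<bullet> (y * z) = (norm z)\<^sup>2 * (x \<bullet> (y :: 'f::star_euclidean))"
proof -
  have "(x * z) \<bullet> (y * z) = (conj z * conj x) \<bullet> (conj z * conj y)"
    using inner_conj[of "x * z" "y * z"] by (simp add: conj_mult)
  then show ?thesis by (simp add: inner_mult_left_same norm_conj inner_conj)
qed

lemma mult_conj_self: "a * conj a = of_real ((norm (a :: 'f::star_euclidean))\<^sup>2)"
  using conj_mult_self[of "conj a"] by (simp add: conj_conj norm_conj)

text \<open>Multiplying both arguments by \<open>conj z\<close> on the right scales the inner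
  product by \<open>(norm z)\<^sup>2\<close>. The first argument becomes that real multiple of
  \<open>x\<close>, and the factor cancels.\<close>

lemma inner_mult_right: "(x * z) \<bullet> y = x \<bullet> (y * conj (z :: 'f::star_euclidean))"
proof (cases "z = 0")
  case True
  then show ?thesis by (simp add: conj_zero)
next
  case False
  have "(norm z)\<^sup>2 * ((x * z) \<bullet> y) = ((x * z) * conj z) \<bullet> (y * conj z)"
    by (simp add: inner_mult_right_same norm_conj)
  also have "(x * z) * conj z = (norm z)\<^sup>2 *\<^sub>R x"
    by (simp add: mult.assoc mult_conj_self of_real_def)
  finally show ?thesis using False by simp
qed

lemma inner_mult_left: "(z * x) \<bullet> y = x \<bullet> (conj z * (y :: 'f::star_euclidean))"
  using inner_mult_right[of "conj x" "conj z" "conj y"] inner_conj[of "z * x" y] inner_conj[of x "conj z * y"]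
  by (simp add: conj_mult conj_conj)

section \<open>Lines, the Hermitian form and unitary maps\<close>

definition vmul :: "'f::conj_div_algebra ^ 'd \<Rightarrow> 'f \<Rightarrow> 'f ^ 'd" where
  "vmul v c = (\<chi> i. v $ i * c)"

lemma norm_vmul: "norm (vmul v c) = norm v * norm c"
  by (simp add: vmul_def norm_vec_mult_right)

lemma vmul_vmul: "vmul (vmul v c) e = vmul v (c * e)"
  by (simp add: vmul_def vec_eq_iff mult.assoc)

lemma vmul_1 [simp]: "vmul v 1 = v"
  by (simp add: vmul_def vec_eq_iff)

lemma line_eq: "line v = range (vmul v)"
  by (auto simp: line_def vmul_def)

lemma line_vmul:
  assumes "c \<noteq> 0" shows "line (vmul v c) = line v"
proof (intro equalityI subsetI)
  fix w assume "w \<in> line v"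
  then obtain e where "w = vmul v e" by (auto simp: line_eq)
  then have "w = vmul (vmul v c) (inverse c * e)" using assms by (simp add: vmul_vmul flip: mult.assoc)
  then show "w \<in> line (vmul v c)" by (auto simp: line_eq)
qed (auto simp: line_eq vmul_vmul)

lemma lines_unit:
  assumes "L \<in> lines"
  obtains v where "norm v = 1" "L = line v"
proof -
  obtain v where v: "v \<noteq> 0" "L = line v" using assms by (auto simp: lines_def)
  let ?c = "of_real (1 / norm v)"
  have "norm (vmul v ?c) = 1" using v(1) by (simp add: norm_vmul del: of_real_divide)
  moreover have "?c \<noteq> 0" using v(1) by simp
  then have "line (vmul v ?c) = L" unfolding v(2) by (rule line_vmul)
  ultimately show ?thesis using that by blast
qed

lemma line_in_lines: "norm v = 1 \<Longrightarrow> line v \<in> lines"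
  by (force simp: lines_def)

abbreviation herm :: "'f::star_euclidean ^ 'd \<Rightarrow> 'f ^ 'd \<Rightarrow> 'f" where
  "herm \<equiv> hermitian_form"

lemma herm_add: "herm (u + u') v = herm u v + herm u' v" "herm u (v + v') = herm u v + herm u v'"
  by (simp_all add: hermitian_form_def conj_add distrib_left distrib_right sum.distrib)

lemma herm_diff: "herm (u - u') v = herm u v - herm u' v" "herm u (v - v') = herm u v - herm u v'"
  by (simp_all add: hermitian_form_def conj_diff left_diff_distrib right_diff_distrib sum_subtractf)

lemma herm_vmul: "herm (vmul u c) v = conj c * herm u v" "herm u (vmul v c) = herm u v * c"
  by (simp_all add: hermitian_form_def vmul_def conj_mult sum_distrib_left sum_distrib_right mult.assoc)

lemma conj_herm: "conj (herm u v) = herm v u"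
  by (simp add: hermitian_form_def conj_sum conj_mult conj_conj)

lemma herm_self: "herm v v = of_real ((norm v)\<^sup>2)"
  by (simp add: hermitian_form_def conj_mult_self norm_vec_def L2_set_def sum_nonneg)

definition unitary :: "('f::star_euclidean ^ 'd \<Rightarrow> 'f ^ 'd) \<Rightarrow> bool" where
  "unitary A \<longleftrightarrow> (\<forall>u v. A (u + v) = A u + A v) \<and> (\<forall>v c. A (vmul v c) = vmul (A v) c) \<and>
    (\<forall>u v. herm (A u) (A v) = herm u v)"

lemma unitary_norm:
  assumes "unitary A" shows "norm (A v) = norm v"
proof -
  have "herm (A v) (A v) = herm v v" using assms by (simp add: unitary_def)
  then have "(norm (A v))\<^sup>2 = (norm v)\<^sup>2" unfolding herm_self by (simp only: of_real_eq_iff)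
  then show ?thesis by simp
qed

text \<open>Norm preservation gives injectivity, and an injective real-linear endomorphism of a
  finite-dimensional space is onto.\<close>

lemma unitary_bij:
  fixes A :: "'f::star_euclidean ^ 'd \<Rightarrow> 'f ^ 'd"
  assumes "unitary A" shows "bij A"
proof -
  have "linear A"
  proof
    show "A (u + v) = A u + A v" for u v using assms by (simp add: unitary_def)
    have "r *\<^sub>R v = vmul v (of_real r)" for r and v :: "'f ^ 'd"
      by (simp add: vmul_def vec_eq_iff of_real_def)
    then show "A (r *\<^sub>R v) = r *\<^sub>R A v" for r v using assms by (simp add: unitary_def)
  qed
  moreover have "inj A"
  proof -
    have "v = 0" if "A v = 0" for v
      using unitary_norm[OF assms, of v] that by simp
    then show ?thesis using linear_injective_0[OF \<open>linear A\<close>] by blast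
  qed
  ultimately show ?thesis using linear_injective_imp_surjective by (auto simp: bij_def)
qed

lemma unitary_comp: "unitary A \<Longrightarrow> unitary B \<Longrightarrow> unitary (\<lambda>v. A (B v))"
  by (simp add: unitary_def)

lemma unitary_line: "unitary A \<Longrightarrow> A ` line v = line (A v)"
  by (auto simp: line_eq unitary_def image_image)

text \<open>
  A Householder reflection in \<open>p - q\<close>, with the factor \<open>2 / (norm (p - q))\<^sup>2\<close> replaced by a
  scalar that need not be real, sends \<open>p\<close> to \<open>q\<close> even if \<open>herm p q\<close> is not real.
\<close>

lemma householder:
  fixes p q :: "'f::star_euclidean ^ 'd"
  assumes "norm p = norm q"
  shows "\<exists>A. unitary A \<and> A p = q \<and> (\<forall>v. herm (p - q) v = 0 \<longrightarrow> A v = v)"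
proof (cases "p = q")
  case True
  have "unitary (\<lambda>v :: 'f ^ 'd. v)" by (simp add: unitary_def)
  then show ?thesis using True by blast
next
  case False
  define w where "w = p - q"
  define k where "k = herm w p"
  \<comment> \<open>\<open>A p = p - w = q\<close> asks for \<open>m * k = 1\<close>. Invariance of
    the form asks for \<open>conj m * herm w w * m = conj m + m\<close>, which is
    \<open>ksum\<close> below with \<open>conj m\<close> and \<open>m\<close> on either
    side.\<close>
  define m where "m = inverse k"
  define A where "A v = v - vmul w (m * herm w v)" for v
  have ksum: "k + conj k = herm w w"
  proof -
    have "herm p p = herm q q" by (simp only: herm_self assms)
    then show ?thesis by (simp add: k_def w_def conj_herm herm_diff conj_diff)
  qed
  have "k \<noteq> 0"
  proof
    assume "k = 0"
    then have "herm w w = 0" using ksum by (simp add: conj_zero)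
    then show False using False by (simp add: herm_self w_def)
  qed
  then have km: "k * m = 1" "m * k = 1" by (auto simp: m_def)
  then have ckm: "conj m * conj k = 1" by (metis conj_mult conj_one)
  have "conj m * herm w w * m = conj m * (k * m) + (conj m * conj k) * m"
    unfolding ksum[symmetric] by (simp add: algebra_simps)
  then have msum: "conj m * herm w w * m = conj m + m" by (simp add: km ckm)
  have "herm (A u) (A v) = herm u v" for u v
  proof -
    have "herm (A u) (A v) = herm u v - herm u w * m * herm w v - herm u w * conj m * herm w v
        + herm u w * (conj m * herm w w * m) * herm w v"
      by (simp add: A_def herm_diff herm_vmul conj_mult conj_herm algebra_simps)
    then show ?thesis unfolding msum by (simp add: algebra_simps)
  qed
  moreover have "A (u + v) = A u + A v" for u v
    by (simp add: A_def herm_add vmul_def vec_eq_iff algebra_simps)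
  moreover have "A (vmul v c) = vmul (A v) c" for v c
    by (simp only: A_def herm_vmul) (simp add: vmul_def vec_eq_iff algebra_simps)
  ultimately have "unitary A" by (simp add: unitary_def)
  moreover have "A p = q"
    by (simp add: A_def km(2) flip: k_def) (simp add: w_def)
  moreover have "A v = v" if "herm (p - q) v = 0" for v
    using that by (simp add: A_def w_def[symmetric] vmul_def vec_eq_iff)
  ultimately show ?thesis by blast
qed

text \<open>Once \<open>p\<close> is at \<open>p'\<close>, a second reflection sends the image of
  \<open>q\<close> to a multiple \<open>vmul q' c\<close>. The unit scalar \<open>c\<close> gives
  both the same product with \<open>p'\<close>, so their difference is orthogonal to
  \<open>p'\<close> and the reflection leaves \<open>p'\<close> fixed.\<close>

lemma unitary_pair:
  fixes p q p' q' :: "'f::star_euclidean ^ 'd"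
  assumes "norm p = 1" "norm q = 1" "norm p' = 1" "norm q' = 1"
    and "norm (herm p q) = norm (herm p' q')"
  shows "\<exists>A. unitary A \<and> A p = p' \<and> line (A q) = line q'"
proof -
  obtain c where c: "norm c = 1" "herm p' q' * c = herm p q"
  proof (cases "herm p' q' = 0")
    case True
    then show ?thesis using that[of 1] assms(5) by simp
  next
    case False
    then show ?thesis
      using that[of "inverse (herm p' q') * herm p q"] assms(5)
      by (simp add: norm_mult norm_inverse flip: mult.assoc)
  qed
  obtain A where A: "unitary A" "A p = p'" using householder[of p p'] assms by auto
  have "norm (A q) = norm (vmul q' c)"
    using assms c(1) by (simp add: unitary_norm[OF A(1)] norm_vmul)
  from householder[OF this] obtain B where B: "unitary B" "B (A q) = vmul q' c"
    "\<And>v. herm (A q - vmul q' c) v = 0 \<Longrightarrow> B v = v" by blast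
  have "herm p' (A q) = herm p q" using A by (metis unitary_def)
  then have "herm p' (A q - vmul q' c) = 0"
    by (simp add: herm_diff herm_vmul c(2))
  then have "herm (A q - vmul q' c) p' = 0" by (metis conj_herm conj_zero)
  then have "B p' = p'" by (rule B(3))
  moreover have "line (vmul q' c) = line q'" using c(1) by (intro line_vmul) auto
  ultimately show ?thesis
    using A B(2) unitary_comp[OF B(1) A(1)] by (intro exI[of _ "\<lambda>v. B (A v)"]) simp
qed

section \<open>Embedding of lines by projection matrices\<close>

definition projection_matrix :: "'f::star_euclidean ^ 'd \<Rightarrow> 'f ^ 'd ^ 'd" where
  "projection_matrix v = (\<chi> i j. v $ i * conj (v $ j))"

text \<open>The squared norm is \<open>conj (herm u v) * herm u v\<close>, a double sum. Taking its
  real part as an inner product with 1 allows factors to be moved to the other side although scalars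
  need not commute.\<close>

lemma inner_projection_matrix:
  "projection_matrix u \<bullet> projection_matrix v = (norm (herm u v))\<^sup>2"
proof -
  have "of_real ((norm (herm u v))\<^sup>2) = conj (herm u v) * herm u v" by (rule conj_mult_self[symmetric])
  also have "\<dots> = (\<Sum>i\<in>UNIV. \<Sum>j\<in>UNIV. conj (v $ i) * (u $ i * conj (u $ j) * v $ j))"
    unfolding conj_herm unfolding hermitian_form_def sum_product by (simp only: mult.assoc)
  finally have "1 \<bullet> (of_real ((norm (herm u v))\<^sup>2) :: 'a) = (\<Sum>i\<in>UNIV. \<Sum>j\<in>UNIV. 1 \<bullet> (conj (v $ i) * (u $ i * conj (u $ j) * v $ j)))"
    by (simp only: inner_sum_right)
  also have "\<dots> = (\<Sum>i\<in>UNIV. \<Sum>j\<in>UNIV. (u $ i * conj (u $ j)) \<bullet> (v $ i * conj (v $ j)))"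
    by (simp add: inner_eq_re[symmetric] inner_mult_right[symmetric] inner_commute)
  also have "1 \<bullet> (of_real ((norm (herm u v))\<^sup>2) :: 'a) = (norm (herm u v))\<^sup>2"
  proof -
    have "1 \<bullet> (1 :: 'a) = 1" using norm_one norm_eq_1 by blast
    then show ?thesis by (simp add: of_real_def)
  qed
  finally show ?thesis by (simp add: projection_matrix_def inner_vec_def)
qed

definition line_embed :: "('f::star_euclidean ^ 'd) set \<Rightarrow> 'f ^ 'd ^ 'd" where
  "line_embed L = projection_matrix (SOME v. v \<in> L \<and> norm v = 1)"

text \<open>Another unit vector of the line is \<open>vmul v c\<close> with
  \<open>norm c = 1\<close>, and \<open>c * conj c = 1\<close> cancels in the middle of each
  entry.\<close>

lemma line_embed:
  assumes "norm v = 1" shows "line_embed (line v) = projection_matrix v"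
proof -
  have "v \<in> line v \<and> norm v = 1" using assms by (auto simp: line_eq intro: range_eqI[of _ _ 1])
  then have "(SOME w. w \<in> line v \<and> norm w = 1) \<in> line v \<and> norm (SOME w. w \<in> line v \<and> norm w = 1) = 1"
    by (rule someI)
  then obtain c where c: "(SOME w. w \<in> line v \<and> norm w = 1) = vmul v c" "norm (vmul v c) = 1"
    by (auto simp: line_eq)
  then have "norm c = 1" using assms by (simp add: norm_vmul)
  then have "x * c * conj (y * c) = x * conj y" for x y
    using mult_conj_self[of c] by (simp add: conj_mult mult.assoc flip: mult.assoc[of c])
  then show ?thesis
    unfolding line_embed_def c(1) by (simp add: projection_matrix_def vmul_def)
qed

text \<open>Left multiplication of a coordinate commutes with the right action of the scalars, hence
  respects lines over the quaternions as well. It supplies the maps \<open>\<phi>\<close> of the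
  frame and, for \<open>e = -1\<close>, the reflection.\<close>

definition scale_coordinate :: "'d \<Rightarrow> 'f::star_euclidean \<Rightarrow> 'f ^ 'd \<Rightarrow> 'f ^ 'd" where
  "scale_coordinate b e v = (\<chi> i. if i = b then e * v $ i else v $ i)"

lemma unitary_scale_coordinate:
  assumes "norm e = 1" shows "unitary (scale_coordinate b e)"
proof -
  have "conj (e * x) * (e * y) = conj x * y" for x y
    using conj_mult_self[of e] assms by (simp add: conj_mult mult.assoc flip: mult.assoc[of "conj e"])
  then have "herm (scale_coordinate b e u) (scale_coordinate b e v) = herm u v" for u v :: "'a ^ 'b"
    unfolding hermitian_form_def by (intro sum.cong) (auto simp: scale_coordinate_def)
  then show ?thesis
    by (auto simp: unitary_def scale_coordinate_def vmul_def vec_eq_iff algebra_simps)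
qed


lemma sum_Basis_inner_square: "(\<Sum>e\<in>Basis. (x \<bullet> e)\<^sup>2) = x \<bullet> x"
  unfolding power2_eq_square by (rule euclidean_inner[symmetric])

lemma herm_axis: "herm v (axis i c) = conj (v $ i) * c"
  by (simp add: hermitian_form_def axis_def if_distrib[of "\<lambda>x. _ * x"] cong: if_cong)

lemma norm_sum_axis:
  assumes "a \<noteq> b"
  shows "norm (axis a (of_real c) + axis b (of_real s) :: 'f::star_euclidean ^ 'd) = sqrt (c\<^sup>2 + s\<^sup>2)"
proof -
  let ?v = "axis a (of_real c) + axis b (of_real s) :: 'f ^ 'd"
  have "(of_real ((norm ?v)\<^sup>2) :: 'f) = herm ?v ?v" by (rule herm_self[symmetric])
  also have "\<dots> = of_real (c\<^sup>2 + s\<^sup>2)"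
    using assms by (simp add: herm_add herm_axis conj_add conj_of_real conj_zero) (simp add: axis_def conj_of_real conj_zero power2_eq_square)
  finally have "(norm ?v)\<^sup>2 = c\<^sup>2 + s\<^sup>2" by (simp only: of_real_eq_iff)
  then show ?thesis by (metis norm_ge_zero real_sqrt_abs abs_of_nonneg)
qed

text \<open>Here \<open>\<rho>\<close> is \<open>v $ a \<bullet> v $ b\<close>, the real part of the
  entry \<open>v $ a * conj (v $ b)\<close>. Scaling coordinate \<open>b\<close> by a basis element
  \<open>e\<close> turns it into the \<open>e\<close>-coordinate of that entry, so by Parseval the
  squares sum to the squared norm of the entry.\<close>

lemma projective_model_lines:
  fixes con :: "('f::star_euclidean ^ 'd) set \<Rightarrow> 'd::finite point"
  assumes con: "inj con" "proj_space F = con ` lines"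
    and dist: "\<And>L M. proj_dist (con L) (con M) = line_angle L M"
    and dim: "scalar_dim F = DIM('f)"
    and ab: "a \<noteq> b"
  shows "projective_model F (\<lambda>p. line_embed (inv con p)) (\<lambda>i. con (line (axis i 1))) a b
    (\<lambda>c s. con (line (axis a (of_real c) + axis b (of_real s))))
    (\<lambda>p. 1 \<bullet> (line_embed (inv con p) $ a $ b)) (\<lambda>e p. con (scale_coordinate b e ` inv con p)) (Basis :: 'f set)"
proof -
  define \<iota> where "\<iota> p = line_embed (inv con p)" for p
  define \<rho> where "\<rho> p = (1 :: 'f) \<bullet> (line_embed (inv con p) $ a $ b)" for p
  define pt where "pt v = con (line v)" for v
  have inv_pt: "inv con (pt v) = line v" for v by (simp add: pt_def con(1))
  have pt_space: "pt v \<in> proj_space F" if "norm v = 1" for v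
    using line_in_lines[OF that] by (simp add: con(2) pt_def)
  have space_pt: "\<exists>v. norm v = 1 \<and> p = pt v" if "p \<in> proj_space F" for p
    using that lines_unit unfolding con(2) pt_def by (metis imageE)
  have inner_pt: "\<iota> (pt u) \<bullet> \<iota> (pt v) = (norm (herm u v))\<^sup>2" if "norm u = 1" "norm v = 1" for u v
    using that by (simp add: \<iota>_def inv_pt line_embed inner_projection_matrix)
  have rho_pt: "\<rho> (pt v) = v $ a \<bullet> v $ b" if "norm v = 1" for v
  proof -
    have "1 \<bullet> (v $ a * conj (v $ b)) = v $ a \<bullet> v $ b"
      using inner_mult_right[of 1 "v $ b" "v $ a"] by (simp add: inner_commute)
    then show ?thesis using that by (simp add: \<rho>_def inv_pt line_embed projection_matrix_def)
  qed
  define T where "T A p = con (A ` inv con p)" for A p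
  have T_pt: "T A (pt v) = pt (A v)" if "unitary A" for A v
    using that by (simp add: T_def pt_def con(1) unitary_line)
  have T_isom: "inner_isometry (proj_space F) \<iota> (T A)" if A: "unitary A" for A
    unfolding inner_isometry_def
  proof (intro conjI ballI)
    show "bij_betw (T A) (proj_space F) (proj_space F)"
      unfolding bij_betw_def
    proof (intro conjI equalityI subsetI)
      show "inj_on (T A) (proj_space F)"
      proof (rule inj_onI)
        fix p q assume "p \<in> proj_space F" "q \<in> proj_space F" and eq: "T A p = T A q"
        then obtain L M where "p = con L" "q = con M" by (auto simp: con(2))
        then have "A ` L = A ` M" using eq con(1) by (simp add: T_def inj_eq)
        then have "L = M" using unitary_bij[OF A] by (metis bij_def inj_image_eq_iff)
        then show "p = q" by (simp add: \<open>p = con L\<close> \<open>q = con M\<close>)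
      qed
      show "q \<in> proj_space F" if q: "q \<in> T A ` proj_space F" for q
      proof -
        obtain p where p: "p \<in> proj_space F" "q = T A p" using q by blast
        obtain v where "norm v = 1" "p = pt v" using space_pt[OF p(1)] by blast
        then show ?thesis using p(2) pt_space[of "A v"] by (simp add: T_pt[OF A] unitary_norm[OF A])
      qed
      show "q \<in> T A ` proj_space F" if q: "q \<in> proj_space F" for q
      proof -
        obtain v where v: "norm v = 1" "q = pt v" using space_pt[OF q] by blast
        obtain w where w: "v = A w" using unitary_bij[OF A] by (metis bij_def surjD)
        then have "norm w = 1" using v(1) unitary_norm[OF A, of w] by simp
        then show ?thesis using pt_space[of w] T_pt[OF A, of w] v(2) w by (metis imageI)
      qed
    qed
    fix p q :: "'d point" assume p: "p \<in> proj_space F" and q: "q \<in> proj_space F"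
    obtain u v where uv: "norm u = 1" "p = pt u" "norm v = 1" "q = pt v" using space_pt p q by metis
    then show "\<iota> (T A p) \<bullet> \<iota> (T A q) = \<iota> p \<bullet> \<iota> q"
      using A by (simp add: T_pt[OF A] inner_pt unitary_norm[OF A]) (simp add: unitary_def)
  qed
  have axis1: "norm (axis i 1 :: 'f ^ 'd) = 1" for i
    by (simp add: norm_vec_def L2_set_def axis_def if_distrib[of norm] if_distrib[of "\<lambda>x. x\<^sup>2"] cong: if_cong)
  have nsum: "norm (axis a (of_real c) + axis b (of_real s) :: 'f ^ 'd) = 1" if "c\<^sup>2 + s\<^sup>2 = 1" for c s
    using norm_sum_axis[OF ab, of c s] that by simp
  have inner_axis: "\<iota> (pt v) \<bullet> \<iota> (pt (axis i 1)) = (norm (v $ i))\<^sup>2" if "norm v = 1" for v i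
    using that by (simp add: inner_pt axis1 herm_axis norm_conj)
  have scale_fix: "T (scale_coordinate b e) (pt (axis i 1)) = pt (axis i 1)" if e: "norm e = 1" for e i
  proof -
    have "scale_coordinate b e (axis i 1) = vmul (axis i 1) (if i = b then e else 1)"
      by (auto simp: scale_coordinate_def vmul_def vec_eq_iff axis_def)
    then have "pt (scale_coordinate b e (axis i 1)) = pt (axis i 1)"
      using e line_vmul[of e "axis b 1"] norm_zero by (cases "i = b") (force simp: pt_def)+
    then show ?thesis by (simp add: T_pt unitary_scale_coordinate e)
  qed
  have rho_scale: "\<rho> (T (scale_coordinate b e) (pt v)) = v $ a \<bullet> (e * v $ b)" if "norm e = 1" "norm v = 1" for e v
    using that ab unitary_norm[OF unitary_scale_coordinate[OF that(1)], of b v]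
    by (simp add: T_pt unitary_scale_coordinate rho_pt) (simp add: scale_coordinate_def)
  have "projective_model F \<iota> (\<lambda>i. pt (axis i 1)) a b (\<lambda>c s. pt (axis a (of_real c) + axis b (of_real s))) \<rho>
      (\<lambda>e. T (scale_coordinate b e)) (Basis :: 'f set)"
  proof unfold_locales
    fix p q p' q' :: "'d point"
    assume pq: "p \<in> proj_space F" "q \<in> proj_space F"
    obtain u v where uv: "norm u = 1" "p = pt u" "norm v = 1" "q = pt v" using space_pt pq by metis
    show "proj_dist p q = arccos (sqrt (\<iota> p \<bullet> \<iota> q))"
      using uv by (simp add: inner_pt) (simp add: pt_def dist line_angle_line)
    have "\<iota> p \<bullet> \<iota> p = 1" using inner_pt[OF uv(1,1)] uv(1,2) by (simp add: herm_self)
    then show "norm (\<iota> p) = 1" by (simp add: norm_eq_1)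
    show "0 \<le> \<iota> p \<bullet> \<iota> q" using uv by (simp add: inner_pt)
    assume pq': "p' \<in> proj_space F" "q' \<in> proj_space F" and eq: "\<iota> p \<bullet> \<iota> q = \<iota> p' \<bullet> \<iota> q'"
    obtain u' v' where uv': "norm u' = 1" "p' = pt u'" "norm v' = 1" "q' = pt v'" using space_pt pq' by metis
    have "(norm (herm u v))\<^sup>2 = (norm (herm u' v'))\<^sup>2" using eq uv uv' by (simp add: inner_pt)
    then have "norm (herm u v) = norm (herm u' v')" by simp
    from unitary_pair[OF uv(1,3) uv'(1,3) this] obtain A
      where A: "unitary A" "A u = u'" "line (A v) = line v'" by blast
    then have "T A p = p'" "T A q = q'" using uv uv' by (simp_all add: T_pt) (simp add: pt_def)
    then show "\<exists>T. inner_isometry (proj_space F) \<iota> T \<and> T p = p' \<and> T q = q'"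
      using T_isom[OF A(1)] by blast
  next
    fix i j :: 'd
    show "pt (axis i 1) \<in> proj_space F" by (rule pt_space[OF axis1])
    show "\<iota> (pt (axis i 1)) \<bullet> \<iota> (pt (axis j 1)) = 0" if "i \<noteq> j"
      unfolding inner_axis[OF axis1] using that by (simp add: axis_def)
  next
    fix z :: "'d point" assume "z \<in> proj_space F"
    then obtain v where v: "norm v = 1" "z = pt v" using space_pt by blast
    have "(\<Sum>i\<in>UNIV. (norm (v $ i))\<^sup>2) = (norm v)\<^sup>2"
      by (simp add: norm_vec_def L2_set_def sum_nonneg)
    then show "(\<Sum>i\<in>UNIV. \<iota> z \<bullet> \<iota> (pt (axis i 1))) = 1"
      using v by (simp add: inner_axis)
    have "(\<Sum>e\<in>Basis. (\<rho> (T (scale_coordinate b e) z))\<^sup>2) = (\<Sum>e\<in>Basis. ((v $ a * conj (v $ b)) \<bullet> e)\<^sup>2)"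
      using v by (intro sum.cong) (simp_all add: rho_scale inner_mult_right conj_conj)
    also have "\<dots> = (norm (v $ a * conj (v $ b)))\<^sup>2"
      unfolding sum_Basis_inner_square power2_norm_eq_inner ..
    finally show "(\<Sum>e\<in>Basis. (\<rho> (T (scale_coordinate b e) z))\<^sup>2) = (\<iota> z \<bullet> \<iota> (pt (axis a 1))) * (\<iota> z \<bullet> \<iota> (pt (axis b 1)))"
      using v by (simp add: inner_axis norm_mult norm_conj power_mult_distrib)
    fix c s :: real assume cs: "c\<^sup>2 + s\<^sup>2 = 1"
    have "(norm (herm v (axis a (of_real c) + axis b (of_real s))))\<^sup>2
        = (norm (c *\<^sub>R conj (v $ a) + s *\<^sub>R conj (v $ b)))\<^sup>2"
      by (simp add: herm_add herm_axis of_real_def)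
    also have "\<dots> = c\<^sup>2 * (norm (v $ a))\<^sup>2 + s\<^sup>2 * (norm (v $ b))\<^sup>2 + 2 * c * s * (v $ a \<bullet> v $ b)"
      unfolding power2_norm_eq_inner
      by (simp add: inner_add_left inner_add_right inner_conj inner_commute power2_eq_square algebra_simps)
    finally show "\<iota> z \<bullet> \<iota> (pt (axis a (of_real c) + axis b (of_real s)))
        = c\<^sup>2 * (\<iota> z \<bullet> \<iota> (pt (axis a 1))) + s\<^sup>2 * (\<iota> z \<bullet> \<iota> (pt (axis b 1))) + 2 * c * s * \<rho> z"
      using v by (simp add: inner_pt nsum[OF cs] inner_axis rho_pt)
  next
    fix c s :: real assume cs: "c\<^sup>2 + s\<^sup>2 = 1"
    show "pt (axis a (of_real c) + axis b (of_real s)) \<in> proj_space F" by (rule pt_space[OF nsum[OF cs]])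
  next
    have "\<rho> (T (scale_coordinate b (-1)) z) = - \<rho> z" if z: "z \<in> proj_space F" for z :: "'d point"
    proof -
      obtain v where "norm v = 1" "z = pt v" using space_pt[OF z] by blast
      then show ?thesis by (simp add: rho_scale rho_pt)
    qed
    then show "\<exists>T. inner_isometry (proj_space F) \<iota> T \<and> T (pt (axis a 1)) = pt (axis a 1) \<and> T (pt (axis b 1)) = pt (axis b 1) \<and>
      (\<forall>z\<in>proj_space F. \<rho> (T z) = - \<rho> z)"
      using T_isom[OF unitary_scale_coordinate[of "-1" b]] scale_fix[of "-1"] by (intro exI[of _ "T (scale_coordinate b (-1))"]) simp
  next
    fix e :: 'f assume "e \<in> Basis"
    then have e: "norm e = 1" by simp
    show "inner_isometry (proj_space F) \<iota> (T (scale_coordinate b e))"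
      by (rule T_isom[OF unitary_scale_coordinate[OF e]])
    show "T (scale_coordinate b e) (pt (axis a 1)) = pt (axis a 1)" "T (scale_coordinate b e) (pt (axis b 1)) = pt (axis b 1)"
      by (rule scale_fix[OF e])+
  qed (auto simp: ab dim)
  then show ?thesis by (simp add: \<iota>_def[abs_def] \<rho>_def[abs_def] T_def[abs_def] pt_def)
qed

section \<open>The octonions as a composition algebra\<close>

lemmas oct_defs = zero_oct_def one_oct_def plus_oct_def minus_oct_def uminus_oct_def
  scaleR_oct_def times_oct_def

instantiation oct :: euclidean_space
begin

definition "inner p q = ofst p \<bullet> ofst q + osnd p \<bullet> osnd (q :: oct)"
definition "(Basis :: oct set) = (\<lambda>b. Oct b 0) ` Basis \<union> (\<lambda>b. Oct 0 b) ` Basis"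
definition "norm q = sqrt (q \<bullet> (q :: oct))"
definition "sgn q = inverse (norm q) *\<^sub>R (q :: oct)"
definition "dist p q = norm (p - q :: oct)"
definition "(uniformity :: (oct \<times> oct) filter) = (INF e\<in>{0 <..}. principal {(x, y). dist x y < e})"
definition "open (U :: oct set) \<longleftrightarrow>
  (\<forall>x\<in>U. eventually (\<lambda>(x', y). x' = x \<longrightarrow> y \<in> U) uniformity)"

instance
proof
  fix x y z :: oct and r :: real and U :: "oct set"
  show "dist x y = norm (x - y)" by (rule dist_oct_def)
  show "sgn x = inverse (norm x) *\<^sub>R x" by (rule sgn_oct_def)
  show "uniformity = (INF e\<in>{0<..}. principal {(x, y). dist (x :: oct) y < e})"
    by (rule uniformity_oct_def)
  show "open U = (\<forall>x\<in>U. \<forall>\<^sub>F (x', y) in uniformity. x' = x \<longrightarrow> y \<in> U)"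
    by (rule open_oct_def)
  show "norm x = sqrt (x \<bullet> x)" by (rule norm_oct_def)
  show "x \<bullet> y = y \<bullet> x" "(x + y) \<bullet> z = x \<bullet> z + y \<bullet> z" "r *\<^sub>R x \<bullet> y = r * (x \<bullet> y)" "0 \<le> x \<bullet> x"
    by (simp_all add: inner_oct_def oct_defs inner_commute inner_add_left inner_add_right distrib_left)
  show "x \<bullet> x = 0 \<longleftrightarrow> x = 0"
    by (cases x) (simp add: inner_oct_def oct_defs add_nonneg_eq_0_iff)
  show "(Basis :: oct set) \<noteq> {}" "finite (Basis :: oct set)"
    by (auto simp: Basis_oct_def)
  show "x \<bullet> y = (if x = y then 1 else 0)" if "x \<in> Basis" "y \<in> Basis"
    using that by (auto simp: Basis_oct_def inner_oct_def inner_Basis split: if_splits)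
  have "(\<forall>u\<in>Basis. x \<bullet> u = 0) \<longleftrightarrow> ofst x = 0 \<and> osnd x = 0"
    using euclidean_all_zero_iff[of "ofst x"] euclidean_all_zero_iff[of "osnd x"]
    by (simp add: Basis_oct_def inner_oct_def ball_Un)
  then show "(\<forall>u\<in>Basis. x \<bullet> u = 0) \<longleftrightarrow> x = 0"
    by (cases x) (simp add: oct_defs)
qed

end

lemma DIM_oct: "DIM(oct) = 8"
proof -
  have "card ((\<lambda>b. Oct b 0) ` Basis) = 4" "card ((\<lambda>b. Oct 0 b) ` Basis) = 4"
    by (subst card_image; auto simp: inj_on_def DIM_quat)+
  moreover have "(\<lambda>b. Oct b 0) ` Basis \<inter> (\<lambda>b. Oct 0 b) ` Basis = {}"
    by auto
  ultimately show ?thesis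
    unfolding Basis_oct_def by (subst card_Un_disjoint) auto
qed

section \<open>Octonion conjugation, adjoints, alternative laws and a Moufang identity\<close>

lemma oct_conj_add: "oct_conj (x + y) = oct_conj x + oct_conj y"
  and oct_conj_scaleR: "oct_conj (r *\<^sub>R x) = r *\<^sub>R oct_conj x"
  and oct_conj_conj [simp]: "oct_conj (oct_conj x) = x"
  and oct_conj_0 [simp]: "oct_conj 0 = 0"
  and oct_conj_1 [simp]: "oct_conj 1 = 1"
  by (auto simp: oct_conj_def quat_conj_def oct_defs quat_defs oct.expand quat.expand)

lemma oct_conj_diff: "oct_conj (x - y) = oct_conj x - oct_conj y"
  using oct_conj_add[of x "- y"] oct_conj_scaleR[of "-1" y] by simp

lemma oct_conj_sum: "oct_conj (\<Sum>i\<in>I. f i) = (\<Sum>i\<in>I. oct_conj (f i))"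
  by (induction I rule: infinite_finite_induct) (simp_all add: oct_conj_add)

lemma oct_mult_distrib:
  fixes x y z :: oct
  shows "(x + y) * z = x * z + y * z" "z * (x + y) = z * x + z * y"
    "(x - y) * z = x * z - y * z" "z * (x - y) = z * x - z * y"
    "(r *\<^sub>R x) * z = r *\<^sub>R (x * z)" "z * (r *\<^sub>R x) = r *\<^sub>R (z * x)"
    "0 * z = 0" "z * 0 = 0" "1 * z = z" "z * 1 = z"
proof -
  have c: "quat_conj (p + q) = quat_conj p + quat_conj q" "quat_conj (p - q) = quat_conj p - quat_conj q"
    "quat_conj (r *\<^sub>R p) = r *\<^sub>R quat_conj p" "quat_conj 0 = 0" "quat_conj 1 = 1" for p q :: quat and r
    by (simp_all add: quat_conj_def quat_defs)
  show "(x + y) * z = x * z + y * z" "z * (x + y) = z * x + z * y"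
    "(x - y) * z = x * z - y * z" "z * (x - y) = z * x - z * y"
    "(r *\<^sub>R x) * z = r *\<^sub>R (x * z)" "z * (r *\<^sub>R x) = r *\<^sub>R (z * x)"
    "0 * z = 0" "z * 0 = 0" "1 * z = z" "z * 1 = z"
    by (simp_all add: oct_defs c algebra_simps)
qed

lemma oct_sum_mult:
  fixes f :: "'i \<Rightarrow> oct"
  shows "(\<Sum>i\<in>I. f i) * z = (\<Sum>i\<in>I. f i * z)" "z * (\<Sum>i\<in>I. f i) = (\<Sum>i\<in>I. z * f i)"
  by (induction I rule: infinite_finite_induct) (simp_all add: oct_mult_distrib)

lemma oct_conj_mult: "oct_conj (x * y) = oct_conj y * oct_conj x"
proof -
  have "quat_conj (p * q) = quat_conj q * quat_conj p" "quat_conj (p - q) = quat_conj p - quat_conj q"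
    "quat_conj (- p) = - quat_conj p" "quat_conj (quat_conj p) = p" for p q :: quat
    by (simp_all add: quat_conj_def quat_defs algebra_simps)
  then show ?thesis by (simp add: oct_conj_def times_oct_def)
qed

lemma oct_inner_conj: "oct_conj x \<bullet> oct_conj y = x \<bullet> y"
  using inner_conj[of "ofst x" "ofst y"] by (simp add: oct_conj_def inner_oct_def conj_quat_def)

text \<open>Adjoints take the place of associativity: later identities are tested against a vector
  and factors are moved across the inner product. Here the four terms of the Cayley-Dickson product
  reduce to adjoints in the quaternions.\<close>

lemma oct_inner_mult_left: "(x * y) \<bullet> z = y \<bullet> (oct_conj x * z)"
proof -
  obtain a b c d e f where x: "x = Oct a b" "y = Oct c d" "z = Oct e f" by (metis oct.exhaust)
  have 1: "(a * c) \<bullet> e = c \<bullet> (conj a * e)" by (rule inner_mult_left)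
  have 2: "(d * a) \<bullet> f = d \<bullet> (f * conj a)" by (rule inner_mult_right)
  have 3: "(b * conj c) \<bullet> f = c \<bullet> (conj f * b)"
    using inner_mult_right[of b "conj c" f] inner_mult_left[of f c b] by (simp add: conj_conj inner_commute)
  have 4: "(conj d * b) \<bullet> e = d \<bullet> (b * conj e)"
    using inner_mult_left[of "conj d" b e] inner_mult_right[of d e b] by (simp add: conj_conj inner_commute)
  show ?thesis
    unfolding x using 1 2 3 4
    by (simp add: inner_oct_def times_oct_def oct_conj_def inner_diff_left inner_diff_right
        inner_add_left inner_add_right flip: conj_quat_def)
qed

lemma oct_inner_mult_right: "(x * y) \<bullet> z = x \<bullet> (z * oct_conj y)"
  using oct_inner_mult_left[of "oct_conj y" "oct_conj x" "oct_conj z"]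
    oct_inner_conj[of "x * y" z] oct_inner_conj[of x "z * oct_conj y"]
  by (simp add: oct_conj_mult)

text \<open>The mixed terms of the Cayley-Dickson product cancel by adjointness and associativity in
  the quaternions.\<close>

lemma oct_norm_mult: "(x * y) \<bullet> (x * y) = (x \<bullet> x) * (y \<bullet> (y :: oct))"
proof -
  obtain a b c d where x: "x = Oct a b" "y = Oct c d" by (metis oct.exhaust)
  have sq: "(p * q) \<bullet> (p * q) = (p \<bullet> p) * (q \<bullet> q)" for p q :: quat
    by (simp add: norm_mult power_mult_distrib flip: power2_norm_eq_inner)
  have cc: "conj p \<bullet> conj p = p \<bullet> p" for p :: quat by (rule inner_conj)
  have cross: "(a * c) \<bullet> (conj d * b) = (d * a) \<bullet> (b * conj c)"
    using inner_mult_left[of "conj d" b "a * c"] inner_mult_right[of "d * a" c b]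
    by (simp add: conj_conj inner_commute mult.assoc)
  have "(x * y) \<bullet> (x * y) = (a * c) \<bullet> (a * c) - 2 * ((a * c) \<bullet> (conj d * b)) + (conj d * b) \<bullet> (conj d * b)
     + (d * a) \<bullet> (d * a) + 2 * ((d * a) \<bullet> (b * conj c)) + (b * conj c) \<bullet> (b * conj c)"
    unfolding x by (simp add: inner_oct_def times_oct_def inner_diff_left inner_diff_right
        inner_add_left inner_add_right inner_commute flip: conj_quat_def)
  then show ?thesis
    unfolding cross sq cc by (simp add: x inner_oct_def algebra_simps)
qed

lemma oct_inner_mult_left_same: "(x * y) \<bullet> (x * z) = (x \<bullet> x) * (y \<bullet> (z :: oct))"
  using oct_norm_mult[of x "y + z"] oct_norm_mult[of x y] oct_norm_mult[of x z]
  by (simp add: oct_mult_distrib inner_add_left inner_add_right inner_commute algebra_simps)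

lemma oct_inner_mult_right_same: "(x * z) \<bullet> (y * z) = (z \<bullet> z) * (x \<bullet> (y :: oct))"
  using oct_norm_mult[of "x + y" z] oct_norm_mult[of x z] oct_norm_mult[of y z]
  by (simp add: oct_mult_distrib inner_add_left inner_add_right inner_commute algebra_simps)

text \<open>\<open>oct_norm_mult\<close> polarised in both factors.\<close>

lemma oct_inner_polar: "(x * y) \<bullet> (u * z) + (x * z) \<bullet> (u * y) = 2 * (x \<bullet> u) * (y \<bullet> (z :: oct))"
  using oct_inner_mult_left_same[of "x + u" y z] oct_inner_mult_left_same[of x y z] oct_inner_mult_left_same[of u y z]
  by (simp add: oct_mult_distrib inner_add_left inner_add_right inner_commute algebra_simps)

lemma oct_eqI: "(\<And>w. x \<bullet> w = y \<bullet> w) \<Longrightarrow> x = (y :: oct)"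
  using vector_eq_rdot[of x y] by blast

text \<open>Tested against \<open>w\<close>, the left side becomes
  \<open>(x * y) \<bullet> (x * w)\<close>, which the composition law evaluates.\<close>

lemma oct_left_alternative: "oct_conj x * (x * y) = (x \<bullet> x) *\<^sub>R y"
  by (rule oct_eqI) (simp add: oct_inner_mult_left[of "oct_conj x"] oct_inner_mult_left_same)

lemma oct_right_alternative: "(y * x) * oct_conj x = (x \<bullet> x) *\<^sub>R y"
  by (rule oct_eqI) (simp add: oct_inner_mult_right[of _ "oct_conj x"] oct_inner_mult_right_same)

lemma oct_left_alternative': "x * (oct_conj x * y) = (x \<bullet> x) *\<^sub>R y"
  using oct_left_alternative[of "oct_conj x" y] by (simp add: oct_inner_conj)

lemma oct_left_alternative_polar: "oct_conj x * (y * z) + oct_conj y * (x * z) = (2 * (x \<bullet> y)) *\<^sub>R z"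
  using oct_left_alternative[of "x + y" z] oct_left_alternative[of x z] oct_left_alternative[of y z]
  by (simp add: oct_conj_add oct_mult_distrib inner_add_left inner_add_right inner_commute algebra_simps)

lemma oct_right_alternative_polar: "(z * y) * oct_conj x + (z * x) * oct_conj y = (2 * (x \<bullet> y)) *\<^sub>R z"
  using oct_right_alternative[of z "x + y"] oct_right_alternative[of z x] oct_right_alternative[of z y]
  by (simp add: oct_conj_add oct_mult_distrib inner_add_left inner_add_right inner_commute algebra_simps)

text \<open>A Moufang identity in disguise: the right side is the expansion of
  \<open>x * (y * z) * x\<close>, and in this form no bracketing of a triple product has to be
  chosen.\<close>

lemma oct_bimultiplication:
  "(x * y) * (z * x) = (2 * ((y * z) \<bullet> oct_conj x)) *\<^sub>R x - (x \<bullet> x) *\<^sub>R oct_conj (y * z)"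
proof (rule oct_eqI)
  fix w
  have "((x * y) * (z * x)) \<bullet> w = (x * y) \<bullet> (w * (oct_conj x * oct_conj z))"
    by (simp add: oct_inner_mult_right[of "x * y"] oct_conj_mult)
  also have "\<dots> = 2 * (x \<bullet> w) * (y \<bullet> (oct_conj x * oct_conj z)) - (x * (oct_conj x * oct_conj z)) \<bullet> (w * y)"
    using oct_inner_polar[of x y w "oct_conj x * oct_conj z"] by simp
  also have "y \<bullet> (oct_conj x * oct_conj z) = (y * z) \<bullet> oct_conj x"
    by (rule oct_inner_mult_right[symmetric])
  also have "(x * (oct_conj x * oct_conj z)) \<bullet> (w * y) = (x \<bullet> x) * (oct_conj (y * z) \<bullet> w)"
    using oct_inner_mult_right[of w y "oct_conj z"]
    by (simp add: oct_left_alternative' oct_conj_mult inner_commute)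
  finally show "((x * y) * (z * x)) \<bullet> w =
      ((2 * ((y * z) \<bullet> oct_conj x)) *\<^sub>R x - (x \<bullet> x) *\<^sub>R oct_conj (y * z)) \<bullet> w"
    by (simp add: inner_diff_left)
qed

lemma oct_re_eq: "oct_re x = 1 \<bullet> x"
  by (simp add: oct_re_def inner_oct_def oct_defs inner_quat_def quat_defs inner_complex_def)

lemma oct_re_mult: "oct_re (x * y) = oct_conj x \<bullet> y"
  using oct_inner_mult_left[of x y 1] by (simp add: oct_re_eq inner_commute oct_mult_distrib)

lemma oct_conj_mult_self: "oct_conj x * x = (x \<bullet> x) *\<^sub>R 1" "x * oct_conj x = (x \<bullet> x) *\<^sub>R 1"
  using oct_left_alternative[of x 1] oct_left_alternative'[of x 1] by (simp_all add: oct_mult_distrib)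

lemma oct_eq_conj_real:
  assumes "oct_conj x = x" shows "x = (1 \<bullet> x) *\<^sub>R 1"
proof -
  have "x + oct_conj x = (2 * (1 \<bullet> x)) *\<^sub>R 1"
    using oct_left_alternative_polar[of 1 x 1] by (simp add: oct_mult_distrib)
  then have "2 *\<^sub>R x = 2 *\<^sub>R ((1 \<bullet> x) *\<^sub>R (1 :: oct))"
    using assms by (simp add: scaleR_2)
  then show ?thesis by (simp only: scaleR_cancel_left) simp
qed

lemma oct_one_inner_one [simp]: "(1 :: oct) \<bullet> 1 = 1"
  by (simp add: inner_oct_def oct_defs inner_quat_def quat_defs inner_complex_def)

section \<open>The octonionic projective plane\<close>

lemma inner_isometry_comp:
  assumes "inner_isometry S \<iota> f" "inner_isometry S \<iota> g"
  shows "inner_isometry S \<iota> (\<lambda>x. f (g x))"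
proof -
  have "g x \<in> S" if "x \<in> S" for x
    using assms(2) that by (auto simp: inner_isometry_def bij_betw_def)
  moreover have "bij_betw (\<lambda>x. f (g x)) S S"
    using assms bij_betw_trans[of g S S f S] by (simp add: inner_isometry_def comp_def)
  ultimately show ?thesis using assms by (simp add: inner_isometry_def)
qed

lemma inner_isometry_inverse:
  assumes "inner_isometry S \<iota> f"
  shows "inner_isometry S \<iota> (inv_into S f)" and "x \<in> S \<Longrightarrow> inv_into S f (f x) = x"
proof -
  have f: "bij_betw f S S" "\<And>x y. x \<in> S \<Longrightarrow> y \<in> S \<Longrightarrow> \<iota> (f x) \<bullet> \<iota> (f y) = \<iota> x \<bullet> \<iota> y"
    using assms by (auto simp: inner_isometry_def)
  have "\<iota> (inv_into S f x) \<bullet> \<iota> (inv_into S f y) = \<iota> x \<bullet> \<iota> y" if "x \<in> S" "y \<in> S" for x y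
  proof -
    have "inv_into S f x \<in> S" "inv_into S f y \<in> S" "f (inv_into S f x) = x" "f (inv_into S f y) = y"
      using that f(1) by (auto simp: bij_betw_def inv_into_into f_inv_into_f)
    then show ?thesis using f(2)[of "inv_into S f x" "inv_into S f y"] by simp
  qed
  then show "inner_isometry S \<iota> (inv_into S f)"
    using bij_betw_inv_into[OF f(1)] by (simp add: inner_isometry_def)
  show "inv_into S f (f x) = x" if "x \<in> S"
    using that f(1) by (simp add: bij_betw_def)
qed

text \<open>\<open>unitary_pair\<close> over the reals, where equality of lines leaves a sign. The
  sign is harmless later, as \<open>real_point\<close> is even.\<close>

lemma orthogonal_matrix_pair:
  fixes p q p' q' :: "real ^ 'd"
  assumes "norm p = 1" "norm q = 1" "norm p' = 1" "norm q' = 1" "\<bar>p \<bullet> q\<bar> = \<bar>p' \<bullet> q'\<bar>"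
  shows "\<exists>Q. orthogonal_matrix Q \<and> Q *v p = p' \<and> (Q *v q = q' \<or> Q *v q = - q')"
proof -
  have herm: "herm u v = u \<bullet> v" for u v :: "real ^ 'd"
    by (simp add: hermitian_form_def conj_real_def inner_vec_def)
  obtain A where A: "unitary A" "A p = p'" "line (A q) = line q'"
    using unitary_pair[of p q p' q'] assms by (auto simp: herm)
  have lin: "linear A"
  proof
    show "A (u + v) = A u + A v" for u v using A(1) by (simp add: unitary_def)
    have "r *\<^sub>R v = vmul v r" for r and v :: "real ^ 'd" by (simp add: vmul_def vec_eq_iff)
    then show "A (r *\<^sub>R v) = r *\<^sub>R A v" for r v using A(1) by (simp add: unitary_def)
  qed
  have "orthogonal_transformation A"
    using lin A(1) by (simp add: orthogonal_transformation_def unitary_def herm)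
  then have "orthogonal_matrix (matrix A)" by (simp add: orthogonal_transformation_matrix)
  moreover have "matrix A *v v = A v" for v by (rule fun_cong[OF matrix_vector_mul(2)[OF lin]])
  moreover have "A q = q' \<or> A q = - q'"
  proof -
    have "A q \<in> line q'" using A(3) by (metis line_eq rangeI vmul_1)
    then obtain c where c: "A q = vmul q' c" by (auto simp: line_eq)
    then have "\<bar>c\<bar> = 1" using unitary_norm[OF A(1), of q] assms by (simp add: norm_vmul)
    then have "c = 1 \<or> c = - 1" by linarith
    then show ?thesis using c by (auto simp: vmul_def vec_eq_iff)
  qed
  ultimately show ?thesis using A(2) by (intro exI[of _ "matrix A"]) simp
qed

section \<open>Conjugation by real orthogonal matrices\<close>

lemma oct_hermitianD: "oct_hermitian A \<Longrightarrow> oct_conj (A $ j $ i) = A $ i $ j"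
  unfolding oct_hermitian_def by metis

text \<open>Conjugation by a real matrix is split into two actions, one on each side. The octonionic
  matrix product is not associative, but real factors pass through it, so each action can be moved
  on its own.\<close>

definition left_act :: "real ^ 'd ^ 'd \<Rightarrow> oct ^ 'd ^ 'd \<Rightarrow> oct ^ 'd ^ 'd" where
  "left_act Q A = (\<chi> i j. \<Sum>k\<in>UNIV. Q $ i $ k *\<^sub>R A $ k $ j)"

definition right_act :: "real ^ 'd ^ 'd \<Rightarrow> oct ^ 'd ^ 'd \<Rightarrow> oct ^ 'd ^ 'd" where
  "right_act Q A = (\<chi> i j. \<Sum>k\<in>UNIV. Q $ j $ k *\<^sub>R A $ i $ k)"

definition real_conjugation :: "real ^ 'd ^ 'd \<Rightarrow> oct ^ 'd ^ 'd \<Rightarrow> oct ^ 'd ^ 'd" where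
  "real_conjugation Q A = left_act Q (right_act Q A)"

lemma left_right_commute: "left_act Q (right_act R A) = right_act R (left_act Q A)"
proof -
  have "(\<Sum>k\<in>UNIV. Q $ i $ k *\<^sub>R (\<Sum>l\<in>UNIV. R $ j $ l *\<^sub>R A $ k $ l))
      = (\<Sum>l\<in>UNIV. R $ j $ l *\<^sub>R (\<Sum>k\<in>UNIV. Q $ i $ k *\<^sub>R A $ k $ l))" for i j
    unfolding scaleR_sum_right by (subst sum.swap) (simp add: mult.commute)
  then show ?thesis by (simp add: left_act_def right_act_def vec_eq_iff)
qed

lemma left_act_mult: "oct_mat_mult (left_act Q A) B = left_act Q (oct_mat_mult A B)"
proof -
  have "(\<Sum>k\<in>UNIV. (\<Sum>m\<in>UNIV. Q $ i $ m *\<^sub>R A $ m $ k) * B $ k $ j)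
      = (\<Sum>m\<in>UNIV. Q $ i $ m *\<^sub>R (\<Sum>k\<in>UNIV. A $ m $ k * B $ k $ j))" for i j
    unfolding scaleR_sum_right oct_sum_mult oct_mult_distrib by (rule sum.swap)
  then show ?thesis by (simp add: left_act_def oct_mat_mult_def vec_eq_iff)
qed

lemma right_act_mult: "oct_mat_mult A (right_act Q B) = right_act Q (oct_mat_mult A B)"
proof -
  have "(\<Sum>k\<in>UNIV. A $ i $ k * (\<Sum>m\<in>UNIV. Q $ j $ m *\<^sub>R B $ k $ m))
      = (\<Sum>m\<in>UNIV. Q $ j $ m *\<^sub>R (\<Sum>k\<in>UNIV. A $ i $ k * B $ k $ m))" for i j
    unfolding scaleR_sum_right oct_sum_mult oct_mult_distrib by (rule sum.swap)
  then show ?thesis by (simp add: right_act_def oct_mat_mult_def vec_eq_iff)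
qed

lemma orthogonal_columns:
  fixes Q :: "real ^ 'd ^ 'd"
  assumes "orthogonal_matrix Q"
  shows "(\<Sum>k\<in>UNIV. Q $ k $ m * Q $ k $ n) = (if m = n then 1 else 0)"
proof -
  have "(transpose Q ** Q) $ m $ n = mat 1 $ m $ n" using assms by (simp add: orthogonal_matrix)
  then show ?thesis by (simp add: matrix_matrix_mult_def transpose_def mat_def)
qed

text \<open>Orthogonality of the columns of \<open>Q\<close>, summed against an arbitrary
  \<open>f\<close>; products and traces are both instances.\<close>

lemma orthogonal_double_sum:
  fixes Q :: "real ^ 'd ^ 'd" and f :: "'d \<Rightarrow> 'd \<Rightarrow> 'a::real_vector"
  assumes "orthogonal_matrix Q"
  shows "(\<Sum>k\<in>UNIV. \<Sum>m\<in>UNIV. \<Sum>n\<in>UNIV. (Q $ k $ m * Q $ k $ n) *\<^sub>R f m n) = (\<Sum>m\<in>UNIV. f m m)"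
proof -
  have "(\<Sum>k\<in>UNIV. \<Sum>m\<in>UNIV. \<Sum>n\<in>UNIV. (Q $ k $ m * Q $ k $ n) *\<^sub>R f m n)
      = (\<Sum>m\<in>UNIV. \<Sum>k\<in>UNIV. \<Sum>n\<in>UNIV. (Q $ k $ m * Q $ k $ n) *\<^sub>R f m n)"
    by (rule sum.swap)
  also have "\<dots> = (\<Sum>m\<in>UNIV. \<Sum>n\<in>UNIV. \<Sum>k\<in>UNIV. (Q $ k $ m * Q $ k $ n) *\<^sub>R f m n)"
    by (rule sum.cong[OF refl]) (rule sum.swap)
  also have "\<dots> = (\<Sum>m\<in>UNIV. \<Sum>n\<in>UNIV. (if m = n then 1 else 0) *\<^sub>R f m n)"
    unfolding scaleR_sum_left[symmetric] orthogonal_columns[OF assms] ..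
  also have "\<dots> = (\<Sum>m\<in>UNIV. f m m)"
    by (intro sum.cong refl) (simp add: if_distrib[of "\<lambda>x. x *\<^sub>R _"] cong: if_cong)
  finally show ?thesis .
qed

lemma right_left_mult:
  assumes "orthogonal_matrix Q"
  shows "oct_mat_mult (right_act Q A) (left_act Q B) = oct_mat_mult A B"
proof -
  have "(\<Sum>k\<in>UNIV. (\<Sum>m\<in>UNIV. Q $ k $ m *\<^sub>R A $ i $ m) * (\<Sum>n\<in>UNIV. Q $ k $ n *\<^sub>R B $ n $ j))
      = (\<Sum>k\<in>UNIV. A $ i $ k * B $ k $ j)" for i j
    unfolding oct_sum_mult(2) unfolding oct_sum_mult(1) oct_mult_distrib(6) unfolding oct_mult_distrib(5) scaleR_sum_right scaleR_scaleR
    by (rule orthogonal_double_sum[OF assms])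
  then show ?thesis by (simp add: left_act_def right_act_def oct_mat_mult_def vec_eq_iff)
qed

lemma real_conjugation_mult:
  assumes "orthogonal_matrix Q"
  shows "oct_mat_mult (real_conjugation Q A) (real_conjugation Q B) = real_conjugation Q (oct_mat_mult A B)"
  unfolding real_conjugation_def left_act_mult
  by (simp add: left_right_commute right_act_mult right_left_mult[OF assms])

lemma real_conjugation_nth:
  "real_conjugation Q A $ i $ j = (\<Sum>k\<in>UNIV. \<Sum>l\<in>UNIV. (Q $ i $ k * Q $ j $ l) *\<^sub>R A $ k $ l)"
  by (simp add: real_conjugation_def left_act_def right_act_def scaleR_sum_right)

lemma real_conjugation_trace:
  assumes "orthogonal_matrix Q"
  shows "oct_trace (real_conjugation Q A) = oct_trace A"
  unfolding oct_trace_def real_conjugation_nth by (rule orthogonal_double_sum[OF assms])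

lemma real_conjugation_hermitian:
  assumes "oct_hermitian A"
  shows "oct_hermitian (real_conjugation Q A)"
  unfolding oct_hermitian_def
proof (intro allI)
  fix i j
  have "oct_conj (real_conjugation Q A $ j $ i) = (\<Sum>k\<in>UNIV. \<Sum>l\<in>UNIV. (Q $ j $ k * Q $ i $ l) *\<^sub>R A $ l $ k)"
    unfolding real_conjugation_nth oct_conj_sum oct_conj_scaleR
    by (simp add: oct_hermitianD[OF assms])
  also have "\<dots> = real_conjugation Q A $ i $ j"
    unfolding real_conjugation_nth by (subst sum.swap) (simp add: mult.commute)
  finally show "real_conjugation Q A $ i $ j = oct_conj (real_conjugation Q A $ j $ i)" ..
qed

lemma jordan_mult_self: "jordan_mult A A = oct_mat_mult A A"
  by (simp add: jordan_mult_def flip: scaleR_2)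

lemma real_conjugation_point:
  assumes "orthogonal_matrix Q" "P \<in> oct_points"
  shows "real_conjugation Q P \<in> oct_points"
  using assms by (simp add: oct_points_def jordan_mult_self real_conjugation_mult
      real_conjugation_trace real_conjugation_hermitian)

lemma left_act_inverse:
  assumes "orthogonal_matrix Q"
  shows "left_act (transpose Q) (left_act Q A) = A"
proof -
  have "(\<Sum>k\<in>UNIV. Q $ k $ i *\<^sub>R (\<Sum>m\<in>UNIV. Q $ k $ m *\<^sub>R A $ m $ j)) = A $ i $ j" for i j
  proof -
    have "(\<Sum>k\<in>UNIV. Q $ k $ i *\<^sub>R (\<Sum>m\<in>UNIV. Q $ k $ m *\<^sub>R A $ m $ j))
        = (\<Sum>m\<in>UNIV. \<Sum>k\<in>UNIV. (Q $ k $ i * Q $ k $ m) *\<^sub>R A $ m $ j)"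
      unfolding scaleR_sum_right by (subst sum.swap) simp
    also have "\<dots> = (\<Sum>m\<in>UNIV. (if i = m then 1 else 0) *\<^sub>R A $ m $ j)"
      unfolding scaleR_sum_left[symmetric] orthogonal_columns[OF assms] ..
    finally show ?thesis by (simp add: if_distrib[of "\<lambda>x. x *\<^sub>R _"] cong: if_cong)
  qed
  then show ?thesis by (simp add: left_act_def transpose_def vec_eq_iff)
qed

lemma right_act_inverse:
  assumes "orthogonal_matrix Q"
  shows "right_act (transpose Q) (right_act Q A) = A"
proof -
  have "(\<Sum>k\<in>UNIV. Q $ k $ j *\<^sub>R (\<Sum>m\<in>UNIV. Q $ k $ m *\<^sub>R A $ i $ m)) = A $ i $ j" for i j
  proof -
    have "(\<Sum>k\<in>UNIV. Q $ k $ j *\<^sub>R (\<Sum>m\<in>UNIV. Q $ k $ m *\<^sub>R A $ i $ m))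
        = (\<Sum>m\<in>UNIV. \<Sum>k\<in>UNIV. (Q $ k $ j * Q $ k $ m) *\<^sub>R A $ i $ m)"
      unfolding scaleR_sum_right by (subst sum.swap) simp
    also have "\<dots> = (\<Sum>m\<in>UNIV. (if j = m then 1 else 0) *\<^sub>R A $ i $ m)"
      unfolding scaleR_sum_left[symmetric] orthogonal_columns[OF assms] ..
    finally show ?thesis by (simp add: if_distrib[of "\<lambda>x. x *\<^sub>R _"] cong: if_cong)
  qed
  then show ?thesis by (simp add: right_act_def transpose_def vec_eq_iff)
qed

lemma real_conjugation_inverse:
  assumes "orthogonal_matrix Q"
  shows "real_conjugation (transpose Q) (real_conjugation Q A) = A"
proof -
  have "real_conjugation (transpose Q) (real_conjugation Q A)
      = right_act (transpose Q) (left_act (transpose Q) (left_act Q (right_act Q A)))"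
    by (simp add: real_conjugation_def left_right_commute)
  then show ?thesis by (simp add: left_act_inverse[OF assms] right_act_inverse[OF assms])
qed

text \<open>With a Hermitian left factor the real part of the trace of a product is a sum of
  entrywise inner products. The trace form of the Albert algebra is thus Euclidean, and a point
  serves as its own embedding.\<close>

lemma oct_inner_eq_trace:
  assumes "oct_hermitian P" "oct_hermitian Q"
  shows "oct_re (oct_trace (jordan_mult P Q)) = P \<bullet> Q"
proof -
  have re: "oct_re (x + y) = oct_re x + oct_re y" "oct_re (r *\<^sub>R x) = r * oct_re x"
    "oct_re (\<Sum>i\<in>I. f i) = (\<Sum>i\<in>I. oct_re (f i))" for x y r I and f :: "'d \<Rightarrow> oct"
    by (simp_all add: oct_re_eq inner_add_right inner_sum_right)
  have *: "oct_re (\<Sum>i\<in>UNIV. oct_mat_mult A B $ i $ i) = A \<bullet> B" if "oct_hermitian A" for A B :: "oct ^ 'd ^ 'd"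
  proof -
    have "oct_re (\<Sum>i\<in>UNIV. oct_mat_mult A B $ i $ i) = (\<Sum>i\<in>UNIV. \<Sum>k\<in>UNIV. oct_conj (A $ i $ k) \<bullet> B $ k $ i)"
      by (simp add: re oct_mat_mult_def oct_re_mult)
    also have "\<dots> = (\<Sum>i\<in>UNIV. \<Sum>k\<in>UNIV. A $ k $ i \<bullet> B $ k $ i)"
      by (simp add: oct_hermitianD[OF that])
    also have "\<dots> = A \<bullet> B" unfolding inner_vec_def by (rule sum.swap)
    finally show ?thesis .
  qed
  have "oct_re (oct_trace (jordan_mult P Q)) = (1 / 2) * (P \<bullet> Q + Q \<bullet> P)"
    unfolding *[OF assms(1), symmetric] *[OF assms(2), symmetric]
    by (simp add: oct_trace_def jordan_mult_def re sum.distrib flip: scaleR_sum_right)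
  then show ?thesis by (simp add: inner_commute)
qed

abbreviation oct_isom :: "(oct ^ 'd ^ 'd \<Rightarrow> oct ^ 'd ^ 'd) \<Rightarrow> bool" where
  "oct_isom \<equiv> inner_isometry oct_points (\<lambda>P. P)"

lemma oct_isom_real_conjugation:
  fixes Q :: "real ^ 'd ^ 'd"
  assumes Q: "orthogonal_matrix Q"
  shows "oct_isom (real_conjugation Q)"
proof -
  have Q': "orthogonal_matrix (transpose Q)" using Q by simp
  have "bij_betw (real_conjugation Q) oct_points oct_points"
  proof (rule bij_betw_byWitness[where f' = "real_conjugation (transpose Q)"])
    show "\<forall>P\<in>oct_points. real_conjugation (transpose Q) (real_conjugation Q P) = P"
      using real_conjugation_inverse[OF Q] by blast
    show "\<forall>P\<in>oct_points. real_conjugation Q (real_conjugation (transpose Q) P) = P"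
      using real_conjugation_inverse[OF Q'] by simp
  qed (use real_conjugation_point[OF Q] real_conjugation_point[OF Q'] in blast)+
  moreover have "real_conjugation Q P \<bullet> real_conjugation Q P' = P \<bullet> P'" if "P \<in> oct_points" "P' \<in> oct_points" for P P'
  proof -
    have h: "oct_hermitian P" "oct_hermitian P'" using that by (auto simp: oct_points_def)
    have "jordan_mult (real_conjugation Q P) (real_conjugation Q P') = real_conjugation Q (jordan_mult P P')"
      unfolding jordan_mult_def real_conjugation_mult[OF Q]
      by (simp add: vec_eq_iff real_conjugation_nth scaleR_sum_right scaleR_add_right sum.distrib mult.commute)
    then show ?thesis
      using oct_inner_eq_trace[OF h] oct_inner_eq_trace[OF h[THEN real_conjugation_hermitian], of Q Q]
      by (simp add: real_conjugation_trace[OF Q])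
  qed
  ultimately show ?thesis by (simp add: inner_isometry_def)
qed

section \<open>Points with real entries\<close>

definition real_point :: "real ^ 'd \<Rightarrow> oct ^ 'd ^ 'd" where
  "real_point w = (\<chi> i j. (w $ i * w $ j) *\<^sub>R 1)"

lemma real_point_minus: "real_point (- w) = real_point w"
  by (simp add: real_point_def)

lemma real_point_in:
  assumes "norm w = 1" shows "real_point w \<in> oct_points"
proof -
  have w: "(\<Sum>k\<in>UNIV. w $ k * w $ k) = 1"
    using assms by (simp add: norm_eq_1 inner_vec_def)
  have "(\<Sum>k\<in>UNIV. (w $ i * w $ k * (w $ k * w $ j)) *\<^sub>R (1 :: oct)) = (w $ i * w $ j) *\<^sub>R 1" for i j
  proof -
    have "(\<Sum>k\<in>UNIV. w $ i * w $ k * (w $ k * w $ j)) = (w $ i * w $ j) * (\<Sum>k\<in>UNIV. w $ k * w $ k)"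
      by (simp add: sum_distrib_left mult_ac)
    then show ?thesis by (simp add: w flip: scaleR_sum_left)
  qed
  then have "oct_mat_mult (real_point w) (real_point w) = real_point w"
    by (simp add: oct_mat_mult_def real_point_def vec_eq_iff oct_mult_distrib mult.commute)
  moreover have "oct_trace (real_point w) = 1"
    by (simp add: oct_trace_def real_point_def w flip: scaleR_sum_left)
  moreover have "oct_hermitian (real_point w)"
    by (simp add: oct_hermitian_def real_point_def oct_conj_scaleR mult.commute)
  ultimately show ?thesis by (simp add: oct_points_def jordan_mult_self)
qed

lemma inner_real_point:
  "P \<bullet> real_point w = (\<Sum>i\<in>UNIV. \<Sum>j\<in>UNIV. w $ i * w $ j * (1 \<bullet> P $ i $ j))"
  by (simp add: inner_vec_def real_point_def inner_commute)

lemma inner_real_point_real_point: "real_point v \<bullet> real_point w = (v \<bullet> w)\<^sup>2"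
  unfolding inner_real_point
  by (simp add: real_point_def inner_vec_def power2_eq_square sum_product mult_ac)

lemma real_conjugation_real_point: "real_conjugation Q (real_point w) = real_point (Q *v w)"
  by (simp add: vec_eq_iff real_conjugation_nth real_point_def matrix_vector_mult_def
      sum_product mult_ac flip: scaleR_sum_left)

lemma oct_isom_inner:
  "oct_isom f \<Longrightarrow> P \<in> oct_points \<Longrightarrow> P' \<in> oct_points \<Longrightarrow> f P \<bullet> f P' = P \<bullet> P'"
  by (simp add: inner_isometry_def)

text \<open>The index type is known only to have three elements, so they are named. The rotated
  instance carries constructions over to another off-diagonal entry.\<close>

locale index_triple =
  fixes a b c :: "'d::finite"
  assumes distinct: "a \<noteq> b" "b \<noteq> c" "a \<noteq> c" and UNIV: "UNIV = {a, b, c}"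
begin

lemma sum3: "(\<Sum>i\<in>UNIV. f i) = f a + f b + (f c :: 'z::comm_monoid_add)"
  unfolding UNIV using distinct by (simp add: add.assoc)

lemma all3: "(\<forall>i. Q i) \<longleftrightarrow> Q a \<and> Q b \<and> Q c"
proof -
  have "(\<forall>i. Q i) \<longleftrightarrow> (\<forall>i\<in>UNIV. Q i)" by simp
  then show ?thesis unfolding UNIV by simp
qed

lemma rotate: "index_triple b c a"
  using distinct UNIV by unfold_locales auto

text \<open>Coordinates of the Albert algebra. With \<open>x\<close>, \<open>y\<close>,
  \<open>z\<close> at \<open>b, c\<close>, at \<open>c, a\<close> and at \<open>a, b\<close>, the
  equations of a point are invariant under cyclic permutation.\<close>

definition hermitian3 :: "real \<Rightarrow> real \<Rightarrow> real \<Rightarrow> oct \<Rightarrow> oct \<Rightarrow> oct \<Rightarrow> oct ^ 'd ^ 'd" where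
  "hermitian3 r s t x y z = (\<chi> i j.
     if i = a then if j = a then r *\<^sub>R 1 else if j = b then z else oct_conj y
     else if i = b then if j = a then oct_conj z else if j = b then s *\<^sub>R 1 else x
     else if j = a then y else if j = b then oct_conj x else t *\<^sub>R 1)"

lemma hermitian3_nth [simp]:
  "hermitian3 r s t x y z $ a $ a = r *\<^sub>R 1" "hermitian3 r s t x y z $ b $ b = s *\<^sub>R 1" "hermitian3 r s t x y z $ c $ c = t *\<^sub>R 1"
  "hermitian3 r s t x y z $ b $ c = x" "hermitian3 r s t x y z $ c $ b = oct_conj x"
  "hermitian3 r s t x y z $ c $ a = y" "hermitian3 r s t x y z $ a $ c = oct_conj y"
  "hermitian3 r s t x y z $ a $ b = z" "hermitian3 r s t x y z $ b $ a = oct_conj z"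
  using distinct by (auto simp: hermitian3_def)

lemma matrix_eqI:
  assumes "A $ a $ a = B $ a $ a" "A $ b $ b = B $ b $ b" "A $ c $ c = B $ c $ c"
    "A $ b $ c = B $ b $ c" "A $ c $ b = B $ c $ b" "A $ c $ a = B $ c $ a" "A $ a $ c = B $ a $ c"
    "A $ a $ b = B $ a $ b" "A $ b $ a = B $ b $ a"
  shows "A = B"
  using assms by (simp add: vec_eq_iff all3)

lemma oct_hermitian_hermitian3: "oct_hermitian (hermitian3 r s t x y z)"
  unfolding oct_hermitian_def all3 by (simp add: oct_conj_scaleR)

lemma inner_hermitian3:
  "hermitian3 r s t x y z \<bullet> hermitian3 r' s' t' x' y' z' = r * r' + s * s' + t * t' + 2 * (x \<bullet> x' + y \<bullet> y' + z \<bullet> z')"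
  by (simp add: inner_vec_def sum3 oct_inner_conj)

text \<open>For trace 1, idempotency amounts to the vanishing of the 2 by 2 minors, that is, to rank
  one. The diagonal entries of the squared matrix give a linear system for the three squared norms;
  in an off-diagonal entry, 1 minus two diagonal coefficients is the third.\<close>

lemma hermitian3_point_iff:
  "hermitian3 r s t x y z \<in> oct_points \<longleftrightarrow> r + s + t = 1 \<and> s * t = x \<bullet> x \<and> t * r = y \<bullet> y \<and> r * s = z \<bullet> z \<and>
    y * z = r *\<^sub>R oct_conj x \<and> z * x = s *\<^sub>R oct_conj y \<and> x * y = t *\<^sub>R oct_conj z"
  (is "?P \<in> oct_points \<longleftrightarrow> ?R")
proof
  have entries: "oct_mat_mult A B $ i $ j = A $ i $ a * B $ a $ j + A $ i $ b * B $ b $ j + A $ i $ c * B $ c $ j"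
    for A B :: "oct ^ 'd ^ 'd" and i j
    by (simp add: oct_mat_mult_def sum3)
  have one: "u *\<^sub>R 1 = v *\<^sub>R (1 :: oct) \<longleftrightarrow> u = v" for u v
    by (metis inner_scaleR_right mult.right_neutral oct_one_inner_one)
  note simps = oct_mult_distrib oct_conj_mult_self oct_conj_scaleR
  {
    assume "?P \<in> oct_points"
    then have sq: "oct_mat_mult ?P ?P = ?P" and "oct_trace ?P = 1"
      by (auto simp: oct_points_def jordan_mult_self)
    then have "(r + s + t) *\<^sub>R 1 = 1 *\<^sub>R (1 :: oct)"
      by (simp add: oct_trace_def sum3 scaleR_add_left)
    then have sum: "r + s + t = 1" unfolding one .
    have "oct_mat_mult ?P ?P $ a $ a = ?P $ a $ a" "oct_mat_mult ?P ?P $ b $ b = ?P $ b $ b"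
      "oct_mat_mult ?P ?P $ c $ c = ?P $ c $ c"
      unfolding sq by simp_all
    then have "(r * r + z \<bullet> z + y \<bullet> y) *\<^sub>R 1 = r *\<^sub>R (1 :: oct)" "(z \<bullet> z + s * s + x \<bullet> x) *\<^sub>R 1 = s *\<^sub>R (1 :: oct)"
      "(y \<bullet> y + x \<bullet> x + t * t) *\<^sub>R 1 = t *\<^sub>R (1 :: oct)"
      unfolding entries hermitian3_nth by (simp_all add: simps scaleR_add_left)
    then have diag: "r * r + z \<bullet> z + y \<bullet> y = r" "z \<bullet> z + s * s + x \<bullet> x = s" "y \<bullet> y + x \<bullet> x + t * t = t"
      unfolding one by auto
    have r: "r = 1 - s - t" using sum by simp
    have "2 * (s * t) = 2 * (x \<bullet> x)" "2 * (t * r) = 2 * (y \<bullet> y)" "2 * (r * s) = 2 * (z \<bullet> z)"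
      using diag unfolding r by (auto simp: algebra_simps)
    then have norms: "s * t = x \<bullet> x" "t * r = y \<bullet> y" "r * s = z \<bullet> z" by auto
    have "oct_mat_mult ?P ?P $ c $ b = ?P $ c $ b" "oct_mat_mult ?P ?P $ a $ c = ?P $ a $ c"
      "oct_mat_mult ?P ?P $ b $ a = ?P $ b $ a"
      unfolding sq by simp_all
    then have off: "y * z = (1 - s - t) *\<^sub>R oct_conj x" "z * x = (1 - r - t) *\<^sub>R oct_conj y" "x * y = (1 - r - s) *\<^sub>R oct_conj z"
      unfolding entries hermitian3_nth by (simp_all add: simps algebra_simps)
    have "1 - s - t = r" "1 - r - t = s" "1 - r - s = t" using sum by auto
    then show ?R using sum norms off by simp
  next
    assume R: ?R
    then have sum: "r + s + t = 1" and norms: "s * t = x \<bullet> x" "t * r = y \<bullet> y" "r * s = z \<bullet> z"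
      and off: "y * z = r *\<^sub>R oct_conj x" "z * x = s *\<^sub>R oct_conj y" "x * y = t *\<^sub>R oct_conj z" by auto
    have off': "oct_conj z * oct_conj y = r *\<^sub>R x" "oct_conj x * oct_conj z = s *\<^sub>R y" "oct_conj y * oct_conj x = t *\<^sub>R z"
      using off[THEN arg_cong, of oct_conj] by (simp_all add: oct_conj_mult oct_conj_scaleR)
    have diag: "r * r + z \<bullet> z + y \<bullet> y = r" "z \<bullet> z + s * s + x \<bullet> x = s" "y \<bullet> y + x \<bullet> x + t * t = t"
    proof -
      have "r * r + z \<bullet> z + y \<bullet> y = r * (r + s + t)" "z \<bullet> z + s * s + x \<bullet> x = s * (r + s + t)"
        "y \<bullet> y + x \<bullet> x + t * t = t * (r + s + t)"
        using norms by (auto simp: algebra_simps)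
      then show "r * r + z \<bullet> z + y \<bullet> y = r" "z \<bullet> z + s * s + x \<bullet> x = s" "y \<bullet> y + x \<bullet> x + t * t = t"
        by (simp_all add: sum)
    qed
    have sc: "r *\<^sub>R v + (s *\<^sub>R v + t *\<^sub>R v) = v" for v :: oct
      using sum by (metis add.assoc scaleR_add_left scaleR_one)
    have "oct_mat_mult ?P ?P = ?P"
    proof (rule matrix_eqI; unfold entries hermitian3_nth)
      show "r *\<^sub>R 1 * r *\<^sub>R 1 + z * oct_conj z + oct_conj y * y = r *\<^sub>R 1"
        by (subst (3) diag(1)[symmetric]) (simp add: simps scaleR_add_left)
      show "oct_conj z * z + s *\<^sub>R 1 * s *\<^sub>R 1 + x * oct_conj x = s *\<^sub>R 1"
        by (subst (3) diag(2)[symmetric]) (simp add: simps scaleR_add_left)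
      show "y * oct_conj y + oct_conj x * x + t *\<^sub>R 1 * t *\<^sub>R 1 = t *\<^sub>R 1"
        by (subst (3) diag(3)[symmetric]) (simp add: simps scaleR_add_left)
    qed (use sc in \<open>simp_all add: simps off off' add_ac\<close>)
    moreover have "oct_trace ?P = 1"
      using sum by (simp add: oct_trace_def sum3 flip: scaleR_add_left)
    ultimately show "?P \<in> oct_points"
      by (simp add: oct_points_def jordan_mult_self oct_hermitian_hermitian3)
  }
qed

lemma hermitian_eq_hermitian3:
  assumes "oct_hermitian P"
  shows "P = hermitian3 (1 \<bullet> P $ a $ a) (1 \<bullet> P $ b $ b) (1 \<bullet> P $ c $ c) (P $ b $ c) (P $ c $ a) (P $ a $ b)"
proof -
  note h = oct_hermitianD[OF assms]
  have d: "(1 \<bullet> P $ i $ i) *\<^sub>R 1 = P $ i $ i" for i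
    by (rule oct_eq_conj_real[symmetric]) (rule h)
  show ?thesis by (rule matrix_eqI) (simp_all add: d h)
qed

lemma point_cases:
  assumes "P \<in> oct_points"
  obtains r s t x y z where "P = hermitian3 r s t x y z" "r + s + t = 1" "s * t = x \<bullet> x" "t * r = y \<bullet> y" "r * s = z \<bullet> z"
    "y * z = r *\<^sub>R oct_conj x" "z * x = s *\<^sub>R oct_conj y" "x * y = t *\<^sub>R oct_conj z" "0 \<le> r" "0 \<le> s" "0 \<le> t"
proof -
  define r s t x y z where d: "r = 1 \<bullet> P $ a $ a" "s = 1 \<bullet> P $ b $ b" "t = 1 \<bullet> P $ c $ c"
    "x = P $ b $ c" "y = P $ c $ a" "z = P $ a $ b"
  have P: "P = hermitian3 r s t x y z"
    unfolding d using assms by (intro hermitian_eq_hermitian3) (simp add: oct_points_def)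
  have R: "r + s + t = 1 \<and> s * t = x \<bullet> x \<and> t * r = y \<bullet> y \<and> r * s = z \<bullet> z \<and>
    y * z = r *\<^sub>R oct_conj x \<and> z * x = s *\<^sub>R oct_conj y \<and> x * y = t *\<^sub>R oct_conj z"
    using assms unfolding P hermitian3_point_iff .
  \<comment> \<open>Multiplying the trace equation by a diagonal entry exhibits that entry as a sum
    of squares, hence as nonnegative.\<close>
  have "r = r * (r + s + t)" "s = s * (r + s + t)" "t = t * (r + s + t)" using R by simp_all
  then have "r = r * r + z \<bullet> z + y \<bullet> y" "s = s * s + z \<bullet> z + x \<bullet> x" "t = t * t + x \<bullet> x + y \<bullet> y"
    using R by (auto simp: algebra_simps)
  then have "0 \<le> r" "0 \<le> s" "0 \<le> t"
    by (metis add_nonneg_nonneg inner_ge_zero zero_le_square)+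
  then show ?thesis using that P R by blast
qed

text \<open>
  For a unit octonion \<open>q\<close> the first off-diagonal entry is mapped to \<open>oct_conj q * x * oct_conj q\<close>,
  written without a triple product.  The Moufang identities make this a symmetry.
\<close>

definition twist :: "oct \<Rightarrow> oct ^ 'd ^ 'd \<Rightarrow> oct ^ 'd ^ 'd" where
  "twist q P = hermitian3 (1 \<bullet> P $ a $ a) (1 \<bullet> P $ b $ b) (1 \<bullet> P $ c $ c)
     ((2 * (P $ b $ c \<bullet> q)) *\<^sub>R oct_conj q - oct_conj (P $ b $ c)) (q * P $ c $ a) (P $ a $ b * q)"

lemma twist_hermitian3: "twist q (hermitian3 r s t x y z) = hermitian3 r s t ((2 * (x \<bullet> q)) *\<^sub>R oct_conj q - oct_conj x) (q * y) (z * q)"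
  by (simp add: twist_def)

text \<open>The map is conjugation after the isometry that fixes \<open>q\<close> and negates its
  orthogonal complement.\<close>

lemma inner_twisted:
  fixes q x x' :: oct
  assumes "q \<bullet> q = 1"
  shows "((2 * (x \<bullet> q)) *\<^sub>R oct_conj q - oct_conj x) \<bullet> ((2 * (x' \<bullet> q)) *\<^sub>R oct_conj q - oct_conj x') = x \<bullet> x'"
  using assms by (simp add: inner_diff_left inner_diff_right oct_inner_conj inner_commute)

text \<open>The equation for \<open>y * z\<close> is preserved by
  \<open>oct_bimultiplication\<close>. In the other two, \<open>q\<close> meets its conjugate, and
  the polarised alternative laws settle them.\<close>

lemma twist_point:
  assumes q: "q \<bullet> q = 1" and P: "P \<in> oct_points"
  shows "twist q P \<in> oct_points"
  using P
proof (cases rule: point_cases)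
  case (1 r s t x y z)
  define x' where "x' = (2 * (x \<bullet> q)) *\<^sub>R oct_conj q - oct_conj x"
  have cx': "oct_conj x' = (2 * (x \<bullet> q)) *\<^sub>R q - x"
    by (simp add: x'_def oct_conj_diff oct_conj_scaleR)
  have "(q * y) * (z * q) = (2 * ((y * z) \<bullet> oct_conj q)) *\<^sub>R q - oct_conj (y * z)"
    using q by (simp add: oct_bimultiplication)
  also have "\<dots> = r *\<^sub>R oct_conj x'"
    by (simp add: 1 cx' oct_inner_conj oct_conj_scaleR scaleR_diff_right mult_ac)
  finally have m1: "(q * y) * (z * q) = r *\<^sub>R oct_conj x'" .
  have "(z * q) * x' = (2 * (x \<bullet> q)) *\<^sub>R ((z * q) * oct_conj q) - (z * q) * oct_conj x"
    by (simp add: x'_def oct_mult_distrib)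
  also have "\<dots> = (2 * (x \<bullet> q)) *\<^sub>R z - (z * q) * oct_conj x"
    using q by (simp add: oct_right_alternative)
  also have "\<dots> = (z * x) * oct_conj q"
    using oct_right_alternative_polar[of z x q] by (simp add: inner_commute algebra_simps)
  finally have m2: "(z * q) * x' = s *\<^sub>R oct_conj (q * y)"
    by (simp add: 1 oct_mult_distrib oct_conj_mult)
  have "x' * (q * y) = (2 * (x \<bullet> q)) *\<^sub>R (oct_conj q * (q * y)) - oct_conj x * (q * y)"
    by (simp add: x'_def oct_mult_distrib)
  also have "\<dots> = (2 * (x \<bullet> q)) *\<^sub>R y - oct_conj x * (q * y)"
    using q by (simp add: oct_left_alternative)
  also have "\<dots> = oct_conj q * (x * y)"
    using oct_left_alternative_polar[of x q y] by (simp add: inner_commute algebra_simps)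
  finally have m3: "x' * (q * y) = t *\<^sub>R oct_conj (z * q)"
    by (simp add: 1 oct_mult_distrib oct_conj_mult)
  have "x' \<bullet> x' = x \<bullet> x" unfolding x'_def by (rule inner_twisted[OF q])
  then show ?thesis
    unfolding 1(1) twist_hermitian3 x'_def[symmetric] hermitian3_point_iff using q 1 m1 m2 m3
    by (simp add: oct_norm_mult)
qed

lemma twist_inverse:
  assumes q: "q \<bullet> q = 1" and P: "P \<in> oct_points"
  shows "twist (oct_conj q) (twist q P) = P"
  using P
proof (cases rule: point_cases)
  case (1 r s t x y z)
  have "oct_conj q * (q * y) = y" "(z * q) * oct_conj q = z"
    using q by (simp_all add: oct_left_alternative oct_right_alternative)
  moreover have "((2 * (x \<bullet> q)) *\<^sub>R oct_conj q - oct_conj x) \<bullet> oct_conj q = x \<bullet> q"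
    using q by (simp add: inner_diff_left oct_inner_conj)
  ultimately show ?thesis
    unfolding 1(1) twist_hermitian3 by (simp add: oct_conj_diff oct_conj_scaleR)
qed

lemma oct_isom_twist:
  assumes q: "q \<bullet> q = 1"
  shows "oct_isom (twist q)"
proof -
  have q': "oct_conj q \<bullet> oct_conj q = 1" using q by (simp add: oct_inner_conj)
  have "bij_betw (twist q) oct_points oct_points"
  proof (rule bij_betw_byWitness[where f' = "twist (oct_conj q)"])
    show "\<forall>P\<in>oct_points. twist (oct_conj q) (twist q P) = P" using twist_inverse[OF q] by blast
    show "\<forall>P\<in>oct_points. twist q (twist (oct_conj q) P) = P" using twist_inverse[OF q'] by simp
  qed (use twist_point[OF q] twist_point[OF q'] in blast)+
  moreover have "twist q P \<bullet> twist q P' = P \<bullet> P'" if pts: "P \<in> oct_points" "P' \<in> oct_points" for P P'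
  proof -
    obtain r s t x y z where P: "P = hermitian3 r s t x y z" by (rule point_cases[OF pts(1)]) (rule that)
    obtain r' s' t' x' y' z' where P': "P' = hermitian3 r' s' t' x' y' z'" by (rule point_cases[OF pts(2)]) (rule that)
    show ?thesis
      unfolding P P' twist_hermitian3 inner_hermitian3 inner_twisted[OF q] using q
      by (simp add: oct_inner_mult_left_same oct_inner_mult_right_same)
  qed
  ultimately show ?thesis by (simp add: inner_isometry_def)
qed

lemma real_point_axis:
  "real_point (axis a 1) = hermitian3 1 0 0 0 0 0" "real_point (axis b 1) = hermitian3 0 1 0 0 0 0"
  "real_point (axis c 1) = hermitian3 0 0 1 0 0 0"
  using distinct by (auto intro!: matrix_eqI simp: real_point_def axis_def)

lemma twist_axis: "twist q (real_point (axis i 1)) = real_point (axis i 1)"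
proof -
  have "\<forall>i. twist q (real_point (axis i 1)) = real_point (axis i 1)"
    unfolding all3 real_point_axis twist_hermitian3 by (simp add: oct_mult_distrib)
  then show ?thesis by blast
qed

lemma unit_multiplier: "\<exists>q. q \<bullet> q = 1 \<and> x * q = norm x *\<^sub>R (1 :: oct)"
proof (cases "x = 0")
  case True
  then show ?thesis by (intro exI[of _ 1]) (simp add: oct_mult_distrib)
next
  case False
  define q where "q = (1 / norm x) *\<^sub>R oct_conj x"
  have "x \<bullet> x = norm x * norm x" by (simp add: power2_eq_square flip: power2_norm_eq_inner)
  then show ?thesis
    using False by (intro exI[of _ q]) (simp add: q_def oct_mult_distrib oct_conj_mult_self oct_inner_conj)
qed

text \<open>
  A twist makes the entry at \<open>b, c\<close> real.  A rotation in the coordinates \<open>b, c\<close> then annihilates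
  the entry at \<open>c, c\<close>, and a further twist makes the only remaining off-diagonal entry real.
\<close>

lemma reduce_to_real:
  assumes P: "P \<in> oct_points"
  shows "\<exists>f w. oct_isom f \<and> f (real_point (axis a 1)) = real_point (axis a 1) \<and> norm w = 1 \<and> f P = real_point w"
proof -
  \<comment> \<open>For the rotated triple it is the entry at \<open>b, c\<close> that is multiplied
    by \<open>q\<close> on the right.\<close>
  interpret r: index_triple b c a by (rule rotate)
  have final: "\<exists>f w. oct_isom f \<and> f (real_point (axis a 1)) = real_point (axis a 1) \<and> norm w = 1 \<and> f P' = real_point w"
    if P': "P' \<in> oct_points" and cc: "1 \<bullet> P' $ c $ c = 0" for P'
    using P'
  proof (cases rule: point_cases)
    case (1 r s t x y z)
    \<comment> \<open>A zero at \<open>c, c\<close> forces the rest of its row to vanish, because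
      \<open>x \<bullet> x = s * t\<close> and \<open>y \<bullet> y = t * r\<close>.\<close>
    have "t = 0" using cc 1(1) by simp
    then have xy: "x = 0" "y = 0" and rs: "r + s = 1" using 1 by auto
    obtain q where q: "q \<bullet> q = 1" "z * q = norm z *\<^sub>R (1 :: oct)" using unit_multiplier by blast
    define w where "w = axis a (sqrt r) + axis b (sqrt s)"
    have "norm z = sqrt r * sqrt s"
      using 1(5) by (simp add: norm_eq_sqrt_inner flip: real_sqrt_mult)
    then have "twist q P' = real_point w"
      unfolding 1(1) twist_hermitian3 q(2) xy \<open>t = 0\<close> using distinct 1
      by (intro matrix_eqI) (auto simp: real_point_def w_def axis_def oct_mult_distrib oct_conj_scaleR mult.commute)
    moreover have "norm w = 1"
      unfolding w_def using norm_sum_axis[OF distinct(1), of "sqrt r" "sqrt s", where 'f = real] rs 1 by simp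
    ultimately show ?thesis using oct_isom_twist[OF q(1)] twist_axis by blast
  qed
  obtain q where q: "q \<bullet> q = 1" "P $ b $ c * q = norm (P $ b $ c) *\<^sub>R (1 :: oct)" using unit_multiplier by blast
  define P1 where "P1 = r.twist q P"
  have iso1: "oct_isom (r.twist q)" "r.twist q (real_point (axis a 1)) = real_point (axis a 1)"
    using r.oct_isom_twist[OF q(1)] r.twist_axis by auto
  have P1: "P1 \<in> oct_points" unfolding P1_def by (rule r.twist_point[OF q(1) P])
  have real: "P1 $ b $ c = norm (P $ b $ c) *\<^sub>R 1" by (simp add: P1_def r.twist_def q(2))
  obtain r s t x y z where m: "P1 = hermitian3 r s t x y z" "r + s + t = 1" "s * t = x \<bullet> x" "t * r = y \<bullet> y" "r * s = z \<bullet> z"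
     "0 \<le> r" "0 \<le> s" "0 \<le> t" by (rule point_cases[OF P1]) (rule that, assumption+)
  have x: "x = sqrt (s * t) *\<^sub>R 1"
  proof -
    have x: "x = norm (P $ b $ c) *\<^sub>R 1" using real m(1) by simp
    then have "sqrt (s * t) = norm (P $ b $ c)" using m(3) by (simp add: real_sqrt_mult)
    then show ?thesis using x by simp
  qed
  show ?thesis
  proof (cases "s + t = 0")
    \<comment> \<open>The direction \<open>v\<close> of the other case would be undefined here, but
      the entry at \<open>c, c\<close> is already zero.\<close>
    case True
    then have "t = 0" using m by simp
    then obtain f w where "oct_isom f" "f (real_point (axis a 1)) = real_point (axis a 1)" "norm w = 1" "f P1 = real_point w"
      using final[OF P1] m(1) by auto
    then show ?thesis
      using inner_isometry_comp[of _ _ f "r.twist q"] iso1 by (intro exI[of _ "\<lambda>P. f (r.twist q P)"] exI[of _ w]) (simp add: P1_def)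
  next
    case False
    \<comment> \<open>The block of \<open>P1\<close> at \<open>b, c\<close> is the rank-one matrix
      of the vector with coordinates \<open>sqrt s\<close> and \<open>sqrt t\<close>, and
      \<open>v\<close> is its direction. Sending \<open>v\<close> to the axis \<open>b\<close>
      leaves no component at \<open>c\<close>, and the new entry at \<open>c, c\<close> is a
      multiple of the square of that component.\<close>
    define v where "v = (1 / sqrt (s + t)) *\<^sub>R (axis b (sqrt s) + axis c (sqrt t))"
    have st: "s + t > 0" using False m by simp
    have "norm (axis b (sqrt s) + axis c (sqrt t)) = sqrt (s + t)"
      using norm_sum_axis[OF distinct(2), of "sqrt s" "sqrt t", where 'f = real] m by simp
    then have "norm v = 1" using st by (simp add: v_def)
    moreover have "axis a 1 \<bullet> v = 0" "axis a 1 \<bullet> axis b (1 :: real) = 0"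
      using distinct by (simp_all add: v_def inner_add_right inner_axis_axis)
    ultimately obtain Q where Q: "orthogonal_matrix Q" "Q *v axis a 1 = axis a 1" "Q *v v = axis b 1 \<or> Q *v v = - axis b 1"
      using orthogonal_matrix_pair[of "axis a 1" v "axis a 1" "axis b 1"] by auto
    have "(Q *v v) $ c = 0" using Q(3) distinct by (auto simp: axis_def)
    moreover have "(Q *v v) $ c = (1 / sqrt (s + t)) * (Q $ c $ b * sqrt s + Q $ c $ c * sqrt t)"
      using distinct by (simp add: matrix_vector_mult_def v_def axis_def sum3 algebra_simps add_divide_distrib)
    ultimately have v0: "Q $ c $ b * sqrt s + Q $ c $ c * sqrt t = 0" using st by simp
    have "(Q *v axis a 1) $ c = 0" using Q(2) distinct by (simp add: axis_def)
    then have Qa: "Q $ c $ a = 0" using distinct by (simp add: matrix_vector_mult_def axis_def sum3)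
    define P2 where "P2 = real_conjugation Q P1"
    have iso2: "oct_isom (real_conjugation Q)" by (rule oct_isom_real_conjugation[OF Q(1)])
    have P2: "P2 \<in> oct_points" unfolding P2_def by (rule real_conjugation_point[OF Q(1) P1])
    have "1 \<bullet> P2 $ c $ c = Q $ c $ b * Q $ c $ b * s + 2 * (Q $ c $ b * Q $ c $ c * sqrt (s * t)) + Q $ c $ c * Q $ c $ c * t"
      by (simp add: P2_def real_conjugation_nth sum3 Qa m(1) x inner_add_right oct_conj_scaleR mult.commute)
    also have "\<dots> = (Q $ c $ b * sqrt s + Q $ c $ c * sqrt t)\<^sup>2"
      using m(7,8) by (simp add: power2_sum power_mult_distrib real_sqrt_mult) (simp add: power2_eq_square)
    finally have "1 \<bullet> P2 $ c $ c = 0" using v0 by simp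
    then obtain f w where f: "oct_isom f" "f (real_point (axis a 1)) = real_point (axis a 1)" "norm w = 1" "f P2 = real_point w"
      using final[OF P2] by blast
    have "oct_isom (\<lambda>P. f (real_conjugation Q (r.twist q P)))"
      by (intro inner_isometry_comp[OF f(1)] inner_isometry_comp[OF iso2] iso1)
    then show ?thesis
      using f iso1 Q(2) by (intro exI[of _ "\<lambda>P. f (real_conjugation Q (r.twist q P))"] exI[of _ w])
        (simp add: P2_def P1_def real_conjugation_real_point)
  qed
qed

text \<open>\<open>P\<close> is made real and then rotated to the axis \<open>a\<close>. Since
  \<open>reduce_to_real\<close> fixes that axis point, it can afterwards treat the image of
  \<open>P'\<close> without disturbing \<open>P\<close>.\<close>

lemma oct_pair_canonical:
  assumes "P \<in> oct_points" "P' \<in> oct_points"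
  shows "\<exists>f w. oct_isom f \<and> f P = real_point (axis a 1) \<and> norm w = 1 \<and> f P' = real_point w"
proof -
  obtain f w where f: "oct_isom f" "norm w = 1" "f P = real_point w"
    using reduce_to_real[OF assms(1)] by blast
  obtain Q where Q: "orthogonal_matrix Q" "Q *v w = axis a 1"
    using orthogonal_matrix_pair[of w w "axis a 1" "axis a 1"] f(2) by (auto simp: norm_eq_1)
  define g where "g P = real_conjugation Q (f P)" for P
  have g: "oct_isom g" unfolding g_def by (rule inner_isometry_comp[OF oct_isom_real_conjugation[OF Q(1)] f(1)])
  have gP: "g P = real_point (axis a 1)" by (simp add: g_def f(3) real_conjugation_real_point Q(2))
  have "g P' \<in> oct_points" using g assms(2) by (auto simp: inner_isometry_def bij_betw_def)
  then obtain h v where h: "oct_isom h" "h (real_point (axis a 1)) = real_point (axis a 1)" "norm v = 1" "h (g P') = real_point v"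
    using reduce_to_real by blast
  then show ?thesis
    using inner_isometry_comp[OF h(1) g] gP by (intro exI[of _ "\<lambda>P. h (g P)"] exI[of _ v]) simp
qed

text \<open>Both pairs are brought to canonical form. This leaves two real unit vectors whose
  products with the axis agree up to sign, which a real orthogonal matrix settles; the second
  reduction is then undone.\<close>

lemma oct_two_point:
  fixes P P' R R' :: "oct ^ 'd ^ 'd"
  assumes "P \<in> oct_points" "P' \<in> oct_points" "R \<in> oct_points" "R' \<in> oct_points" "P \<bullet> P' = R \<bullet> R'"
  shows "\<exists>f. oct_isom f \<and> f P = R \<and> f P' = R'"
proof -
  let ?o = "real_point (axis a 1) :: oct ^ 'd ^ 'd"
  obtain f w where f: "oct_isom f" "f P = ?o" "norm w = 1" "f P' = real_point w"
    using oct_pair_canonical[OF assms(1,2)] by blast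
  obtain g v where g: "oct_isom g" "g R = ?o" "norm v = 1" "g R' = real_point v"
    using oct_pair_canonical[OF assms(3,4)] by blast
  have "P \<bullet> P' = (axis a 1 \<bullet> w)\<^sup>2" "R \<bullet> R' = (axis a 1 \<bullet> v)\<^sup>2"
    using oct_isom_inner[OF f(1) assms(1,2)] oct_isom_inner[OF g(1) assms(3,4)] f(2,4) g(2,4)
    by (simp_all add: inner_real_point_real_point)
  then have "\<bar>axis a 1 \<bullet> w\<bar> = \<bar>axis a 1 \<bullet> v\<bar>" using assms(5) by (metis power2_eq_iff abs_minus_cancel)
  then obtain Q where Q: "orthogonal_matrix Q" "Q *v axis a 1 = axis a 1" "Q *v w = v \<or> Q *v w = - v"
    using orthogonal_matrix_pair[of "axis a 1" w "axis a 1" v] f(3) g(3) by auto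
  have Qo: "real_conjugation Q ?o = ?o" by (simp add: real_conjugation_real_point Q(2))
  have Qw: "real_conjugation Q (real_point w) = real_point v"
    using Q(3) by (auto simp: real_conjugation_real_point real_point_minus)
  let ?g = "inv_into oct_points g"
  have "oct_isom (\<lambda>P. ?g (real_conjugation Q (f P)))"
    by (intro inner_isometry_comp[OF inner_isometry_inverse(1)[OF g(1)]]
        inner_isometry_comp[OF oct_isom_real_conjugation[OF Q(1)]] f(1))
  moreover have "?g (real_conjugation Q (f P)) = R"
    using inner_isometry_inverse(2)[OF g(1) assms(3)] by (simp add: f(2) Qo g(2))
  moreover have "?g (real_conjugation Q (f P')) = R'"
    using inner_isometry_inverse(2)[OF g(1) assms(4)] by (simp add: f(4) Qw g(4))
  ultimately show ?thesis by blast
qed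

end

section \<open>The octonionic model and the four cases of the theorem\<close>

fun oct_matrix :: "'d::finite point \<Rightarrow> oct ^ 'd ^ 'd" where
  "oct_matrix (Oct_Point P) = P"
| "oct_matrix _ = 0"

lemma (in index_triple) projective_model_oct:
  "projective_model Oct_Scalars oct_matrix (\<lambda>i. Oct_Point (real_point (axis i 1))) a b
    (\<lambda>r s. Oct_Point (real_point (axis a r + axis b s))) (\<lambda>p. 1 \<bullet> oct_matrix p $ a $ b)
    (\<lambda>q p. Oct_Point (twist q (oct_matrix p))) (Basis :: oct set)"
proof -
  have isom: "inner_isometry (proj_space Oct_Scalars) oct_matrix (\<lambda>p. Oct_Point (f (oct_matrix p)))"
    if f: "oct_isom f" for f :: "oct ^ 'd ^ 'd \<Rightarrow> oct ^ 'd ^ 'd"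
  proof -
    have bij: "inj_on f oct_points" "f ` oct_points = oct_points"
      using f by (auto simp: inner_isometry_def bij_betw_def)
    have "inj_on (\<lambda>p. Oct_Point (f (oct_matrix p))) (Oct_Point ` oct_points)"
      using bij(1) by (auto simp: inj_on_def)
    moreover have "(\<lambda>p. Oct_Point (f (oct_matrix p))) ` Oct_Point ` oct_points = Oct_Point ` oct_points"
      by (simp add: image_image) (metis bij(2) image_image)
    ultimately show ?thesis using f by (auto simp: inner_isometry_def bij_betw_def)
  qed
  have axis_in: "real_point (axis i 1) \<in> oct_points" for i :: 'd by (intro real_point_in) simp
  have inner_axis: "P \<bullet> real_point (axis i 1) = 1 \<bullet> P $ i $ i" for P :: "oct ^ 'd ^ 'd" and i :: 'd
    unfolding inner_real_point by (simp add: axis_def if_distrib[of "\<lambda>x. x * _"] if_distrib[of "\<lambda>x. _ * x"] cong: if_cong)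
  \<comment> \<open>Nonnegativity is not visible from the matrix entries; in canonical form the
    inner product is the square of a real one.\<close>
  have basic: "0 \<le> P \<bullet> P'" "P \<bullet> P = 1" if P: "P \<in> oct_points" and P': "P' \<in> oct_points" for P P' :: "oct ^ 'd ^ 'd"
  proof -
    obtain f w where f: "oct_isom f" "f P = real_point (axis a 1)" "norm w = 1" "f P' = real_point w"
      using oct_pair_canonical[OF P P'] by blast
    have "P \<bullet> P' = (axis a 1 \<bullet> w)\<^sup>2" "P \<bullet> P = (axis a 1 \<bullet> axis a (1 :: real))\<^sup>2"
      using oct_isom_inner[OF f(1) P P'] oct_isom_inner[OF f(1) P P] f(2,4)
      by (simp_all add: inner_real_point_real_point inner_axis_axis)
    then show "0 \<le> P \<bullet> P'" "P \<bullet> P = 1" by (simp_all add: inner_axis_axis)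
  qed
  have twist_entry: "1 \<bullet> twist q P $ a $ b = oct_conj (P $ a $ b) \<bullet> q" for q P
    by (simp add: twist_def flip: oct_re_mult oct_re_eq)
  show ?thesis
  proof unfold_locales
    fix p p' :: "'d point" assume p: "p \<in> proj_space Oct_Scalars" and p': "p' \<in> proj_space Oct_Scalars"
    then obtain P P' where P: "P \<in> oct_points" "p = Oct_Point P" and P': "P' \<in> oct_points" "p' = Oct_Point P'"
      by auto
    have "oct_hermitian P" "oct_hermitian P'" using P P' by (auto simp: oct_points_def)
    then show "proj_dist p p' = arccos (sqrt (oct_matrix p \<bullet> oct_matrix p'))"
      by (simp add: P P' oct_angle_def oct_inner_eq_trace)
    show "norm (oct_matrix p) = 1" using basic(2)[OF P(1) P(1)] by (simp add: P norm_eq_1)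
    show "0 \<le> oct_matrix p \<bullet> oct_matrix p'" using basic(1)[OF P(1) P'(1)] by (simp add: P P')
    fix r r' :: "'d point" assume r: "r \<in> proj_space Oct_Scalars" and r': "r' \<in> proj_space Oct_Scalars"
      and eq: "oct_matrix p \<bullet> oct_matrix p' = oct_matrix r \<bullet> oct_matrix r'"
    then obtain R R' where R: "R \<in> oct_points" "r = Oct_Point R" and R': "R' \<in> oct_points" "r' = Oct_Point R'"
      by auto
    obtain f where f: "oct_isom f" "f P = R" "f P' = R'"
      using oct_two_point[OF P(1) P'(1) R(1) R'(1)] eq by (auto simp: P P' R R')
    then show "\<exists>T. inner_isometry (proj_space Oct_Scalars) oct_matrix T \<and> T p = r \<and> T p' = r'"
      using isom[OF f(1)] by (intro exI[of _ "\<lambda>p. Oct_Point (f (oct_matrix p))"]) (simp add: P P' R R')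
  next
    fix i j :: 'd
    show "Oct_Point (real_point (axis i 1)) \<in> proj_space Oct_Scalars" using axis_in by simp
    show "oct_matrix (Oct_Point (real_point (axis i 1))) \<bullet> oct_matrix (Oct_Point (real_point (axis j 1))) = 0" if "i \<noteq> j"
      using that by (simp add: inner_real_point_real_point inner_axis_axis)
  next
    fix p :: "'d point" assume "p \<in> proj_space Oct_Scalars"
    then obtain P where P: "P \<in> oct_points" "p = Oct_Point P" by auto
    then obtain r s t x y z where m: "P = hermitian3 r s t x y z" "r + s + t = 1" "r * s = z \<bullet> z" using point_cases by metis
    show "(\<Sum>i\<in>UNIV. oct_matrix p \<bullet> oct_matrix (Oct_Point (real_point (axis i 1)))) = 1"
      using m(2) by (simp add: P inner_axis sum3 m(1))
    \<comment> \<open>The real parts of the twisted entries are the coordinates of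
      \<open>oct_conj z\<close>, so their squares sum to the squared norm of \<open>z\<close>, which
      is \<open>r * s\<close>.\<close>
    have "(\<Sum>q\<in>Basis. (1 \<bullet> oct_matrix (Oct_Point (twist q (oct_matrix p))) $ a $ b)\<^sup>2) = oct_conj z \<bullet> oct_conj z"
      by (simp add: P twist_entry m(1) sum_Basis_inner_square)
    then show "(\<Sum>q\<in>Basis. (1 \<bullet> oct_matrix (Oct_Point (twist q (oct_matrix p))) $ a $ b)\<^sup>2)
      = (oct_matrix p \<bullet> oct_matrix (Oct_Point (real_point (axis a 1)))) * (oct_matrix p \<bullet> oct_matrix (Oct_Point (real_point (axis b 1))))"
      using m(3) by (simp add: P inner_axis m(1) oct_inner_conj)
    fix u v :: real assume "u\<^sup>2 + v\<^sup>2 = 1"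
    have "1 \<bullet> oct_conj z = 1 \<bullet> z" using oct_inner_conj[of 1 z] by simp
    then show "oct_matrix p \<bullet> oct_matrix (Oct_Point (real_point (axis a u + axis b v))) =
        u\<^sup>2 * (oct_matrix p \<bullet> oct_matrix (Oct_Point (real_point (axis a 1)))) +
        v\<^sup>2 * (oct_matrix p \<bullet> oct_matrix (Oct_Point (real_point (axis b 1)))) + 2 * u * v * (1 \<bullet> oct_matrix p $ a $ b)"
      using distinct by (simp add: P inner_axis) (simp add: inner_real_point sum3 axis_def m(1) power2_eq_square algebra_simps)
  next
    fix u v :: real assume "u\<^sup>2 + v\<^sup>2 = 1"
    then show "Oct_Point (real_point (axis a u + axis b v)) \<in> proj_space Oct_Scalars"
      using norm_sum_axis[OF distinct(1), of u v, where 'f = real] by (auto intro!: real_point_in)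
  next
    have "1 \<bullet> twist (-1) P $ a $ b = - (1 \<bullet> P $ a $ b)" for P
      using oct_inner_conj[of "P $ a $ b" 1] by (simp add: twist_entry inner_commute)
    then show "\<exists>T. inner_isometry (proj_space Oct_Scalars) oct_matrix T \<and>
      T (Oct_Point (real_point (axis a 1))) = Oct_Point (real_point (axis a 1)) \<and>
      T (Oct_Point (real_point (axis b 1))) = Oct_Point (real_point (axis b 1)) \<and>
      (\<forall>z\<in>proj_space Oct_Scalars. 1 \<bullet> oct_matrix (T z) $ a $ b = - (1 \<bullet> oct_matrix z $ a $ b))"
      using isom[OF oct_isom_twist[of "-1"]]
      by (intro exI[of _ "\<lambda>p. Oct_Point (twist (-1) (oct_matrix p))"]) (simp add: twist_axis)
  next
    fix q :: oct assume "q \<in> Basis"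
    then have "q \<bullet> q = 1" by (simp add: inner_Basis)
    then show "inner_isometry (proj_space Oct_Scalars) oct_matrix (\<lambda>p. Oct_Point (twist q (oct_matrix p)))"
      by (intro isom oct_isom_twist)
  qed (simp_all add: twist_axis DIM_oct distinct)
qed

lemma index_triple_exists:
  assumes "CARD('d::finite) = 3"
  shows "\<exists>a b c :: 'd. index_triple a b c"
proof -
  obtain a b c :: 'd where "UNIV = {a, b, c}" "a \<noteq> b" "b \<noteq> c" "a \<noteq> c"
    using assms by (auto simp: card_3_iff)
  then have "index_triple a b c" by unfold_locales
  then show ?thesis by blast
qed

theorem theorem1:
  fixes F :: scalars
    and \<sigma> :: "'d::finite point measure"
    and X :: "nat \<Rightarrow> 'd point set"
  assumes "CARD('d) \<ge> 2"
    and "F = Oct_Scalars \<Longrightarrow> CARD('d) = 3"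
    and "surface_measure F \<sigma>"
    and "\<And>N. finite (X N)"
    and "\<And>N. X N \<subseteq> proj_space F"
    and "filterlim (\<lambda>N. card (X N)) at_top sequentially"
    and "hyperuniform_large_balls F \<sigma> X"
  shows "uniformly_distributed F \<sigma> X \<and>
    (\<forall>n\<ge>1. (\<lambda>N. (\<Sum>x\<in>X N. \<Sum>y\<in>X N.
        jacobi_poly n (jacobi_alpha F CARD('d)) (jacobi_beta F) (cos (2 * proj_dist x y)))
      / real (card (X N))) \<longlonglongrightarrow> 0)"
proof -
  obtain a b :: 'd where ab: "a \<noteq> b"
    using assms(1) card_le_Suc0_iff_eq[of "UNIV :: 'd set"] by fastforce
  show ?thesis
  proof (cases F)
    case Real_Scalars
    have "inj Real_Point" "proj_space F = Real_Point ` (lines :: (real ^ 'd) set set)"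
      "\<And>L M. proj_dist (Real_Point L) (Real_Point M :: 'd point) = line_angle L M" "scalar_dim F = DIM(real)"
      by (auto simp: Real_Scalars inj_def)
    from projective_model.hyperuniform_imp_uniform[OF projective_model_lines[OF this ab] assms(3-7)]
    show ?thesis by blast
  next
    case Complex_Scalars
    have "inj Complex_Point" "proj_space F = Complex_Point ` (lines :: (complex ^ 'd) set set)"
      "\<And>L M. proj_dist (Complex_Point L) (Complex_Point M :: 'd point) = line_angle L M" "scalar_dim F = DIM(complex)"
      by (auto simp: Complex_Scalars inj_def)
    from projective_model.hyperuniform_imp_uniform[OF projective_model_lines[OF this ab] assms(3-7)]
    show ?thesis by blast
  next
    case Quat_Scalars
    have "inj Quat_Point" "proj_space F = Quat_Point ` (lines :: (quat ^ 'd) set set)"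
      "\<And>L M. proj_dist (Quat_Point L) (Quat_Point M :: 'd point) = line_angle L M" "scalar_dim F = DIM(quat)"
      by (auto simp: Quat_Scalars inj_def DIM_quat)
    from projective_model.hyperuniform_imp_uniform[OF projective_model_lines[OF this ab] assms(3-7)]
    show ?thesis by blast
  next
    case Oct_Scalars
    then obtain a b c :: 'd where "index_triple a b c"
      using index_triple_exists assms(2) by blast
    from projective_model.hyperuniform_imp_uniform
      [OF index_triple.projective_model_oct[OF this, folded Oct_Scalars] assms(3-7)]
    show ?thesis by blast
  qed
qed

end
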